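(* Let $p$ be a prime, let $k\geq 1$ be an integer, and let $\Omega\subseteq\mathbb{Q}_p$ be a Borel set of positive and finite Haar measure. If $\Omega$ $k$-tiles $\mathbb{Q}_p$ by translations, then $L^2(\Omega)$ admits a Riesz basis consisting of characters in $\widehat{\mathbb{Q}_p}$.
   Context: $\mathbb{Q}_p$ is the field of $p$-adic numbers, regarded as an additive locally compact abelian group. $\widehat{\mathbb{Q}_p}$ is the group of its characters, i.e. continuous group homomorphisms to $\mathbb{T}=\{z\in\mathbb{C}:|z|=1\}$. $L^2(\Omega)$ is taken with respect to Haar measure restricted to $\Omega$. A Borel set $\Omega\subset\mathbb{Q}_p$ $k$-tiles $\mathbb{Q}_p$ by translations if there is a translation set $T\subset\mathbb{Q}_p$ such that $\sum_{t\in T}1_\Omega(x-t)=k$ for almost every $x\in\mathbb{Q}_p$, where $1_\Omega$ is the indicator function of $\Omega$. A countable family $\{f_n\}$ in a separable Hilbert space $\mathcal{H}$ is a Riesz basis if $f_n=Te_n$ for all $n$, for some bounded invertible operator $T:\mathcal{H}\to\mathcal{H}$ and some orthonormal basis $\{e_n\}$ of $\mathcal{H}$; equivalently, $\{f_n\}$ is complete in $\mathcal{H}$ and there is $K>0$ with $\frac1K\sum_n|a_n|^2\le\|\sum_n a_nf_n\|^2\le K\sum_n|a_n|^2$ for all square-summable $\{a_n\}\subset\mathbb{C}$. Characters are viewed as elements of $L^2(\Omega)$ by restriction to $\Omega$. *)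

theory Defs
  imports "HOL-Analysis.Analysis" "Berlekamp_Zassenhaus.Finite_Field"
begin

section \<open>The p-adic absolute value on the rationals\<close>

definition padic_abs :: "nat \<Rightarrow> rat \<Rightarrow> real" where
  "padic_abs p q =
     (if q = 0 then 0
      else real p powi (int (multiplicity (int p) (snd (quotient_of q)))
                        - int (multiplicity (int p) (fst (quotient_of q)))))"

context
  fixes p :: nat
  assumes p: "prime p"
begin

lemma padic_prime_int: "prime_elem (int p)"
  using p by simp

lemma padic_p_gt_1: "real p > 1"
  using prime_gt_1_nat[OF p] by simp

lemma padic_abs_frac:
  assumes "a \<noteq> 0" "b \<noteq> 0"
  shows "padic_abs p (of_int a / of_int b) =
           real p powi (int (multiplicity (int p) b) - int (multiplicity (int p) a))"
proof -
  define q :: rat where "q = of_int a / of_int b"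
  obtain c d where cd: "quotient_of q = (c, d)" by fastforce
  have d: "d > 0" using quotient_of_denom_pos[OF cd] .
  have q: "q = of_int c / of_int d" using quotient_of_div[OF cd] .
  have q0: "q \<noteq> 0" using assms by (simp add: q_def)
  have c: "c \<noteq> 0" using q q0 by auto
  have "(of_int (a * d) :: rat) = of_int (c * b)"
    using q d assms unfolding q_def by (simp add: field_simps)
  then have "a * d = c * b" by (simp only: of_int_eq_iff)
  then have "multiplicity (int p) a + multiplicity (int p) d =
             multiplicity (int p) c + multiplicity (int p) b"
    using prime_elem_multiplicity_mult_distrib[OF padic_prime_int] assms c d
    by (metis less_irrefl)
  then show ?thesis
    using q0 by (simp add: padic_abs_def q_def[symmetric] cd) (smt (verit) of_nat_add)
qed

lemma padic_abs_0 [simp]: "padic_abs p 0 = 0"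
  by (simp add: padic_abs_def)

lemma padic_abs_pos: "q \<noteq> 0 \<Longrightarrow> padic_abs p q > 0"
  using padic_p_gt_1 by (simp add: padic_abs_def)

lemma padic_abs_nonneg [simp]: "padic_abs p q \<ge> 0"
  using padic_abs_pos[of q] by (cases "q = 0") auto

lemma rat_frac_ex: "\<exists>a b. b \<noteq> 0 \<and> q = of_int a / (of_int b :: rat)"
proof -
  obtain c d where cd: "quotient_of q = (c, d)" by fastforce
  then show ?thesis
    using quotient_of_denom_pos[OF cd] quotient_of_div[OF cd] by (intro exI[of _ c] exI[of _ d]) auto
qed

lemma padic_abs_1 [simp]: "padic_abs p 1 = 1"
  using padic_abs_frac[of 1 1] by simp

lemma padic_abs_mult: "padic_abs p (x * y) = padic_abs p x * padic_abs p y"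
proof (cases "x = 0 \<or> y = 0")
  case False
  obtain a b c d where ab: "b \<noteq> 0" "x = of_int a / of_int b"
    and cd: "d \<noteq> 0" "y = of_int c / of_int d"
    using rat_frac_ex by metis
  have ac: "a \<noteq> 0" "c \<noteq> 0" using False ab cd by auto
  have "x * y = of_int (a * c) / of_int (b * d)" using ab cd by simp
  then show ?thesis
    using ab cd ac padic_abs_frac[of "a * c" "b * d"] padic_abs_frac[of a b] padic_abs_frac[of c d]
      prime_elem_multiplicity_mult_distrib[OF padic_prime_int] padic_p_gt_1
    by (simp add: power_int_add[symmetric] algebra_simps)
qed auto

lemma padic_abs_minus [simp]: "padic_abs p (- x) = padic_abs p x"
proof -
  have "padic_abs p (- 1) = 1"
  proof -
    have "padic_abs p (- 1) * padic_abs p (- 1) = 1"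
      by (simp add: padic_abs_mult[symmetric])
    moreover have "padic_abs p (- 1) \<ge> 0"
      by (rule padic_abs_nonneg)
    ultimately show ?thesis
      by (metis abs_of_nonneg abs_mult_self_eq mult_cancel_left2 one_neq_zero real_sqrt_abs2 real_sqrt_one)
  qed
  then show ?thesis using padic_abs_mult[of "-1" x] by simp
qed

lemma padic_abs_inverse: "padic_abs p (inverse x) = inverse (padic_abs p x)"
proof (cases "x = 0")
  case False
  then have "padic_abs p x * padic_abs p (inverse x) = 1"
    by (simp add: padic_abs_mult[symmetric])
  then show ?thesis by (metis inverse_unique)
qed auto

lemma padic_abs_ultra: "padic_abs p (x + y) \<le> max (padic_abs p x) (padic_abs p y)"
proof (cases "x = 0 \<or> y = 0 \<or> x + y = 0")
  case True
  then show ?thesis by (auto simp: max_def)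
next
  case False
  obtain a b c d where ab: "b \<noteq> 0" "x = of_int a / of_int b"
    and cd: "d \<noteq> 0" "y = of_int c / of_int d"
    using rat_frac_ex by metis
  define u v w where "u = a * d" and "v = c * b" and "w = b * d"
  have w: "w \<noteq> 0" using ab cd by (simp add: w_def)
  have x: "x = of_int u / of_int w" and y: "y = of_int v / of_int w"
    and xy: "x + y = of_int (u + v) / of_int w"
    using ab cd by (simp_all add: u_def v_def w_def field_simps)
  have nz: "u \<noteq> 0" "v \<noteq> 0" "u + v \<noteq> 0" using False x y xy by auto
  define m where "m = min (multiplicity (int p) u) (multiplicity (int p) v)"
  have "int p ^ m dvd u + v"
    by (intro dvd_add multiplicity_dvd') (auto simp: m_def)
  then have le: "m \<le> multiplicity (int p) (u + v)"
    using nz p by (intro multiplicity_geI) auto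
  have "padic_abs p (x + y) \<le> real p powi (int (multiplicity (int p) w) - int m)"
    unfolding xy padic_abs_frac[OF nz(3) w]
    using le padic_p_gt_1 by (intro power_int_increasing) auto
  also have "\<dots> \<le> max (padic_abs p x) (padic_abs p y)"
    unfolding x y padic_abs_frac[OF nz(1) w] padic_abs_frac[OF nz(2) w]
    by (auto simp: m_def min_def)
  finally show ?thesis .
qed

lemma padic_abs_triangle: "padic_abs p (x + y) \<le> padic_abs p x + padic_abs p y"
  using padic_abs_ultra[of x y] padic_abs_nonneg[of x] padic_abs_nonneg[of y] by linarith

lemma padic_abs_minus_commute: "padic_abs p (x - y) = padic_abs p (y - x)"
  by (metis minus_diff_eq padic_abs_minus)

lemma padic_abs_triangle2: "\<bar>padic_abs p x - padic_abs p y\<bar> \<le> padic_abs p (x - y)"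
  using padic_abs_triangle[of "x - y" y] padic_abs_triangle[of "y - x" x]
    padic_abs_minus_commute[of x y] by simp

end


section \<open>Cauchy sequences of rationals for the p-adic absolute value\<close>

definition padic_cauchy :: "nat \<Rightarrow> (nat \<Rightarrow> rat) \<Rightarrow> bool" where
  "padic_cauchy p X \<longleftrightarrow>
     (\<forall>e>0. \<exists>N. \<forall>m\<ge>N. \<forall>n\<ge>N. padic_abs p (X m - X n) < e)"

definition padic_null :: "nat \<Rightarrow> (nat \<Rightarrow> rat) \<Rightarrow> bool" where
  "padic_null p X \<longleftrightarrow> (\<lambda>n. padic_abs p (X n)) \<longlonglongrightarrow> 0"

definition padic_rel :: "nat \<Rightarrow> (nat \<Rightarrow> rat) \<Rightarrow> (nat \<Rightarrow> rat) \<Rightarrow> bool" where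
  "padic_rel p X Y \<longleftrightarrow> padic_cauchy p X \<and> padic_cauchy p Y \<and> padic_null p (\<lambda>n. X n - Y n)"

context
  fixes p :: nat
  assumes p: "prime p"
begin

lemma padic_cauchy_const: "padic_cauchy p (\<lambda>_. c)"
  using padic_abs_0[OF p] by (simp add: padic_cauchy_def)

lemma padic_cauchy_minus: "padic_cauchy p X \<Longrightarrow> padic_cauchy p (\<lambda>n. - X n)"
proof -
  have "padic_abs p (- X m - - X n) = padic_abs p (X m - X n)" for m n
    using padic_abs_minus_commute[OF p, of "X n" "X m"] by simp
  then show "padic_cauchy p X \<Longrightarrow> padic_cauchy p (\<lambda>n. - X n)"
    by (simp only: padic_cauchy_def)
qed

lemma padic_cauchy_add:
  assumes "padic_cauchy p X" "padic_cauchy p Y"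
  shows "padic_cauchy p (\<lambda>n. X n + Y n)"
  unfolding padic_cauchy_def
proof (intro allI impI)
  fix e :: real assume "e > 0"
  then obtain M N where MN: "\<And>m n. m \<ge> M \<Longrightarrow> n \<ge> M \<Longrightarrow> padic_abs p (X m - X n) < e"
    "\<And>m n. m \<ge> N \<Longrightarrow> n \<ge> N \<Longrightarrow> padic_abs p (Y m - Y n) < e"
    using assms unfolding padic_cauchy_def by metis
  have "padic_abs p ((X m + Y m) - (X n + Y n)) < e" if "m \<ge> max M N" "n \<ge> max M N" for m n
    using padic_abs_ultra[OF p, of "X m - X n" "Y m - Y n"] MN(1)[of m n] MN(2)[of m n] that
    by (simp add: algebra_simps)
  then show "\<exists>N. \<forall>m\<ge>N. \<forall>n\<ge>N. padic_abs p ((X m + Y m) - (X n + Y n)) < e" by blast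
qed

lemma padic_abs_convergent:
  assumes "padic_cauchy p X"
  shows "convergent (\<lambda>n. padic_abs p (X n))"
proof -
  have "Cauchy (\<lambda>n. padic_abs p (X n))"
    unfolding Cauchy_def dist_real_def
    using assms padic_abs_triangle2[OF p] unfolding padic_cauchy_def by (meson le_less_trans)
  then show ?thesis by (simp add: Cauchy_convergent_iff)
qed

lemma padic_cauchy_bounded:
  assumes "padic_cauchy p X"
  obtains B where "B > 0" "\<And>n. padic_abs p (X n) < B"
proof -
  have "Bseq (\<lambda>n. padic_abs p (X n))"
    using padic_abs_convergent[OF assms] by (rule convergent_imp_Bseq)
  then obtain K where "K > 0" "\<And>n. \<bar>padic_abs p (X n)\<bar> \<le> K"
    unfolding Bseq_def by auto
  then show ?thesis
    using that[of "K + 1"] by (metis abs_le_D1 add_pos_pos less_add_one order_le_less_trans zero_less_one)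
qed

lemma padic_cauchy_mult:
  assumes X: "padic_cauchy p X" and Y: "padic_cauchy p Y"
  shows "padic_cauchy p (\<lambda>n. X n * Y n)"
  unfolding padic_cauchy_def
proof (intro allI impI)
  fix e :: real assume e: "e > 0"
  obtain A where A: "A > 0" "\<And>n. padic_abs p (X n) < A"
    using padic_cauchy_bounded[OF X] by blast
  obtain B where B: "B > 0" "\<And>n. padic_abs p (Y n) < B"
    using padic_cauchy_bounded[OF Y] by blast
  have "e / B > 0" "e / A > 0" using e A B by auto
  then obtain M N where MN: "\<And>m n. m \<ge> M \<Longrightarrow> n \<ge> M \<Longrightarrow> padic_abs p (X m - X n) < e / B"
    "\<And>m n. m \<ge> N \<Longrightarrow> n \<ge> N \<Longrightarrow> padic_abs p (Y m - Y n) < e / A"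
    using assms unfolding padic_cauchy_def by metis
  have "padic_abs p (X m * Y m - X n * Y n) < e" if "m \<ge> max M N" "n \<ge> max M N" for m n
  proof -
    have "padic_abs p (X m) * padic_abs p (Y m - Y n) < A * (e / A)"
      using MN(2)[of m n] A that padic_abs_nonneg[OF p] by (intro mult_strict_mono) auto
    moreover have "padic_abs p (X m - X n) * padic_abs p (Y n) < (e / B) * B"
      using MN(1)[of m n] B e that padic_abs_nonneg[OF p] by (intro mult_strict_mono) auto
    moreover have "X m * Y m - X n * Y n = X m * (Y m - Y n) + (X m - X n) * Y n"
      by (simp add: algebra_simps)
    ultimately show ?thesis
      using padic_abs_ultra[OF p, of "X m * (Y m - Y n)" "(X m - X n) * Y n"] A B
      by (simp add: padic_abs_mult[OF p])
  qed
  then show "\<exists>N. \<forall>m\<ge>N. \<forall>n\<ge>N. padic_abs p (X m * Y m - X n * Y n) < e" by blast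
qed

lemma padic_null_minus: "padic_null p X \<Longrightarrow> padic_null p (\<lambda>n. - X n)"
  by (simp add: padic_null_def padic_abs_minus[OF p])

lemma padic_null_add:
  assumes "padic_null p X" "padic_null p Y"
  shows "padic_null p (\<lambda>n. X n + Y n)"
proof -
  have "(\<lambda>n. padic_abs p (X n) + padic_abs p (Y n)) \<longlonglongrightarrow> 0 + 0"
    using assms unfolding padic_null_def by (rule tendsto_add)
  then have l: "(\<lambda>n. padic_abs p (X n) + padic_abs p (Y n)) \<longlonglongrightarrow> 0" by simp
  show ?thesis
    unfolding padic_null_def
  proof (rule tendsto_sandwich[OF _ _ tendsto_const l])
    show "eventually (\<lambda>n. 0 \<le> padic_abs p (X n + Y n)) sequentially"
      by (intro always_eventually allI padic_abs_nonneg[OF p])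
    show "eventually (\<lambda>n. padic_abs p (X n + Y n) \<le> padic_abs p (X n) + padic_abs p (Y n)) sequentially"
      by (intro always_eventually allI padic_abs_triangle[OF p])
  qed
qed

lemma padic_null_diff:
  "padic_null p X \<Longrightarrow> padic_null p Y \<Longrightarrow> padic_null p (\<lambda>n. X n - Y n)"
  using padic_null_add[of X "\<lambda>n. - Y n"] padic_null_minus[of Y] by simp

lemma padic_null_mult:
  assumes X: "padic_cauchy p X" and Y: "padic_null p Y"
  shows "padic_null p (\<lambda>n. X n * Y n)"
proof -
  have "(\<lambda>n. padic_abs p (X n) * padic_abs p (Y n)) \<longlonglongrightarrow> lim (\<lambda>n. padic_abs p (X n)) * 0"
    using padic_abs_convergent[OF X] Y unfolding padic_null_def
    by (intro tendsto_mult) (auto simp: convergent_LIMSEQ_iff)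
  then show ?thesis by (simp add: padic_null_def padic_abs_mult[OF p])
qed

lemma padic_cauchy_not_null:
  assumes X: "padic_cauchy p X" and nz: "\<not> padic_null p X"
  obtains b N where "b > 0" "\<And>n. n \<ge> N \<Longrightarrow> padic_abs p (X n) > b"
proof -
  define L where "L = lim (\<lambda>n. padic_abs p (X n))"
  have L: "(\<lambda>n. padic_abs p (X n)) \<longlonglongrightarrow> L"
    using padic_abs_convergent[OF X] by (simp add: L_def convergent_LIMSEQ_iff)
  have "L \<ge> 0" using L padic_abs_nonneg[OF p] by (intro LIMSEQ_le_const) auto
  moreover have "L \<noteq> 0" using L nz by (auto simp: padic_null_def)
  ultimately have "L > 0" by simp
  then have "eventually (\<lambda>n. padic_abs p (X n) > L / 2) sequentially"
    using L by (intro order_tendstoD) auto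
  then show ?thesis
    using \<open>L > 0\<close> that[of "L / 2"] by (auto simp: eventually_sequentially)
qed

lemma padic_cauchy_inverse:
  assumes X: "padic_cauchy p X" and nz: "\<not> padic_null p X"
  shows "padic_cauchy p (\<lambda>n. inverse (X n))"
  unfolding padic_cauchy_def
proof (intro allI impI)
  fix e :: real assume e: "e > 0"
  obtain b M where b: "b > 0" "\<And>n. n \<ge> M \<Longrightarrow> padic_abs p (X n) > b"
    using padic_cauchy_not_null[OF assms] by blast
  have "e * b * b > 0" using e b by simp
  then obtain N where N: "\<And>m n. m \<ge> N \<Longrightarrow> n \<ge> N \<Longrightarrow> padic_abs p (X m - X n) < e * b * b"
    using X unfolding padic_cauchy_def by metis
  have "padic_abs p (inverse (X m) - inverse (X n)) < e" if "m \<ge> max M N" "n \<ge> max M N" for m n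
  proof -
    have gt: "padic_abs p (X m) > b" "padic_abs p (X n) > b" using b that by auto
    have nz: "X m \<noteq> 0" "X n \<noteq> 0" using gt b padic_abs_0[OF p] by auto
    have "b * b < padic_abs p (X m) * padic_abs p (X n)"
      using gt b by (intro mult_strict_mono) auto
    then have "e * b * b < e * (padic_abs p (X m) * padic_abs p (X n))"
      using e by (simp add: mult.assoc)
    moreover have "padic_abs p (X m - X n) < e * b * b" using N that by simp
    ultimately have less: "padic_abs p (X m - X n) < e * (padic_abs p (X m) * padic_abs p (X n))"
      by linarith
    have "inverse (X m) - inverse (X n) = - ((X m - X n) * inverse (X m * X n))"
      using nz by (simp add: field_simps)
    then have "padic_abs p (inverse (X m) - inverse (X n)) =
               padic_abs p (X m - X n) / (padic_abs p (X m) * padic_abs p (X n))"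
      by (simp only: padic_abs_minus[OF p] padic_abs_mult[OF p] padic_abs_inverse[OF p]
          divide_inverse)
    also have "\<dots> < e"
      using less gt b by (subst pos_divide_less_eq) auto
    finally show ?thesis .
  qed
  then show "\<exists>N. \<forall>m\<ge>N. \<forall>n\<ge>N. padic_abs p (inverse (X m) - inverse (X n)) < e" by blast
qed

lemma padic_null_iff_of_rel: "padic_rel p X Y \<Longrightarrow> padic_null p X \<longleftrightarrow> padic_null p Y"
  using padic_null_add[of Y "\<lambda>n. X n - Y n"] padic_null_diff[of X "\<lambda>n. X n - Y n"]
  by (auto simp: padic_rel_def)

lemma padic_null_inverse_diff:
  assumes X: "padic_cauchy p X" "\<not> padic_null p X"
    and Y: "padic_cauchy p Y" "\<not> padic_null p Y"
    and XY: "padic_null p (\<lambda>n. X n - Y n)"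
  shows "padic_null p (\<lambda>n. inverse (X n) - inverse (Y n))"
proof -
  have "padic_null p (\<lambda>n. - ((inverse (X n) * inverse (Y n)) * (X n - Y n)))"
    by (intro padic_null_minus padic_null_mult XY padic_cauchy_mult padic_cauchy_inverse X Y)
  then have lim: "(\<lambda>n. padic_abs p (- ((inverse (X n) * inverse (Y n)) * (X n - Y n)))) \<longlonglongrightarrow> 0"
    by (simp add: padic_null_def)
  obtain a M where a: "a > 0" "\<And>n. n \<ge> M \<Longrightarrow> padic_abs p (X n) > a"
    using padic_cauchy_not_null[OF X] by blast
  obtain b N where b: "b > 0" "\<And>n. n \<ge> N \<Longrightarrow> padic_abs p (Y n) > b"
    using padic_cauchy_not_null[OF Y] by blast
  have "- ((inverse (X n) * inverse (Y n)) * (X n - Y n)) = inverse (X n) - inverse (Y n)"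
    if "n \<ge> max M N" for n
  proof -
    have "X n \<noteq> 0" "Y n \<noteq> 0" using a(2)[of n] b(2)[of n] a(1) b(1) that padic_abs_0[OF p] by auto
    then show ?thesis by (simp add: field_simps)
  qed
  then have ev: "eventually (\<lambda>n. padic_abs p (- ((inverse (X n) * inverse (Y n)) * (X n - Y n))) =
                    padic_abs p (inverse (X n) - inverse (Y n))) sequentially"
    unfolding eventually_sequentially by metis
  show ?thesis
    unfolding padic_null_def by (rule Lim_transform_eventually[OF lim ev])
qed

lemma padic_abs_lim_eq_of_rel:
  assumes "padic_rel p X Y"
  shows "lim (\<lambda>n. padic_abs p (X n)) = lim (\<lambda>n. padic_abs p (Y n))"
proof -
  have Y: "(\<lambda>n. padic_abs p (Y n)) \<longlonglongrightarrow> lim (\<lambda>n. padic_abs p (Y n))"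
    using assms padic_abs_convergent by (simp add: padic_rel_def convergent_LIMSEQ_iff)
  have "padic_null p (\<lambda>n. X n - Y n)"
    using assms by (simp add: padic_rel_def)
  then have lim: "(\<lambda>n. padic_abs p (X n - Y n)) \<longlonglongrightarrow> 0"
    by (simp only: padic_null_def)
  have "(\<lambda>n. padic_abs p (X n) - padic_abs p (Y n)) \<longlonglongrightarrow> 0"
  proof (rule Lim_null_comparison[OF _ lim])
    show "eventually (\<lambda>n. norm (padic_abs p (X n) - padic_abs p (Y n)) \<le> padic_abs p (X n - Y n)) sequentially"
      unfolding real_norm_def by (intro always_eventually allI padic_abs_triangle2[OF p])
  qed
  from tendsto_add[OF this Y] show ?thesis by (simp add: limI)
qed

lemma part_equivp_padic_rel: "part_equivp (padic_rel p)"
proof (rule part_equivpI)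
  show "\<exists>X. padic_rel p X X"
    by (intro exI[of _ "\<lambda>_. 0"])
      (simp add: padic_rel_def padic_null_def padic_cauchy_const padic_abs_0[OF p])
  show "symp (padic_rel p)"
    by (rule sympI) (simp add: padic_rel_def padic_null_def padic_abs_minus_commute[OF p])
  show "transp (padic_rel p)"
  proof (rule transpI)
    fix X Y Z assume "padic_rel p X Y" "padic_rel p Y Z"
    then show "padic_rel p X Z"
      using padic_null_add[of "\<lambda>n. X n - Y n" "\<lambda>n. Y n - Z n"] by (simp add: padic_rel_def)
  qed
qed

end


section \<open>The field of p-adic numbers\<close>

text \<open>
  The prime is carried by the type argument: \<open>'a padic\<close> is the completion of the rationals
  for the p-adic absolute value with p the cardinality of \<^typ>\<open>'a\<close>, and the class
  \<^class>\<open>prime_card\<close> says exactly that this cardinality is prime.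
\<close>

typedef (overloaded) 'a padic =
  "{X. padic_cauchy CARD('a::prime_card) X} // {(X, Y). padic_rel CARD('a) X Y}"
  morphisms Rep_padic Abs_padic
  using padic_cauchy_const[OF prime_card] by (auto simp: quotient_def)

lemma padic_rel_refl_iff: "padic_rel CARD('p::prime_card) X X \<longleftrightarrow> padic_cauchy CARD('p) X"
  by (simp add: padic_rel_def padic_null_def padic_abs_0[OF prime_card])

definition abs_padic :: "(nat \<Rightarrow> rat) \<Rightarrow> 'a::prime_card padic" where
  "abs_padic X = Abs_padic {Y. padic_rel CARD('a) X Y}"

definition rep_padic :: "'a::prime_card padic \<Rightarrow> nat \<Rightarrow> rat" where
  "rep_padic x = (SOME X. X \<in> Rep_padic x)"

definition cr_padic :: "(nat \<Rightarrow> rat) \<Rightarrow> 'a::prime_card padic \<Rightarrow> bool" where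
  "cr_padic X x \<longleftrightarrow> padic_rel CARD('a) X X \<and> abs_padic X = x"

lemma Quotient_padic:
  "Quotient (padic_rel CARD('a::prime_card)) abs_padic rep_padic (cr_padic :: _ \<Rightarrow> 'a padic \<Rightarrow> bool)"
proof -
  let ?R = "padic_rel CARD('a)"
  have sym: "?R X Y \<Longrightarrow> ?R Y X" and trans: "?R X Y \<Longrightarrow> ?R Y Z \<Longrightarrow> ?R X Z" for X Y Z
    using part_equivp_symp[OF part_equivp_padic_rel[OF prime_card[where 'a='a]]]
      part_equivp_transp[OF part_equivp_padic_rel[OF prime_card[where 'a='a]]]
    by blast+
  have Rep_abs: "Rep_padic (abs_padic X :: 'a padic) = {Y. ?R X Y}" if "?R X X" for X
    unfolding abs_padic_def
    by (rule Abs_padic_inverse) (use that in \<open>auto simp: quotient_def padic_rel_refl_iff\<close>)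
  have rep: "?R (rep_padic x) (rep_padic x) \<and> abs_padic (rep_padic x) = x" for x :: "'a padic"
  proof -
    obtain X where X: "?R X X" "Rep_padic x = {Y. ?R X Y}"
      using Rep_padic[of x] by (auto simp: quotient_def padic_rel_refl_iff)
    then have r: "?R X (rep_padic x)"
      unfolding rep_padic_def by (metis mem_Collect_eq someI)
    then have "{Y. ?R (rep_padic x) Y} = {Y. ?R X Y}"
      using sym trans by blast
    then have "abs_padic (rep_padic x) = x"
      unfolding abs_padic_def using X by (metis Rep_padic_inverse)
    then show ?thesis using r sym trans by blast
  qed
  have eq: "?R X Y \<longleftrightarrow> ?R X X \<and> ?R Y Y \<and> (abs_padic X :: 'a padic) = abs_padic Y" for X Y
  proof
    assume R: "?R X Y"
    then have "{Z. ?R X Z} = {Z. ?R Y Z}" using sym trans by blast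
    then show "?R X X \<and> ?R Y Y \<and> (abs_padic X :: 'a padic) = abs_padic Y"
      using R sym trans unfolding abs_padic_def by metis
  next
    assume "?R X X \<and> ?R Y Y \<and> (abs_padic X :: 'a padic) = abs_padic Y"
    then show "?R X Y" using Rep_abs[of X] Rep_abs[of Y] by auto
  qed
  show ?thesis
  proof (rule QuotientI)
    show "abs_padic (rep_padic x) = x" and "?R (rep_padic x) (rep_padic x)" for x :: "'a padic"
      using rep by blast+
    show "?R X Y = (?R X X \<and> ?R Y Y \<and> (abs_padic X :: 'a padic) = abs_padic Y)" for X Y
      by (rule eq)
    show "(cr_padic :: _ \<Rightarrow> 'a padic \<Rightarrow> bool) = (\<lambda>X x. ?R X X \<and> abs_padic X = x)"
      by (intro ext) (rule cr_padic_def)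
  qed
qed

setup_lifting Quotient_padic

instantiation padic :: (prime_card) field
begin

lift_definition zero_padic :: "'a padic" is "\<lambda>_. 0"
  by (simp add: padic_rel_refl_iff padic_cauchy_const[OF prime_card])

lift_definition one_padic :: "'a padic" is "\<lambda>_. 1"
  by (simp add: padic_rel_refl_iff padic_cauchy_const[OF prime_card])

lift_definition plus_padic :: "'a padic \<Rightarrow> 'a padic \<Rightarrow> 'a padic" is "\<lambda>X Y n. X n + Y n"
  unfolding padic_rel_def add_diff_add
  by (simp add: padic_cauchy_add[OF prime_card] padic_null_add[OF prime_card])

lift_definition uminus_padic :: "'a padic \<Rightarrow> 'a padic" is "\<lambda>X n. - X n"
  unfolding padic_rel_def minus_diff_minus
  by (simp only: padic_cauchy_minus[OF prime_card] padic_null_minus[OF prime_card] simp_thms)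

lift_definition times_padic :: "'a padic \<Rightarrow> 'a padic \<Rightarrow> 'a padic" is "\<lambda>X Y n. X n * Y n"
proof -
  fix X X' Y Y' :: "nat \<Rightarrow> rat"
  assume r: "padic_rel CARD('a) X X'" "padic_rel CARD('a) Y Y'"
  then have "padic_null CARD('a) (\<lambda>n. X n * (Y n - Y' n) + Y' n * (X n - X' n))"
    unfolding padic_rel_def
    by (intro padic_null_add[OF prime_card] padic_null_mult[OF prime_card]) auto
  moreover have "(\<lambda>n. X n * (Y n - Y' n) + Y' n * (X n - X' n)) = (\<lambda>n. X n * Y n - X' n * Y' n)"
    by (simp add: algebra_simps)
  ultimately show "padic_rel CARD('a) (\<lambda>n. X n * Y n) (\<lambda>n. X' n * Y' n)"
    using r by (simp add: padic_rel_def padic_cauchy_mult[OF prime_card])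
qed

lift_definition inverse_padic :: "'a padic \<Rightarrow> 'a padic"
  is "\<lambda>X. if padic_null CARD('a) X then (\<lambda>_. 0) else (\<lambda>n. inverse (X n))"
proof -
  fix X Y :: "nat \<Rightarrow> rat"
  assume r: "padic_rel CARD('a) X Y"
  note iff = padic_null_iff_of_rel[OF prime_card r]
  show "padic_rel CARD('a)
      (if padic_null CARD('a) X then (\<lambda>_. 0) else (\<lambda>n. inverse (X n)))
      (if padic_null CARD('a) Y then (\<lambda>_. 0) else (\<lambda>n. inverse (Y n)))"
  proof (cases "padic_null CARD('a) X")
    case True
    then show ?thesis
      using iff by (simp add: padic_rel_refl_iff padic_cauchy_const[OF prime_card])
  next
    case False
    then show ?thesis
      using iff r padic_cauchy_inverse[OF prime_card[where 'a='a]]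
        padic_null_inverse_diff[OF prime_card[where 'a='a]]
      by (simp add: padic_rel_def)
  qed
qed

definition minus_padic :: "'a padic \<Rightarrow> 'a padic \<Rightarrow> 'a padic" where
  "minus_padic x y = x + - y"

definition divide_padic :: "'a padic \<Rightarrow> 'a padic \<Rightarrow> 'a padic" where
  "divide_padic x y = x * inverse y"

instance
proof
  fix a b c :: "'a padic"
  note [simp] = padic_cauchy_add[OF prime_card] padic_cauchy_mult[OF prime_card]
    padic_cauchy_minus[OF prime_card] padic_cauchy_const[OF prime_card] padic_abs_0[OF prime_card]
  show "a + b + c = a + (b + c)"
    by transfer (simp add: padic_rel_def padic_null_def)
  show "a + b = b + a"
    by transfer (simp add: padic_rel_def padic_null_def)
  show "0 + a = a"
    by transfer (simp add: padic_rel_def padic_null_def)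
  show "- a + a = 0"
    by transfer (simp add: padic_rel_def padic_null_def)
  show "a - b = a + - b"
    by (simp add: minus_padic_def)
  show "a * b * c = a * (b * c)"
    by transfer (simp add: padic_rel_def padic_null_def mult.assoc)
  show "a * b = b * a"
    by transfer (simp add: padic_rel_def padic_null_def mult.commute)
  show "1 * a = a"
    by transfer (simp add: padic_rel_def padic_null_def)
  show "(a + b) * c = a * c + b * c"
    by transfer (simp add: padic_rel_def padic_null_def distrib_right)
  show "(0 :: 'a padic) \<noteq> 1"
    by transfer
      (simp add: padic_rel_def padic_null_def padic_abs_minus[OF prime_card]
        padic_abs_1[OF prime_card] LIMSEQ_const_iff)
  show "a div b = a * inverse b"
    by (simp add: divide_padic_def)
  show "inverse (0 :: 'a padic) = 0"
    by transfer (simp add: padic_rel_def padic_null_def)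
  show "inverse a * a = 1" if "a \<noteq> 0"
    using that
  proof transfer
    fix X :: "nat \<Rightarrow> rat"
    assume X: "padic_rel CARD('a) X X" and "\<not> padic_rel CARD('a) X (\<lambda>_. 0)"
    then have c: "padic_cauchy CARD('a) X" and nz: "\<not> padic_null CARD('a) X"
      by (auto simp: padic_rel_def)
    obtain b N where b: "b > 0" "\<And>n. n \<ge> N \<Longrightarrow> padic_abs CARD('a) (X n) > b"
      using padic_cauchy_not_null[OF prime_card c nz] by blast
    have "inverse (X n) * X n - 1 = 0" if "n \<ge> N" for n
    proof -
      have "X n \<noteq> 0" using b(2)[OF that] b(1) by auto
      then show ?thesis by simp
    qed
    then have ev: "eventually (\<lambda>n. padic_abs CARD('a) (inverse (X n) * X n - 1) = 0) sequentially"
      unfolding eventually_sequentially by (metis padic_abs_0[OF prime_card])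
    have "padic_null CARD('a) (\<lambda>n. inverse (X n) * X n - 1)"
      unfolding padic_null_def by (rule tendsto_eventually[OF ev])
    then show "padic_rel CARD('a)
        (\<lambda>n. (if padic_null CARD('a) X then \<lambda>_. 0 else (\<lambda>n. inverse (X n))) n * X n) (\<lambda>_. 1)"
      using c nz padic_cauchy_inverse[OF prime_card c nz] by (simp add: padic_rel_def)
  qed
qed

end

lift_definition padic_norm :: "'p::prime_card padic \<Rightarrow> real"
  is "\<lambda>X. lim (\<lambda>n. padic_abs CARD('p) (X n))"
  by (rule padic_abs_lim_eq_of_rel[OF prime_card])

lemma padic_abs_tendsto_lim:
  "padic_rel CARD('p::prime_card) X X \<Longrightarrow>
    (\<lambda>n. padic_abs CARD('p) (X n)) \<longlonglongrightarrow> lim (\<lambda>n. padic_abs CARD('p) (X n))"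
  using padic_abs_convergent[OF prime_card[where 'a='p]]
  by (simp add: padic_rel_def convergent_LIMSEQ_iff)

lemma padic_norm_eq_0_iff: "padic_norm x = 0 \<longleftrightarrow> x = 0"
proof transfer
  fix X :: "nat \<Rightarrow> rat" assume X: "padic_rel CARD('a) X X"
  show "lim (\<lambda>n. padic_abs CARD('a) (X n)) = 0 \<longleftrightarrow> padic_rel CARD('a) X (\<lambda>_. 0)"
  proof
    assume "lim (\<lambda>n. padic_abs CARD('a) (X n)) = 0"
    then have "(\<lambda>n. padic_abs CARD('a) (X n)) \<longlonglongrightarrow> 0"
      using padic_abs_tendsto_lim[OF X] by (simp only:)
    then show "padic_rel CARD('a) X (\<lambda>_. 0)"
      using X by (simp add: padic_rel_def padic_null_def padic_cauchy_const[OF prime_card])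
  next
    assume "padic_rel CARD('a) X (\<lambda>_. 0)"
    then have "(\<lambda>n. padic_abs CARD('a) (X n)) \<longlonglongrightarrow> 0"
      by (simp add: padic_rel_def padic_null_def)
    then show "lim (\<lambda>n. padic_abs CARD('a) (X n)) = 0"
      by (rule limI)
  qed
qed

lemma padic_norm_minus: "padic_norm (- x) = padic_norm x"
  by transfer (simp add: padic_abs_minus[OF prime_card])

lemma padic_norm_triangle: "padic_norm (x + y) \<le> padic_norm x + padic_norm y"
proof transfer
  fix X Y :: "nat \<Rightarrow> rat"
  assume r: "padic_rel CARD('a) X X" "padic_rel CARD('a) Y Y"
  then have "padic_rel CARD('a) (\<lambda>n. X n + Y n) (\<lambda>n. X n + Y n)"
    by (simp add: padic_rel_refl_iff padic_cauchy_add[OF prime_card])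
  note l = padic_abs_tendsto_lim[OF this]
    tendsto_add[OF padic_abs_tendsto_lim[OF r(1)] padic_abs_tendsto_lim[OF r(2)]]
  show "lim (\<lambda>n. padic_abs CARD('a) (X n + Y n)) \<le>
        lim (\<lambda>n. padic_abs CARD('a) (X n)) + lim (\<lambda>n. padic_abs CARD('a) (Y n))"
    by (rule LIMSEQ_le[OF l]) (use padic_abs_triangle[OF prime_card] in blast)
qed

instantiation padic :: (prime_card) metric_space
begin

definition dist_padic :: "'a padic \<Rightarrow> 'a padic \<Rightarrow> real" where
  "dist_padic x y = padic_norm (x - y)"

definition uniformity_padic :: "('a padic \<times> 'a padic) filter" where
  "uniformity_padic = (INF e\<in>{0<..}. principal {(x, y). dist x y < e})"

definition open_padic :: "'a padic set \<Rightarrow> bool" where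
  "open_padic U \<longleftrightarrow> (\<forall>x\<in>U. eventually (\<lambda>(x', y). x' = x \<longrightarrow> y \<in> U) uniformity)"

instance
proof
  fix x y z :: "'a padic"
  show "dist x y = 0 \<longleftrightarrow> x = y"
    by (simp add: dist_padic_def padic_norm_eq_0_iff)
  show "dist x y \<le> dist x z + dist y z"
    using padic_norm_triangle[of "x - z" "z - y"] padic_norm_minus[of "y - z"]
    by (simp add: dist_padic_def)
qed (rule uniformity_padic_def open_padic_def)+

end


section \<open>Haar measure, multi-tiling and characters\<close>

text \<open>
  On a locally compact group whose topology has a countable base, such as the p-adic numbers,
  every Borel measure that is finite on compact sets is regular, so regularity is not listed.
\<close>

definition haar_measure :: "'a::{group_add, topological_space} measure \<Rightarrow> bool" where
  "haar_measure \<mu> \<longleftrightarrow>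
     sets \<mu> = sets borel \<and>
     (\<forall>A\<in>sets borel. \<forall>a. emeasure \<mu> ((\<lambda>x. a + x) ` A) = emeasure \<mu> A) \<and>
     (\<forall>K. compact K \<longrightarrow> emeasure \<mu> K < \<infinity>) \<and>
     emeasure \<mu> UNIV \<noteq> 0"

definition k_tiles :: "'a::ab_group_add measure \<Rightarrow> nat \<Rightarrow> 'a set \<Rightarrow> bool" where
  "k_tiles \<mu> k \<Omega> \<longleftrightarrow>
     (\<exists>T. AE x in \<mu>. ((\<lambda>t. indicator \<Omega> (x - t) :: real) has_sum real k) T)"

definition characters :: "('a::{ab_group_add, topological_space} \<Rightarrow> complex) set" where
  "characters = {\<psi>. continuous_on UNIV \<psi> \<and> (\<forall>x. cmod (\<psi> x) = 1) \<and> (\<forall>x y. \<psi> (x + y) = \<psi> x * \<psi> y)}"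


section \<open>Riesz bases of the Hilbert space of square-integrable functions\<close>

text \<open>
  Elements of the Hilbert space are represented by square-integrable functions, and equality in
  the space by equality almost everywhere.  Bounded operators of the space thus correspond to maps
  of functions that respect equality almost everywhere and are linear up to it.
\<close>

definition L2 :: "'a measure \<Rightarrow> ('a \<Rightarrow> complex) set" where
  "L2 M = {f \<in> borel_measurable M. integrable M (\<lambda>x. (cmod (f x))\<^sup>2)}"

definition L2_inner :: "'a measure \<Rightarrow> ('a \<Rightarrow> complex) \<Rightarrow> ('a \<Rightarrow> complex) \<Rightarrow> complex" where
  "L2_inner M f g = (\<integral>x. f x * cnj (g x) \<partial>M)"

definition L2_norm :: "'a measure \<Rightarrow> ('a \<Rightarrow> complex) \<Rightarrow> real" where
  "L2_norm M f = sqrt (\<integral>x. (cmod (f x))\<^sup>2 \<partial>M)"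

definition L2_bounded_operator ::
    "'a measure \<Rightarrow> (('a \<Rightarrow> complex) \<Rightarrow> ('a \<Rightarrow> complex)) \<Rightarrow> bool" where
  "L2_bounded_operator M U \<longleftrightarrow>
     (\<forall>f\<in>L2 M. U f \<in> L2 M) \<and>
     (\<forall>f\<in>L2 M. \<forall>g\<in>L2 M. (AE x in M. f x = g x) \<longrightarrow> (AE x in M. U f x = U g x)) \<and>
     (\<forall>f\<in>L2 M. \<forall>g\<in>L2 M. \<forall>a b.
        AE x in M. U (\<lambda>y. a * f y + b * g y) x = a * U f x + b * U g x) \<and>
     (\<exists>C. \<forall>f\<in>L2 M. L2_norm M (U f) \<le> C * L2_norm M f)"

definition L2_bounded_invertible ::
    "'a measure \<Rightarrow> (('a \<Rightarrow> complex) \<Rightarrow> ('a \<Rightarrow> complex)) \<Rightarrow> bool" where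
  "L2_bounded_invertible M U \<longleftrightarrow>
     L2_bounded_operator M U \<and>
     (\<exists>V. L2_bounded_operator M V \<and>
        (\<forall>f\<in>L2 M. (AE x in M. V (U f) x = f x) \<and> (AE x in M. U (V f) x = f x)))"

definition L2_orthonormal_basis :: "'a measure \<Rightarrow> 'i set \<Rightarrow> ('i \<Rightarrow> 'a \<Rightarrow> complex) \<Rightarrow> bool" where
  "L2_orthonormal_basis M I e \<longleftrightarrow>
     (\<forall>i\<in>I. e i \<in> L2 M) \<and>
     (\<forall>i\<in>I. \<forall>j\<in>I. L2_inner M (e i) (e j) = (if i = j then 1 else 0)) \<and>
     (\<forall>f\<in>L2 M. \<forall>\<epsilon>>0. \<exists>F c. finite F \<and> F \<subseteq> I \<and>
        L2_norm M (\<lambda>x. f x - (\<Sum>i\<in>F. c i * e i x)) < \<epsilon>)"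

definition L2_riesz_basis :: "'a measure \<Rightarrow> 'i set \<Rightarrow> ('i \<Rightarrow> 'a \<Rightarrow> complex) \<Rightarrow> bool" where
  "L2_riesz_basis M I f \<longleftrightarrow>
     countable I \<and>
     (\<exists>U e. L2_bounded_invertible M U \<and> L2_orthonormal_basis M I e \<and>
        (\<forall>i\<in>I. AE x in M. f i x = U (e i) x))"

end

theory Submission
  imports Defs
begin

text \<open>
  Write \<open>B n\<close> for the ball of radius \<open>p\<^sup>n\<close>, a compact open subgroup, and let \<open>T\<close> be the
  translation set.  The proof has two parts: a multi-tile is, up to a null set, a finite union of
  cosets of one small ball, and for such a union a Riesz basis of characters can be written down.

  \<^bold>\<open>A multi-tile is a union of cosets.\<close>
  Let \<open>\<psi>\<close> be a character that is nontrivial on \<open>B n\<close>, and let \<open>v x\<close> be the sum of \<open>\<psi> t\<close> over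
  the \<open>t \<in> T\<close> in \<open>x + B n\<close>.  The integral of \<open>\<psi> y * v (x - y)\<close> over \<open>y \<in> \<Omega>\<close> can be rearranged, by the
  tiling equation, to \<open>k\<close> times the integral of \<open>\<psi>\<close> over \<open>x + B n\<close>, so it is zero.  On the other hand
  \<open>v\<close> is constant on the cosets of \<open>B n\<close>, so up to the small part of \<open>\<Omega>\<close> outside \<open>B n\<close> the same
  integral is \<open>v x\<close> times the integral of \<open>\<psi>\<close> over \<open>\<Omega>\<close>.  If the latter is not zero, this forces \<open>v = 0\<close>
  for all large \<open>n\<close> (\<open>character_sum_translations_zero\<close>): in particular, the sum of \<open>\<psi>\<close> over \<open>T \<inter> B n\<close>
  vanishes.

  Such a sum is the value, at a root of unity of order \<open>p\<^sup>s\<close>, of an integer polynomial whose value at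
  \<open>1\<close> is the number of points of \<open>T \<inter> B n\<close>.  The cyclotomic polynomials of prime power order are
  irreducible and have the value \<open>p\<close> at \<open>1\<close>; hence every order \<open>p\<^sup>s\<close> at which a sum vanishes
  contributes a factor \<open>p\<close> to that number (\<open>vanishing_sum_dvd_card\<close>).  Characters that are trivial on
  most of \<open>\<Omega>\<close> have a nonzero integral over \<open>\<Omega>\<close>, so their sums vanish; they already account for \<open>p\<^sup>n\<close>
  up to a constant factor, while by volume \<open>T \<inter> B n\<close> has at most a constant times \<open>p\<^sup>n\<close> points.
  Hence only finitely many further orders can occur (\<open>finite_exceptional_levels\<close>), and there is an
  \<open>M\<close> such that every character in question that is nontrivial on \<open>B M\<close> has integral zero over \<open>\<Omega>\<close>.
  By uniqueness of Fourier coefficients, the indicator function of \<open>\<Omega>\<close> is almost everywhere constant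
  on every coset of \<open>B M\<close> (\<open>Omega_AE_union_of_cosets\<close>).

  \<^bold>\<open>The Riesz basis.\<close>
  Let \<open>\<Omega>\<close> be the disjoint union of the cosets \<open>c i + B M\<close> for \<open>i < J\<close>, and let the set \<open>A\<close> contain one
  extension of each character of \<open>B M\<close>.  The normalised products of \<open>\<psi> \<in> A\<close> with the indicator
  functions of the \<open>J\<close> cosets form an orthonormal basis.  If \<open>E\<close> is a character with kernel \<open>B M\<close>,
  then on \<open>\<Omega>\<close> the \<open>J\<close> characters \<open>\<psi> * E\<^sup>j\<close> are the combinations of the \<open>J\<close> basis functions of \<open>\<psi>\<close>
  given by the Vandermonde matrix with the nodes \<open>E (c i)\<close>.  These are distinct, and the matrix is
  the same for all \<open>\<psi>\<close>, so the characters \<open>\<psi> * E\<^sup>j\<close> are the image of the orthonormal basis under a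
  bounded invertible operator (\<open>L2_riesz_basis_block\<close>, \<open>riesz_basis_union_of_cosets\<close>).
\<close>


section \<open>Norm and completeness of the p-adic numbers\<close>

lemma padic_norm_mult: "padic_norm (x * y) = padic_norm x * padic_norm y"
proof transfer
  fix X Y :: "nat \<Rightarrow> rat"
  assume r: "padic_rel CARD('a) X X" "padic_rel CARD('a) Y Y"
  have "(\<lambda>n. padic_abs CARD('a) (X n * Y n)) \<longlonglongrightarrow>
      lim (\<lambda>n. padic_abs CARD('a) (X n)) * lim (\<lambda>n. padic_abs CARD('a) (Y n))"
    unfolding padic_abs_mult[OF prime_card]
    by (intro tendsto_mult padic_abs_tendsto_lim r)
  then show "lim (\<lambda>n. padic_abs CARD('a) (X n * Y n)) =
      lim (\<lambda>n. padic_abs CARD('a) (X n)) * lim (\<lambda>n. padic_abs CARD('a) (Y n))"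
    by (rule limI)
qed

lemma padic_norm_ultra: "padic_norm (x + y) \<le> max (padic_norm x) (padic_norm y)"
proof transfer
  fix X Y :: "nat \<Rightarrow> rat"
  assume r: "padic_rel CARD('a) X X" "padic_rel CARD('a) Y Y"
  then have "padic_rel CARD('a) (\<lambda>n. X n + Y n) (\<lambda>n. X n + Y n)"
    by (simp add: padic_rel_refl_iff padic_cauchy_add[OF prime_card])
  note l = padic_abs_tendsto_lim[OF this]
    tendsto_max[OF padic_abs_tendsto_lim[OF r(1)] padic_abs_tendsto_lim[OF r(2)]]
  show "lim (\<lambda>n. padic_abs CARD('a) (X n + Y n)) \<le>
        max (lim (\<lambda>n. padic_abs CARD('a) (X n))) (lim (\<lambda>n. padic_abs CARD('a) (Y n)))"
    by (rule LIMSEQ_le[OF l]) (use padic_abs_ultra[OF prime_card] in blast)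
qed

lemma padic_norm_0 [simp]: "padic_norm 0 = 0"
  by (simp add: padic_norm_eq_0_iff)

lemma padic_norm_nonneg [simp]: "0 \<le> padic_norm x"
  using padic_norm_triangle[of x "- x"] by (simp add: padic_norm_minus)

lift_definition rat_padic :: "rat \<Rightarrow> 'p::prime_card padic" is "\<lambda>r _. r"
  by (simp add: padic_rel_refl_iff padic_cauchy_const[OF prime_card])

lemma rat_padic_add: "rat_padic (a + b) = rat_padic a + rat_padic b"
  by transfer (simp add: padic_rel_refl_iff padic_cauchy_const[OF prime_card])

lemma rat_padic_mult: "rat_padic (a * b) = rat_padic a * rat_padic b"
  by transfer (simp add: padic_rel_refl_iff padic_cauchy_const[OF prime_card])

lemma rat_padic_minus: "rat_padic (- a) = - rat_padic a"
  by transfer (simp add: padic_rel_refl_iff padic_cauchy_const[OF prime_card])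

lemma rat_padic_diff: "rat_padic (a - b) = rat_padic a - rat_padic b"
  using rat_padic_add[of a "- b"] by (simp add: rat_padic_minus)

lemma rat_padic_0 [simp]: "rat_padic 0 = 0"
  by transfer (simp add: padic_rel_refl_iff padic_cauchy_const[OF prime_card])

lemma rat_padic_1 [simp]: "rat_padic 1 = 1"
  by transfer (simp add: padic_rel_refl_iff padic_cauchy_const[OF prime_card])

lemma rat_padic_of_nat [simp]: "rat_padic (of_nat n) = of_nat n"
  by (induction n) (simp_all add: rat_padic_add)

lemma padic_norm_rat: "padic_norm (rat_padic r :: 'p::prime_card padic) = padic_abs CARD('p) r"
  by transfer (simp add: limI)

lemma rat_padic_dense:
  assumes "e > 0"
  shows "\<exists>r. padic_norm (x - rat_padic r) < e"
proof -
  have "\<exists>r. padic_norm (x + - rat_padic r) < e"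
    using assms
  proof transfer
    fix e :: real and X :: "nat \<Rightarrow> rat"
    assume e: "e > 0" and X: "padic_rel CARD('a) X X"
    then have c: "padic_cauchy CARD('a) X" by (simp add: padic_rel_refl_iff)
    then obtain N where N: "\<And>m n. m \<ge> N \<Longrightarrow> n \<ge> N \<Longrightarrow> padic_abs CARD('a) (X m - X n) < e / 2"
      using e unfolding padic_cauchy_def by (metis half_gt_zero)
    have "padic_cauchy CARD('a) (\<lambda>n. X n + - X N)"
      by (intro padic_cauchy_add[OF prime_card] c padic_cauchy_const[OF prime_card])
    then have l: "(\<lambda>n. padic_abs CARD('a) (X n + - X N)) \<longlonglongrightarrow> lim (\<lambda>n. padic_abs CARD('a) (X n + - X N))"
      by (intro padic_abs_tendsto_lim) (simp add: padic_rel_refl_iff)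
    have "lim (\<lambda>n. padic_abs CARD('a) (X n + - X N)) \<le> e / 2"
      by (rule LIMSEQ_le_const2[OF l]) (use N in \<open>auto intro!: exI[of _ N] less_imp_le\<close>)
    then have "lim (\<lambda>n. padic_abs CARD('a) (X n + - X N)) < e" using e by simp
    then show "\<exists>r. lim (\<lambda>n. padic_abs CARD('a) (X n + - r)) < e" by blast
  qed
  then show ?thesis by simp
qed

lemma padic_cauchy_lim:
  assumes "padic_cauchy CARD('p::prime_card) X"
  shows "\<exists>l :: 'p padic. (\<lambda>n. rat_padic (X n)) \<longlonglongrightarrow> l"
proof -
  define l :: "'p padic" where "l = abs_padic X"
  have nrm: "padic_norm (rat_padic (X n) - l) = lim (\<lambda>m. padic_abs CARD('p) (X n + - X m))" for n
  proof -
    have c: "padic_rel CARD('p) X X" using assms by (simp add: padic_rel_refl_iff)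
    have c1: "padic_rel CARD('p) (\<lambda>_. X n) (\<lambda>_. X n)"
      by (simp add: padic_rel_refl_iff padic_cauchy_const[OF prime_card])
    have c2: "padic_rel CARD('p) (\<lambda>m. - X m) (\<lambda>m. - X m)"
      using assms by (simp add: padic_rel_refl_iff padic_cauchy_minus[OF prime_card])
    have c3: "padic_rel CARD('p) (\<lambda>m. X n + - X m) (\<lambda>m. X n + - X m)"
      using c1 c2 by (simp only: padic_rel_refl_iff padic_cauchy_add[OF prime_card])
    have "rat_padic (X n) - l = rat_padic (X n) + - l" by simp
    also have "\<dots> = abs_padic (\<lambda>m. X n + - X m)"
      unfolding l_def rat_padic.abs_eq uminus_padic.abs_eq[OF c] plus_padic.abs_eq[OF c1 c2] ..
    finally show ?thesis using padic_norm.abs_eq[OF c3] by simp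
  qed
  have "(\<lambda>n. rat_padic (X n)) \<longlonglongrightarrow> l"
  proof (rule metric_LIMSEQ_I)
    fix e :: real assume e: "e > 0"
    then obtain N where N: "\<And>m n. m \<ge> N \<Longrightarrow> n \<ge> N \<Longrightarrow> padic_abs CARD('p) (X m - X n) < e / 2"
      using assms unfolding padic_cauchy_def by (metis half_gt_zero)
    have "dist (rat_padic (X n)) l < e" if n: "n \<ge> N" for n
    proof -
      have "padic_cauchy CARD('p) (\<lambda>m. X n + - X m)"
        by (intro padic_cauchy_add[OF prime_card] padic_cauchy_minus[OF prime_card] assms
            padic_cauchy_const[OF prime_card])
      then have l: "(\<lambda>m. padic_abs CARD('p) (X n + - X m)) \<longlonglongrightarrow> lim (\<lambda>m. padic_abs CARD('p) (X n + - X m))"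
        by (intro padic_abs_tendsto_lim) (simp add: padic_rel_refl_iff)
      have "lim (\<lambda>m. padic_abs CARD('p) (X n + - X m)) \<le> e / 2"
        by (rule LIMSEQ_le_const2[OF l]) (use N[OF n] in \<open>auto intro!: exI[of _ N] less_imp_le\<close>)
      then show ?thesis using nrm[of n] e by (simp add: dist_padic_def)
    qed
    then show "\<exists>N. \<forall>n\<ge>N. dist (rat_padic (X n)) l < e" by blast
  qed
  then show ?thesis by blast
qed

text \<open>
  Rationals that follow a Cauchy sequence at distance \<open>1 / (n + 1)\<close> form a Cauchy sequence of
  rationals, and its class is the limit.
\<close>

lemma padic_complete: "complete (UNIV :: 'p::prime_card padic set)"
  unfolding complete_def
proof (intro allI impI)
  fix f :: "nat \<Rightarrow> 'p padic" assume "(\<forall>n. f n \<in> UNIV) \<and> Cauchy f"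
  then have f: "Cauchy f" by simp
  have "\<exists>r. dist (f n) (rat_padic r) < 1 / real (Suc n)" for n
    using rat_padic_dense[of "1 / real (Suc n)" "f n"] by (simp add: dist_padic_def)
  then obtain r where r: "\<And>n. dist (f n) (rat_padic (r n)) < 1 / real (Suc n)" by metis
  have lim0: "(\<lambda>n. dist (f n) (rat_padic (r n))) \<longlonglongrightarrow> 0"
    by (rule tendsto_sandwich[OF _ _ tendsto_const LIMSEQ_inverse_real_of_nat])
      (use r in \<open>auto intro!: always_eventually less_imp_le simp: inverse_eq_divide\<close>)
  have "padic_cauchy CARD('p) r"
    unfolding padic_cauchy_def
  proof (intro allI impI)
    fix e :: real assume e: "e > 0"
    obtain N1 where N1: "\<And>m n. m \<ge> N1 \<Longrightarrow> n \<ge> N1 \<Longrightarrow> dist (f m) (f n) < e / 3"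
      using f e unfolding Cauchy_def by (metis zero_less_divide_iff zero_less_numeral)
    obtain N2 where N2: "\<And>n. n \<ge> N2 \<Longrightarrow> dist (f n) (rat_padic (r n)) < e / 3"
      using order_tendstoD(2)[OF lim0, of "e / 3"] e by (auto simp: eventually_sequentially)
    have "padic_abs CARD('p) (r m - r n) < e" if "m \<ge> max N1 N2" "n \<ge> max N1 N2" for m n
    proof -
      have "padic_abs CARD('p) (r m - r n) = dist (rat_padic (r m) :: 'p padic) (rat_padic (r n))"
        by (simp add: dist_padic_def padic_norm_rat[symmetric] rat_padic_diff)
      also have "\<dots> \<le> dist (rat_padic (r m)) (f m) + dist (f m) (f n) + dist (f n) (rat_padic (r n))"
        using dist_triangle[of "rat_padic (r m)" "rat_padic (r n)" "f m"]
          dist_triangle[of "f m" "rat_padic (r n)" "f n"] by linarith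
      also have "\<dots> < e"
        using N1[of m n] N2[of m] N2[of n] that by (simp add: dist_commute)
      finally show ?thesis .
    qed
    then show "\<exists>N. \<forall>m\<ge>N. \<forall>n\<ge>N. padic_abs CARD('p) (r m - r n) < e" by blast
  qed
  then obtain l :: "'p padic" where l: "(\<lambda>n. rat_padic (r n)) \<longlonglongrightarrow> l"
    using padic_cauchy_lim by blast
  have "(\<lambda>n. dist (f n) (rat_padic (r n)) + dist (rat_padic (r n)) l) \<longlonglongrightarrow> 0 + 0"
    by (rule tendsto_add[OF lim0 tendsto_dist_iff[THEN iffD1, OF l]])
  then have s: "(\<lambda>n. dist (f n) (rat_padic (r n)) + dist (rat_padic (r n)) l) \<longlonglongrightarrow> 0" by simp
  have "(\<lambda>n. dist (f n) l) \<longlonglongrightarrow> 0"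
    by (rule tendsto_sandwich[OF _ _ tendsto_const s])
      (auto intro!: always_eventually dist_triangle)
  then have "f \<longlonglongrightarrow> l" by (rule tendsto_dist_iff[THEN iffD2])
  then show "\<exists>l\<in>UNIV. f \<longlonglongrightarrow> l" by blast
qed

section \<open>The standard character\<close>

definition p_fractions :: "nat \<Rightarrow> rat set" where
  "p_fractions p = {of_int m / of_nat p ^ n | m n. True}"

lemma p_fractions_add:
  assumes "prime p" "a \<in> p_fractions p" "b \<in> p_fractions p"
  shows "a + b \<in> p_fractions p"
proof -
  obtain m n m' n' where "a = of_int m / of_nat p ^ n" "b = of_int m' / of_nat p ^ n'"
    using assms by (auto simp: p_fractions_def)
  moreover have "(of_nat p :: rat) \<noteq> 0" using assms(1) by auto
  ultimately have "a + b = of_int (m * int p ^ n' + m' * int p ^ n) / of_nat p ^ (n + n')"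
    by (simp add: add_frac_eq power_add mult.commute)
  then show ?thesis unfolding p_fractions_def by blast
qed

lemma p_fractions_minus:
  assumes "a \<in> p_fractions p"
  shows "- a \<in> p_fractions p"
proof -
  obtain m n where "a = of_int m / of_nat p ^ n" using assms by (auto simp: p_fractions_def)
  then have "- a = of_int (- m) / of_nat p ^ n" by simp
  then show ?thesis unfolding p_fractions_def by blast
qed

lemma p_fractions_integral:
  assumes p: "prime p" and q: "q \<in> p_fractions p" and le: "padic_abs p q \<le> 1"
  shows "q \<in> \<int>"
proof -
  obtain m n where mn: "q = of_int m / of_nat p ^ n" using q by (auto simp: p_fractions_def)
  have p1: "p > 1" using prime_gt_1_nat[OF p] .
  show ?thesis
  proof (cases "m = 0")
    case False
    have "q = of_int m / of_int (int p ^ n)" using mn by simp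
    then have "padic_abs p q = real p powi (int (multiplicity (int p) (int p ^ n)) - int (multiplicity (int p) m))"
      using padic_abs_frac[OF p, of m "int p ^ n"] False p1 by simp
    also have "multiplicity (int p) (int p ^ n) = n"
      using p1 by (intro multiplicity_same_power) auto
    finally have "real p powi (int n - int (multiplicity (int p) m)) \<le> 1" using le by simp
    then have "int n - int (multiplicity (int p) m) \<le> 0"
      using p1 power_int_strict_increasing[of 0 "int n - int (multiplicity (int p) m)" "real p"]
      by (cases "int n - int (multiplicity (int p) m) \<le> 0") auto
    then have "int p ^ n dvd m" by (intro multiplicity_dvd') auto
    then obtain k where "m = int p ^ n * k" by (auto elim: dvdE)
    then have "q = of_int k" using mn p1 by simp
    then show ?thesis by simp
  qed (use mn in simp)
qed

lemma padic_abs_of_int_le_1: "prime p \<Longrightarrow> padic_abs p (of_int k) \<le> 1"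
proof (cases "k = 0")
  case False
  assume p: "prime p"
  have "padic_abs p (of_int k / of_int 1) = real p powi (int (multiplicity (int p) 1) - int (multiplicity (int p) k))"
    by (rule padic_abs_frac[OF p]) (use False in auto)
  also have "\<dots> \<le> real p powi 0"
    using prime_gt_1_nat[OF p] by (intro power_int_increasing) auto
  finally show ?thesis by simp
qed (simp add: padic_abs_0)

text \<open>
  Partial fractions: if \<open>r = a / (p\<^sup>n * c)\<close> with \<open>p\<close> not dividing \<open>c\<close>, and \<open>d\<close> is an inverse of \<open>c\<close>
  modulo \<open>p\<^sup>n\<close>, then \<open>a * d / p\<^sup>n\<close> differs from \<open>r\<close> by \<open>a * (1 - c * d) / (p\<^sup>n * c)\<close>, which is
  \<open>p\<close>-integral.
\<close>

lemma p_fractions_approx_rat: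
  assumes p: "prime p"
  shows "\<exists>q\<in>p_fractions p. padic_abs p (r - q) \<le> 1"
proof -
  obtain a b where ab: "b \<noteq> 0" "r = of_int a / (of_int b :: rat)"
    using rat_frac_ex[OF p] by metis
  have p1: "p > 1" using prime_gt_1_nat[OF p] .
  obtain c where c: "b = int p ^ multiplicity (int p) b * c" "\<not> int p dvd c"
    using multiplicity_decompose'[of b "int p"] ab p1 p by auto
  define n where "n = multiplicity (int p) b"
  have "coprime c (int p ^ n)"
    using c(2) p by (metis coprime_commute coprime_power_left_iff prime_imp_coprime prime_int_nat_transfer
        prime_nat_int_transfer coprime_power_right_iff)
  then obtain d where d: "[c * d = 1] (mod (int p ^ n))"
    using cong_solve_coprime_int by blast
  then have "int p ^ n dvd 1 - c * d"
    using cong_iff_dvd_diff cong_sym by blast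
  then obtain e where e: "1 - c * d = int p ^ n * e" by (auto elim: dvdE)
  have c0: "c \<noteq> 0" using c(2) by auto
  have b: "(of_int b :: rat) = of_nat p ^ n * of_int c" by (subst c(1)) (simp add: n_def)
  have e': "1 - (of_int c :: rat) * of_int d = of_nat p ^ n * of_int e"
    using arg_cong[OF e, of "of_int :: int \<Rightarrow> rat"] by simp
  have "r - of_int (a * d) / of_nat p ^ n = of_int a * (1 - of_int c * of_int d) / (of_nat p ^ n * of_int c)"
    using c0 p1 unfolding ab(2) b by (simp add: field_simps)
  also have "\<dots> = of_int (a * e) / of_int c"
    unfolding e' using c0 p1 by simp
  finally have eq: "r - of_int (a * d) / of_nat p ^ n = of_int (a * e) / of_int c" .
  have "padic_abs p (r - of_int (a * d) / of_nat p ^ n) \<le> 1"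
  proof (cases "a * e = 0")
    case False
    have "padic_abs p (of_int (a * e) / of_int c) =
        real p powi (int (multiplicity (int p) c) - int (multiplicity (int p) (a * e)))"
      by (rule padic_abs_frac[OF p]) (use False c0 in auto)
    also have "multiplicity (int p) c = 0" using c(2) by (rule not_dvd_imp_multiplicity_0)
    also have "real p powi (int 0 - int (multiplicity (int p) (a * e))) \<le> real p powi 0"
      using p1 by (intro power_int_increasing) auto
    finally show ?thesis unfolding eq by simp
  next
    case True
    then have "of_int (a * e) / of_int c = (0 :: rat)" by simp
    then show ?thesis unfolding eq by (simp only: padic_abs_0[OF p] zero_le_one)
  qed
  moreover have "of_int (a * d) / of_nat p ^ n \<in> p_fractions p" unfolding p_fractions_def by blast
  ultimately show ?thesis by blast
qed

text \<open>
  A fractional part; it is determined only up to an integer, which does not affect its image on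
  the unit circle.
\<close>

definition padic_frac :: "'p::prime_card padic \<Rightarrow> rat" where
  "padic_frac x = (SOME q. q \<in> p_fractions CARD('p) \<and> padic_norm (x - rat_padic q) \<le> 1)"

lemma padic_frac:
  fixes x :: "'p::prime_card padic"
  shows "padic_frac x \<in> p_fractions CARD('p)" "padic_norm (x - rat_padic (padic_frac x)) \<le> 1"
proof -
  obtain r where r: "padic_norm (x - rat_padic r) < 1"
    using rat_padic_dense[of 1 x] by auto
  obtain q where q: "q \<in> p_fractions CARD('p)" "padic_abs CARD('p) (r - q) \<le> 1"
    using p_fractions_approx_rat[OF prime_card] by blast
  have "padic_norm ((x - rat_padic r) + rat_padic (r - q)) \<le> 1"
    using r q padic_norm_ultra[of "x - rat_padic r" "rat_padic (r - q)"] by (simp add: padic_norm_rat)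
  then have "padic_norm (x - rat_padic q) \<le> 1" by (simp add: rat_padic_diff)
  then have "\<exists>q. q \<in> p_fractions CARD('p) \<and> padic_norm (x - rat_padic q) \<le> 1"
    using q by blast
  from someI_ex[OF this] show "padic_frac x \<in> p_fractions CARD('p)"
    "padic_norm (x - rat_padic (padic_frac x)) \<le> 1"
    by (simp_all add: padic_frac_def)
qed

definition std_char :: "'p::prime_card padic \<Rightarrow> complex" where
  "std_char x = cis (2 * pi * of_rat (padic_frac x))"

lemma cis_2pi_of_rat_Ints: "q \<in> \<int> \<Longrightarrow> cis (2 * pi * of_rat q) = 1"
  by (auto elim!: Ints_cases simp: cis_multiple_2pi)

text \<open>
  Two \<open>p\<close>-fractions at distance at most \<open>1\<close> from \<open>x\<close> differ by a \<open>p\<close>-fraction of absolute value at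
  most \<open>1\<close>, that is, by an integer.
\<close>

lemma std_char_eqI:
  fixes x :: "'p::prime_card padic"
  assumes q: "q \<in> p_fractions CARD('p)" and le: "padic_norm (x - rat_padic q) \<le> 1"
  shows "std_char x = cis (2 * pi * of_rat q)"
proof -
  define d where "d = q - padic_frac x"
  have "d \<in> p_fractions CARD('p)"
    using p_fractions_add[OF prime_card q p_fractions_minus[OF padic_frac(1)[of x]]] by (simp add: d_def)
  moreover have "padic_norm ((x - rat_padic (padic_frac x)) + - (x - rat_padic q)) \<le> 1"
    using padic_norm_ultra[of "x - rat_padic (padic_frac x)" "- (x - rat_padic q)"] le padic_frac(2)[of x]
      padic_norm_minus[of "x - rat_padic q"] by simp
  then have "padic_abs CARD('p) d \<le> 1"
    unfolding padic_norm_rat[symmetric] d_def rat_padic_diff by simp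
  ultimately have "d \<in> \<int>" by (rule p_fractions_integral[OF prime_card])
  then have "cis (2 * pi * of_rat d) = 1" by (rule cis_2pi_of_rat_Ints)
  moreover have "cis (2 * pi * of_rat q) = cis (2 * pi * of_rat d) * std_char x"
    by (simp add: std_char_def cis_mult d_def of_rat_diff algebra_simps)
  ultimately show ?thesis by simp
qed

lemma std_char_add: "std_char (x + y) = std_char x * std_char y"
proof -
  let ?q = "padic_frac x + padic_frac y"
  have "padic_norm ((x - rat_padic (padic_frac x)) + (y - rat_padic (padic_frac y))) \<le> 1"
    using padic_norm_ultra[of "x - rat_padic (padic_frac x)" "y - rat_padic (padic_frac y)"]
      padic_frac(2)[of x] padic_frac(2)[of y] by simp
  then have "std_char (x + y) = cis (2 * pi * of_rat ?q)"
    by (intro std_char_eqI p_fractions_add[OF prime_card] padic_frac)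
      (simp_all add: rat_padic_add algebra_simps)
  then show ?thesis by (simp add: std_char_def cis_mult of_rat_add algebra_simps)
qed

lemma norm_std_char [simp]: "cmod (std_char x) = 1"
  by (simp add: std_char_def)

lemma cis_2pi_eq_1_iff: "cis (2 * pi * r) = 1 \<longleftrightarrow> r \<in> \<int>"
proof
  assume "cis (2 * pi * r) = 1"
  then have "cos (2 * pi * r) = 1" by (metis cis.sel(1) one_complex.sel(1))
  then obtain k :: int where "2 * pi * r = of_int k * 2 * pi"
    using cos_one_2pi_int by blast
  then have "r = of_int k" by simp
  then show "r \<in> \<int>" by simp
qed (auto elim!: Ints_cases simp: cis_multiple_2pi)

lemma of_rat_Ints_iff: "(of_rat q :: real) \<in> \<int> \<longleftrightarrow> q \<in> \<int>"
proof
  assume "(of_rat q :: real) \<in> \<int>"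
  then obtain k :: int where "(of_rat q :: real) = of_int k" by (auto elim: Ints_cases)
  then have "(of_rat q :: real) = of_rat (of_int k)" by simp
  then have "q = of_int k" by (simp only: of_rat_eq_iff)
  then show "q \<in> \<int>" by simp
qed (auto elim!: Ints_cases)

lemma std_char_eq_1_iff: "std_char (x :: 'p::prime_card padic) = 1 \<longleftrightarrow> padic_norm x \<le> 1"
proof
  assume "padic_norm x \<le> 1"
  moreover have "0 \<in> p_fractions CARD('p)"
    unfolding p_fractions_def by (rule CollectI) (rule exI[of _ 0], simp)
  ultimately show "std_char x = 1" using std_char_eqI[of 0 x] by simp
next
  assume "std_char x = 1"
  then have "padic_frac x \<in> \<int>" by (simp add: std_char_def cis_2pi_eq_1_iff of_rat_Ints_iff)
  then have "padic_norm (rat_padic (padic_frac x) :: 'p padic) \<le> 1"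
    unfolding padic_norm_rat using padic_abs_of_int_le_1[OF prime_card] by (auto elim!: Ints_cases)
  then show "padic_norm x \<le> 1"
    using padic_norm_ultra[of "x - rat_padic (padic_frac x)" "rat_padic (padic_frac x)"] padic_frac(2)[of x]
    by simp
qed

lemma std_char_0 [simp]: "std_char 0 = 1"
  by (simp add: std_char_eq_1_iff)

lemma std_char_of_nat_mult: "std_char (of_nat k * x) = std_char x ^ k"
  by (induction k) (simp_all add: std_char_add distrib_right)


section \<open>A tower of characters and its kernels\<close>

lemma padic_abs_powi:
  assumes p: "prime p"
  shows "padic_abs p (of_nat p powi n) = real p powi (- n)"
proof -
  have p1: "p > 1" using prime_gt_1_nat[OF p] .
  have "padic_abs p (of_int (int p) / of_int 1) = real p powi (int (multiplicity (int p) 1) - int (multiplicity (int p) (int p)))"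
    by (rule padic_abs_frac[OF p]) (use p1 in auto)
  also have "multiplicity (int p) (int p) = 1"
    using p1 by (intro multiplicity_self) auto
  finally have 1: "padic_abs p (of_nat p) = inverse (real p)" by (simp add: power_int_minus)
  have 2: "padic_abs p (of_nat p ^ k) = inverse (real p) ^ k" for k
    by (induction k) (simp_all add: padic_abs_mult[OF p] 1 padic_abs_1[OF p])
  show ?thesis
    by (cases n rule: int_cases3)
      (simp_all add: 2 power_int_minus padic_abs_inverse[OF p] padic_abs_1[OF p] power_inverse)
qed

text \<open>
  The dilates \<open>x \<mapsto> std_char (p\<^sup>n * x)\<close> of the standard character form a tower: each is the \<open>p\<close>-th
  power of the one before, and the kernel of the \<open>n\<close>-th is the ball of radius \<open>p\<^sup>n\<close>.  The group
  structure of the balls is read off from these two facts.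
\<close>

definition padic_char :: "int \<Rightarrow> 'p::prime_card padic \<Rightarrow> complex" where
  "padic_char n x = std_char (rat_padic (of_nat CARD('p) powi n) * x)"

definition pball :: "int \<Rightarrow> 'p::prime_card padic set" where
  "pball n = {x. padic_norm x \<le> real CARD('p) powi n}"

lemma p_gt_1: "CARD('p::prime_card) > 1"
  using prime_gt_1_nat[OF prime_card] .

lemma padic_char_add: "padic_char n (x + y) = padic_char n x * padic_char n y"
  by (simp add: padic_char_def distrib_left std_char_add)

lemma padic_char_0 [simp]: "padic_char n 0 = 1"
  by (simp add: padic_char_def)

lemma norm_padic_char [simp]: "cmod (padic_char n x) = 1"
  by (simp add: padic_char_def)

lemma padic_char_nonzero [simp]: "padic_char n x \<noteq> 0"
  using norm_padic_char[of n x] by fastforce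

lemma padic_char_minus: "padic_char n (- x) = inverse (padic_char n x)"
  using padic_char_add[of n x "- x"] by (simp add: inverse_unique)

lemma padic_char_diff: "padic_char n (x - y) = padic_char n x / padic_char n y"
  using padic_char_add[of n x "- y"] by (simp add: padic_char_minus field_simps)

lemma padic_char_of_nat_mult: "padic_char n (of_nat k * x) = padic_char n x ^ k"
  unfolding padic_char_def by (metis mult.left_commute std_char_of_nat_mult)

lemma padic_char_Suc: "padic_char (n + int k) (x :: 'p::prime_card padic) = padic_char n x ^ (CARD('p) ^ k)"
proof -
  have "(of_nat CARD('p) :: rat) powi (n + int k) = of_nat (CARD('p) ^ k) * of_nat CARD('p) powi n"
    using p_gt_1[where 'p='p] by (simp add: power_int_add)
  then have "padic_char (n + int k) x = std_char (of_nat (CARD('p) ^ k) * (rat_padic (of_nat CARD('p) powi n) * x))"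
    unfolding padic_char_def by (simp only: rat_padic_mult rat_padic_of_nat mult.assoc)
  then show ?thesis by (simp only: std_char_of_nat_mult padic_char_def)
qed

lemma padic_char_eq_1_iff: "padic_char n x = 1 \<longleftrightarrow> x \<in> pball n"
proof -
  have pos: "real CARD('a) powi n > 0" using p_gt_1[where 'p='a] by simp
  have "padic_char n x = 1 \<longleftrightarrow> real CARD('a) powi (- n) * padic_norm x \<le> 1"
    unfolding padic_char_def std_char_eq_1_iff padic_norm_mult padic_norm_rat padic_abs_powi[OF prime_card] ..
  also have "\<dots> \<longleftrightarrow> x \<in> pball n"
    using pos by (simp add: pball_def power_int_minus field_simps)
  finally show ?thesis .
qed

lemma padic_char_eq_iff: "padic_char n x = padic_char n y \<longleftrightarrow> x - y \<in> pball n"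
  by (simp add: padic_char_eq_1_iff[symmetric] padic_char_diff)

lemma pball_0 [simp]: "0 \<in> pball n"
  by (simp add: padic_char_eq_1_iff[symmetric])

lemma pball_add: "x \<in> pball n \<Longrightarrow> y \<in> pball n \<Longrightarrow> x + y \<in> pball n"
  by (simp add: padic_char_eq_1_iff[symmetric] padic_char_add)

lemma pball_minus: "x \<in> pball n \<Longrightarrow> - x \<in> pball n"
  by (simp add: padic_char_eq_1_iff[symmetric] padic_char_minus)

lemma pball_mono: "m \<le> n \<Longrightarrow> pball m \<subseteq> (pball n :: 'p::prime_card padic set)"
  using power_int_increasing[of m n "real CARD('p)"] p_gt_1[where 'p='p] by (fastforce simp: pball_def)

lemma powi_at_top:
  assumes "real p > 1" shows "\<exists>n::nat. real p powi int n > c"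
  using real_arch_pow[OF assms, of c] by simp

lemma pball_exhaust: "\<exists>n::nat. (x :: 'p::prime_card padic) \<in> pball (int n)"
  using powi_at_top[of "CARD('p)" "padic_norm x"] p_gt_1[where 'p='p] by (auto simp: pball_def intro: less_imp_le)

lemma eventually_mem_pball: "\<forall>\<^sub>F N in sequentially. (x :: 'p::prime_card padic) \<in> pball (int N)"
proof -
  obtain K :: nat where K: "x \<in> pball (int K)" using pball_exhaust by blast
  show ?thesis
    using eventually_ge_at_top[of K]
  proof eventually_elim
    case (elim N)
    then show ?case using K pball_mono[of "int K" "int N"] by auto
  qed
qed

lemma pball_small:
  assumes "e > 0" shows "\<exists>n::nat. \<forall>x \<in> pball (- int n). padic_norm (x :: 'p::prime_card padic) < e"
proof -
  obtain n :: nat where n: "real CARD('p) powi int n > 1 / e"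
    using powi_at_top[of "CARD('p)" "1 / e"] p_gt_1[where 'p='p] by auto
  then have "real CARD('p) powi (- int n) < e"
    using assms p_gt_1[where 'p='p] by (simp add: power_int_minus field_simps)
  then show ?thesis by (intro exI[of _ n]) (auto simp: pball_def)
qed

definition pcoset :: "int \<Rightarrow> 'p::prime_card padic \<Rightarrow> 'p padic set" where
  "pcoset n c = {x. x - c \<in> pball n}"

lemma pcoset_0 [simp]: "pcoset n 0 = pball n" by (simp add: pcoset_def)

lemma pcoset_self [simp]: "c \<in> pcoset n c" by (simp add: pcoset_def)

lemma pcoset_iff: "x \<in> pcoset n c \<longleftrightarrow> padic_char n x = padic_char n c"
  by (simp add: pcoset_def padic_char_eq_iff)

lemma pcoset_eq: "x - c \<in> pball n \<Longrightarrow> pcoset n x = pcoset n c"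
  unfolding pcoset_def by (auto simp: padic_char_eq_iff[symmetric])

lemma pcoset_mono: "m \<le> n \<Longrightarrow> pcoset m c \<subseteq> pcoset n c"
  using pball_mono[of m n] by (auto simp: pcoset_def)

lemma pcoset_translate: "pcoset n c = (\<lambda>x. c + x) ` pball n"
proof (intro equalityI subsetI)
  fix x assume "x \<in> pcoset n c"
  then show "x \<in> (\<lambda>x. c + x) ` pball n" by (intro image_eqI[of _ _ "x - c"]) (auto simp: pcoset_def)
qed (auto simp: pcoset_def)

lemma open_pcoset: "open (pcoset n c :: 'p::prime_card padic set)"
  unfolding open_dist
proof
  fix x :: "'p padic" assume x: "x \<in> pcoset n c"
  have "y \<in> pcoset n c" if "dist y x < real CARD('p) powi n" for y
    using that x pball_add[of "y - x" n "x - c"] by (simp add: pcoset_def dist_padic_def pball_def)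
  then show "\<exists>e>0. \<forall>y. dist y x < e \<longrightarrow> y \<in> pcoset n c"
    using p_gt_1[where 'p='p] by (intro exI[of _ "real CARD('p) powi n"]) auto
qed

lemma closed_pcoset: "closed (pcoset n c)"
proof -
  have "- pcoset n c = (\<Union>x\<in>- pcoset n c. pcoset n x)"
    by (auto simp: pcoset_iff)
  moreover have "open (\<Union>x\<in>- pcoset n c. pcoset n x)"
    by (intro open_UN ballI open_pcoset)
  ultimately have "open (- pcoset n c)" by simp
  then show ?thesis by (simp add: closed_def)
qed

lemma closed_pball: "closed (pball n)"
  using closed_pcoset[of n 0] by simp

lemma continuous_padic_char: "continuous_on UNIV (padic_char n :: 'p::prime_card padic \<Rightarrow> complex)"
  unfolding continuous_on_iff
proof (intro ballI allI impI)
  fix x :: "'p padic" and e :: real assume e: "e > 0"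
  have "dist (padic_char n y) (padic_char n x) < e" if "dist y x < real CARD('p) powi n" for y
  proof -
    have "y - x \<in> pball n" using that by (simp add: pball_def dist_padic_def)
    then show ?thesis using e by (simp add: padic_char_eq_iff[symmetric])
  qed
  then show "\<exists>d>0. \<forall>x'\<in>UNIV. dist x' x < d \<longrightarrow> dist (padic_char n x') (padic_char n x) < e"
    using p_gt_1[where 'p='p] by (intro exI[of _ "real CARD('p) powi n"]) auto
qed

lemma character_norm: "\<psi> \<in> characters \<Longrightarrow> cmod (\<psi> x) = 1"
  and character_add: "\<psi> \<in> characters \<Longrightarrow> \<psi> (x + y) = \<psi> x * \<psi> y"
  by (auto simp: characters_def)

lemma padic_char_power_characters: "(\<lambda>x. padic_char n x ^ r) \<in> characters"
  by (auto simp: characters_def norm_power padic_char_add power_mult_distrib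
      intro!: continuous_on_power continuous_padic_char)

lemma cis_power_root: "cis (2 * pi / real q) ^ r = cis (2 * pi * real r / real q)"
  unfolding Complex.DeMoivre by (rule arg_cong[where f = cis]) simp

text \<open>
  The element \<open>p\<^sup>-\<^sup>n\<close>, at which the characters of the tower take roots of unity of exact
  \<open>p\<close>-power order as values.
\<close>

definition pgen :: "int \<Rightarrow> 'p::prime_card padic" where
  "pgen n = rat_padic (of_nat CARD('p) powi (- n))"

lemma padic_char_pgen:
  "padic_char n (pgen (n + int j) :: 'p::prime_card padic) = cis (2 * pi / real (CARD('p) ^ j))"
proof -
  have p: "CARD('p) > 1" by (rule p_gt_1)
  have "rat_padic (of_nat CARD('p) powi n) * (pgen (n + int j) :: 'p padic) =
      rat_padic (of_nat CARD('p) powi n * of_nat CARD('p) powi (- (n + int j)))"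
    unfolding pgen_def rat_padic_mult ..
  also have "(of_nat CARD('p) :: rat) powi n * of_nat CARD('p) powi (- (n + int j)) = of_nat CARD('p) powi (- int j)"
    using p by (subst power_int_add[symmetric]) auto
  also have "\<dots> = of_int 1 / of_nat CARD('p) ^ j" by (simp add: power_int_minus inverse_eq_divide)
  finally have eq: "padic_char n (pgen (n + int j) :: 'p padic) = std_char (rat_padic (of_int 1 / of_nat CARD('p) ^ j) :: 'p padic)"
    by (simp add: padic_char_def)
  have "std_char (rat_padic (of_int 1 / of_nat CARD('p) ^ j) :: 'p padic)
      = cis (2 * pi * of_rat (of_int 1 / of_nat CARD('p) ^ j))"
    by (rule std_char_eqI) (auto simp: p_fractions_def simp del: of_int_1)
  then show ?thesis unfolding eq by (simp add: of_rat_divide of_rat_power)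
qed

text \<open>
  On the larger ball the \<open>n\<close>-th character takes values in the roots of unity of order \<open>p\<^sup>j\<close>, and
  each of these is its value at a multiple of \<open>pgen (n + j)\<close>.
\<close>

lemma pball_decompose:
  fixes x :: "'p::prime_card padic"
  assumes "x \<in> pball (n + int j)"
  shows "\<exists>r<CARD('p) ^ j. padic_char n x = cis (2 * pi * real r / real (CARD('p) ^ j)) \<and>
     x \<in> pcoset n (of_nat r * pgen (n + int j))"
proof -
  let ?q = "CARD('p) ^ j"
  have q: "?q > 0" using p_gt_1[where 'p='p] by simp
  have "padic_char n x ^ ?q = 1"
    using assms by (simp add: padic_char_Suc[symmetric] padic_char_eq_1_iff)
  then have "padic_char n x \<in> (\<lambda>k. cis (2 * pi * real k / real ?q)) ` {..<?q}"
    using Complex.bij_betw_roots_unity[OF q] by (auto simp: bij_betw_def)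
  then obtain r where r: "r < ?q" "padic_char n x = cis (2 * pi * real r / real ?q)" by auto
  have "padic_char n (of_nat r * pgen (n + int j) :: 'p padic) = cis (2 * pi / real ?q) ^ r"
    by (simp only: padic_char_of_nat_mult padic_char_pgen)
  also have "\<dots> = padic_char n x"
    unfolding r(2) by (rule cis_power_root)
  finally have "x \<in> pcoset n (of_nat r * pgen (n + int j))"
    by (simp add: pcoset_def padic_char_eq_iff[symmetric])
  then show ?thesis using r by blast
qed

lemma pgen_in_pball: "of_nat r * (pgen n :: 'p::prime_card padic) \<in> pball n"
proof -
  have "padic_char n (pgen n :: 'p padic) = 1"
    using padic_char_pgen[of n 0, where 'p='p] by simp
  then have "padic_char n (of_nat r * (pgen n :: 'p padic)) = 1"
    by (simp only: padic_char_of_nat_mult power_one)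
  then show ?thesis by (simp add: padic_char_eq_1_iff)
qed

lemma pball_Un:
  "(pball (n + int j) :: 'p::prime_card padic set) = (\<Union>r<CARD('p) ^ j. pcoset n (of_nat r * pgen (n + int j)))"
proof (intro equalityI subsetI)
  fix x :: "'p padic"
  assume "x \<in> (\<Union>r<CARD('p) ^ j. pcoset n (of_nat r * pgen (n + int j)))"
  then obtain r where "x - of_nat r * pgen (n + int j) \<in> pball n" by (auto simp: pcoset_def)
  then have "x - of_nat r * pgen (n + int j) + of_nat r * pgen (n + int j) \<in> pball (n + int j)"
    using pball_mono[of n "n + int j"] by (intro pball_add pgen_in_pball) auto
  then show "x \<in> pball (n + int j)" by simp
qed (use pball_decompose in blast)

lemma pball_disjoint:
  "disjoint_family_on (\<lambda>r. pcoset n (of_nat r * pgen (n + int j) :: 'p::prime_card padic)) {..<CARD('p) ^ j}"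
proof -
  let ?q = "CARD('p) ^ j"
  have q: "?q > 0" using p_gt_1[where 'p='p] by simp
  have val: "padic_char n x = cis (2 * pi * real r / real ?q)"
    if "x \<in> pcoset n (of_nat r * pgen (n + int j))" for x :: "'p padic" and r
  proof -
    have "padic_char n x = padic_char n (of_nat r * pgen (n + int j) :: 'p padic)"
      using that by (simp add: pcoset_def padic_char_eq_iff)
    also have "\<dots> = cis (2 * pi / real ?q) ^ r"
      by (simp only: padic_char_of_nat_mult padic_char_pgen)
    finally show ?thesis unfolding cis_power_root .
  qed
  have inj: "inj_on (\<lambda>k. cis (2 * pi * real k / real ?q)) {..<?q}"
    using Complex.bij_betw_roots_unity[OF q] by (auto simp: bij_betw_def)
  show ?thesis
    unfolding disjoint_family_on_def
  proof (intro ballI impI)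
    fix r s assume "r \<in> {..<?q}" "s \<in> {..<?q}" "r \<noteq> s"
    then show "pcoset n (of_nat r * pgen (n + int j) :: 'p padic) \<inter> pcoset n (of_nat s * pgen (n + int j)) = {}"
      using val[of _ r] val[of _ s] inj_onD[OF inj, of r s] unfolding disjoint_iff by metis
  qed
qed

text \<open>
  A ball is complete, and it is totally bounded because it consists of finitely many cosets of
  every smaller ball.
\<close>

lemma compact_pball: "compact (pball n :: 'p::prime_card padic set)"
  unfolding compact_eq_totally_bounded
proof (intro conjI allI impI)
  show "complete (pball n :: 'p padic set)"
    using complete_Int_closed[OF padic_complete closed_pball] by simp
next
  fix e :: real assume "e > 0"
  then obtain m0 :: nat where m0: "\<forall>x \<in> pball (- int m0). padic_norm (x :: 'p padic) < e"
    using pball_small by blast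
  define m where "m = min n (- int m0)"
  define j where "j = nat (n - m)"
  have nj: "n = m + int j" by (simp add: j_def m_def)
  have mb: "pcoset m c \<subseteq> ball c e" for c :: "'p padic"
  proof
    fix x assume "x \<in> pcoset m c"
    then have "x - c \<in> pball (- int m0)" using pball_mono[of m "- int m0"] by (auto simp: pcoset_def m_def)
    then have "dist x c < e" using m0 by (simp add: dist_padic_def)
    then show "x \<in> ball c e" by (simp add: dist_commute)
  qed
  show "\<exists>k. finite k \<and> (pball n :: 'p padic set) \<subseteq> (\<Union>x\<in>k. ball x e)"
    by (rule exI[of _ "(\<lambda>r. of_nat r * pgen (m + int j)) ` {..<CARD('p) ^ j}"])
      (use mb in \<open>auto simp: nj pball_Un\<close>)
qed

lemma pcoset_rat: "\<exists>r. x \<in> pcoset n (rat_padic r)"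
proof -
  have "real CARD('a) powi n > 0" using p_gt_1[where 'p='a] by simp
  from rat_padic_dense[OF this, of x] show ?thesis
    by (auto simp: pcoset_def pball_def intro: less_imp_le)
qed

lemma pcoset_subset_or_disjoint:
  assumes "m \<le> n"
  shows "pcoset m c \<inter> pcoset n d = {} \<or> pcoset m c \<subseteq> pcoset n d"
proof (cases "pcoset m c \<inter> pcoset n d = {}")
  case False
  then obtain x where x: "x \<in> pcoset m c" "x \<in> pcoset n d" by blast
  have "pcoset m c = pcoset m x" "pcoset n d = pcoset n x"
    using x by (auto simp: pcoset_iff)
  then show ?thesis using pcoset_mono[OF assms, of x] by simp
qed auto

lemma countable_pcosets: "countable {pcoset n c | n c. True}"
proof -
  have "{pcoset n (c :: 'a padic) | n c. True} \<subseteq> (\<Union>n. \<Union>r. {pcoset n (rat_padic r)})"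
  proof safe
    fix n :: int and c :: "'a padic"
    obtain r where "c \<in> pcoset n (rat_padic r)" using pcoset_rat by blast
    then have "pcoset n c = pcoset n (rat_padic r)" by (intro pcoset_eq) (simp add: pcoset_def)
    then show "pcoset n c \<in> (\<Union>n. \<Union>r. {pcoset n (rat_padic r)})" by blast
  qed
  then show ?thesis by (rule countable_subset) (intro countable_UN countable_insert countable_empty, auto)
qed

lemma open_eq_Union_pcosets:
  fixes U :: "'p::prime_card padic set"
  assumes "open U"
  shows "U = \<Union>{C \<in> {pcoset n c | n c. True}. C \<subseteq> U}"
proof (intro equalityI subsetI)
  fix x assume x: "x \<in> U"
  then obtain e where e: "e > 0" "\<And>y. dist y x < e \<Longrightarrow> y \<in> U"
    using assms unfolding open_dist by blast
  obtain n :: nat where n: "\<forall>y \<in> pball (- int n). padic_norm (y :: 'p padic) < e"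
    using pball_small[OF e(1)] by blast
  have "pcoset (- int n) x \<subseteq> U" using e(2) n by (auto simp: pcoset_def dist_padic_def)
  then show "x \<in> \<Union>{C \<in> {pcoset n c | n c. True}. C \<subseteq> U}" using pcoset_self by blast
qed auto

text \<open>
  There are only countably many cosets of balls, because every coset contains a rational.
\<close>

lemma borel_eq_pcosets: "sets (borel :: 'p::prime_card padic measure) = sigma_sets UNIV {pcoset n c | n c. True}"
proof (rule antisym)
  show "sets (borel :: 'p padic measure) \<subseteq> sigma_sets UNIV {pcoset n c | n c. True}"
    unfolding borel_def
  proof (subst sets_measure_of, simp, rule sigma_sets_mono, rule subsetI)
    fix U :: "'p padic set" assume "U \<in> {S. open S}"
    then have U: "open U" by simp
    show "U \<in> sigma_sets UNIV {pcoset n c | n c. True}"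
      by (subst open_eq_Union_pcosets[OF U], rule sigma_sets_UNION)
        (auto intro: countable_subset[OF _ countable_pcosets])
  qed
  show "sigma_sets UNIV {pcoset n c | n c. True} \<subseteq> sets (borel :: 'p padic measure)"
    by (rule sets.sigma_sets_subset') (auto intro: borel_open open_pcoset)
qed


section \<open>Haar measure and uniqueness of Fourier coefficients\<close>

lemma continuous_padic_shift: "continuous_on UNIV (\<lambda>x. a + x :: 'p::prime_card padic)"
  unfolding continuous_on_iff by (auto simp: dist_padic_def)

lemma borel_measurable_padic_shift [measurable]: "(\<lambda>x. a + x :: 'p::prime_card padic) \<in> borel_measurable borel"
  by (rule borel_measurable_continuous_onI[OF continuous_padic_shift])

lemma borel_measurable_padic_char [measurable]: "padic_char n \<in> borel_measurable borel"
  by (rule borel_measurable_continuous_onI[OF continuous_padic_char])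

lemma borel_measurable_characters: "\<psi> \<in> characters \<Longrightarrow> \<psi> \<in> borel_measurable borel"
  by (rule borel_measurable_continuous_onI) (simp add: characters_def)

lemma pcoset_borel [measurable]: "pcoset n c \<in> sets borel"
  by (rule borel_open[OF open_pcoset])

lemma pball_borel [measurable]: "pball n \<in> sets borel"
  using pcoset_borel[of n 0] by simp

locale padic_haar =
  fixes \<mu> :: "'p::prime_card padic measure"
  assumes haar: "haar_measure \<mu>"
begin

lemma sets_haar [measurable_cong, simp]: "sets \<mu> = sets borel"
  using haar by (simp add: haar_measure_def)

lemma space_haar [simp]: "space \<mu> = UNIV"
  using sets_eq_imp_space_eq[OF sets_haar] by simp

lemma emeasure_shift: "A \<in> sets borel \<Longrightarrow> emeasure \<mu> ((\<lambda>x. a + x) ` A) = emeasure \<mu> A"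
  using haar by (simp add: haar_measure_def)

lemma distr_shift: "distr \<mu> \<mu> (\<lambda>x. a + x) = \<mu>"
proof (rule measure_eqI)
  fix A assume "A \<in> sets (distr \<mu> \<mu> (\<lambda>x. a + x))"
  then have A: "A \<in> sets borel" by simp
  have "(\<lambda>x. a + x) -` A = (\<lambda>x. - a + x) ` A"
  proof (intro equalityI subsetI)
    fix x assume "x \<in> (\<lambda>x. a + x) -` A"
    then show "x \<in> (\<lambda>x. - a + x) ` A" by (intro image_eqI[of _ _ "a + x"]) auto
  qed auto
  then show "emeasure (distr \<mu> \<mu> (\<lambda>x. a + x)) A = emeasure \<mu> A"
    using emeasure_shift[OF A, of "- a"] by (subst emeasure_distr) (use A in auto)
qed simp

lemma integral_shift:
  fixes f :: "'p padic \<Rightarrow> 'b::{banach, second_countable_topology}"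
  assumes "f \<in> borel_measurable borel"
  shows "(\<integral>x. f (a + x) \<partial>\<mu>) = (\<integral>x. f x \<partial>\<mu>)"
proof -
  have "(\<integral>x. f x \<partial>distr \<mu> \<mu> (\<lambda>x. a + x)) = (\<integral>x. f (a + x) \<partial>\<mu>)"
    by (rule integral_distr) (use assms in \<open>auto simp: measurable_cong_sets[OF sets_haar refl]\<close>)
  then show ?thesis by (simp add: distr_shift)
qed

lemma emeasure_pcoset: "emeasure \<mu> (pcoset n c) = emeasure \<mu> (pball n)"
  unfolding pcoset_translate by (rule emeasure_shift) measurable

lemma emeasure_pball_finite: "emeasure \<mu> (pball n) < \<infinity>"
  using haar compact_pball by (auto simp: haar_measure_def)

lemma emeasure_pcoset_finite [simp]: "emeasure \<mu> (pcoset n c) \<noteq> \<infinity>" "emeasure \<mu> (pcoset n c) \<noteq> Orderings.top"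
  "emeasure \<mu> (pball n) \<noteq> \<infinity>" "emeasure \<mu> (pball n) \<noteq> Orderings.top"
  using emeasure_pball_finite[of n] by (auto simp: emeasure_pcoset)

lemma measure_pcoset: "measure \<mu> (pcoset n c) = measure \<mu> (pball n)"
  by (simp add: measure_def emeasure_pcoset)

lemma emeasure_pball_add: "emeasure \<mu> (pball (n + int j)) = ennreal (real (CARD('p) ^ j)) * emeasure \<mu> (pball n)"
proof -
  have "emeasure \<mu> (pball (n + int j)) = (\<Sum>r<CARD('p) ^ j. emeasure \<mu> (pcoset n (of_nat r * pgen (n + int j))))"
    unfolding pball_Un by (rule sum_emeasure[symmetric]) (auto intro: pball_disjoint)
  then show ?thesis by (simp add: emeasure_pcoset ennreal_of_nat_eq_real_of_nat del: of_nat_power)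
qed

lemma measure_pball_add: "measure \<mu> (pball (n + int j)) = real (CARD('p) ^ j) * measure \<mu> (pball n)"
  unfolding measure_def emeasure_pball_add enn2real_mult by simp

text \<open>
  If one ball were a null set, then all larger balls, and with them the whole group, would be.
\<close>

lemma measure_pball_pos: "measure \<mu> (pball n) > 0"
proof (rule ccontr)
  assume "\<not> ?thesis"
  then have "measure \<mu> (pball n) = 0" by (simp add: not_less measure_le_0_iff)
  then have 0: "emeasure \<mu> (pball n) = 0" by (simp add: emeasure_eq_ennreal_measure)
  have "UNIV = (\<Union>j. pball (n + int j) :: 'p padic set)"
  proof (intro equalityI subsetI)
    fix x :: "'p padic"
    obtain k :: nat where k: "x \<in> pball (int k)" using pball_exhaust by blast
    have "int k \<le> n + int (nat (int k - n))" by simp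
    then have "x \<in> pball (n + int (nat (int k - n)))" using k pball_mono by blast
    then show "x \<in> (\<Union>j. pball (n + int j))" by blast
  qed auto
  also have "emeasure \<mu> \<dots> = 0"
    by (rule emeasure_UN_eq_0) (auto simp: emeasure_pball_add 0)
  finally show False using haar by (simp add: haar_measure_def)
qed

lemma sigma_finite_haar: "sigma_finite_measure \<mu>"
proof
  show "\<exists>A. countable A \<and> A \<subseteq> sets \<mu> \<and> \<Union> A = space \<mu> \<and> (\<forall>a\<in>A. emeasure \<mu> a \<noteq> \<infinity>)"
    by (rule exI[of _ "range (\<lambda>n. pball (int n))"]) (use pball_exhaust in auto)
qed

lemma borel_measurable_haar_iff: "f \<in> borel_measurable \<mu> \<longleftrightarrow> f \<in> borel_measurable borel"
  by (simp add: measurable_cong_sets[OF sets_haar refl])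

lemma pcoset_fmeasurable: "pcoset n c \<in> fmeasurable \<mu>" "pball n \<in> fmeasurable \<mu>"
  using emeasure_pball_finite[of n] by (simp_all add: fmeasurable_def emeasure_pcoset)

lemma integrable_indicator_fmeasurable:
  "A \<in> fmeasurable \<mu> \<Longrightarrow> integrable \<mu> (\<lambda>x. B * indicator A x :: real)"
  by (intro integrable_mult_right integrable_real_indicator) (simp_all add: fmeasurable_def)

lemma integrable_on_fmeasurable:
  fixes f :: "'p padic \<Rightarrow> 'b::{banach, second_countable_topology}"
  assumes f: "f \<in> borel_measurable borel" and A: "A \<in> fmeasurable \<mu>"
    and le: "\<And>x. norm (f x) \<le> B * indicator A x"
  shows "integrable \<mu> f"
proof (rule Bochner_Integration.integrable_bound[OF integrable_indicator_fmeasurable[OF A, of B]])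
  show "f \<in> borel_measurable \<mu>" using f by (simp add: borel_measurable_haar_iff)
  show "AE x in \<mu>. norm (f x) \<le> norm (B * indicator A x)"
    by (rule AE_I2, rule order_trans[OF le]) simp
qed

text \<open>
  Translation by \<open>h\<close> preserves the integral and multiplies it by \<open>\<psi> h\<close>, which is not \<open>1\<close>.
\<close>

lemma integral_character_pcoset:
  assumes \<psi>: "\<psi> \<in> characters" and h: "h \<in> pball n" "\<psi> h \<noteq> 1"
  shows "(\<integral>x. \<psi> x * indicator (pcoset n c) x \<partial>\<mu>) = 0"
proof -
  have [measurable]: "\<psi> \<in> borel_measurable borel" by (rule borel_measurable_characters[OF \<psi>])
  let ?I = "\<integral>x. \<psi> x * indicator (pcoset n c) x \<partial>\<mu>"
  have ind: "indicator (pcoset n c) (h + x) = (indicator (pcoset n c) x :: complex)" for x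
    using h(1) by (simp add: indicator_def pcoset_iff padic_char_add padic_char_eq_1_iff[symmetric])
  have "?I = (\<integral>x. \<psi> (h + x) * indicator (pcoset n c) (h + x) \<partial>\<mu>)"
    by (rule integral_shift[symmetric]) measurable
  also have "\<dots> = (\<integral>x. \<psi> h * (\<psi> x * indicator (pcoset n c) x) \<partial>\<mu>)"
    using \<psi> by (simp add: ind characters_def mult.assoc)
  also have "\<dots> = \<psi> h * ?I" by simp
  finally show ?thesis using h(2) by simp
qed

end

lemma tendsto_average_powers:
  fixes z :: complex
  assumes "cmod z = 1"
  shows "(\<lambda>n. (\<Sum>r<Suc n. z ^ r) / of_nat (Suc n)) \<longlonglongrightarrow> (if z = 1 then 1 else 0)"
proof (cases "z = 1")
  case False
  have bound: "norm ((\<Sum>r<Suc n. z ^ r) / of_nat (Suc n)) \<le> (2 / cmod (z - 1)) * inverse (real (Suc n))" for n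
  proof -
    have eq: "(\<Sum>r<Suc n. z ^ r) = (z ^ Suc n - 1) / (z - 1)"
      by (rule geometric_sum[OF False])
    have "norm ((\<Sum>r<Suc n. z ^ r) / of_nat (Suc n)) = cmod (z ^ Suc n - 1) / cmod (z - 1) / real (Suc n)"
      by (simp only: eq norm_divide norm_of_nat)
    also have "\<dots> \<le> 2 / cmod (z - 1) / real (Suc n)"
      using norm_triangle_ineq4[of "z ^ Suc n" 1] assms
      by (intro divide_right_mono) (simp_all add: norm_power norm_mult)
    finally show ?thesis by (simp only: divide_inverse[of _ "real (Suc n)"])
  qed
  have "(\<lambda>n. (2 / cmod (z - 1)) * inverse (real (Suc n))) \<longlonglongrightarrow> (2 / cmod (z - 1)) * 0"
    by (intro tendsto_mult tendsto_const LIMSEQ_inverse_real_of_nat)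
  then have "(\<lambda>n. (2 / cmod (z - 1)) * inverse (real (Suc n))) \<longlonglongrightarrow> 0" by (simp only: mult_zero_right)
  then have "(\<lambda>n. (\<Sum>r<Suc n. z ^ r) / of_nat (Suc n)) \<longlonglongrightarrow> 0"
    by (rule Lim_null_comparison[OF always_eventually[OF allI[OF bound]]])
  then show ?thesis using False by simp
next
  case True
  have "(\<Sum>r<Suc n. z ^ r) / of_nat (Suc n) = 1" for n
    using of_nat_neq_0[of n, where 'a=complex] by (simp add: True del: sum.lessThan_Suc of_nat_Suc)
  then show ?thesis using True by (simp del: sum.lessThan_Suc of_nat_Suc)
qed

context padic_haar
begin

text \<open>
  The indicator function of the coset is the bounded pointwise limit of averages of powers of
  \<open>padic_char m (x - y)\<close>, which equals \<open>1\<close> exactly on the coset.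
\<close>

lemma integral_pcoset_zero_of_powers:
  fixes g :: "'p padic \<Rightarrow> complex"
  assumes g: "integrable \<mu> g" and zero: "\<And>j. (\<integral>x. g x * padic_char m x ^ j \<partial>\<mu>) = 0"
  shows "(\<integral>x. g x * indicator (pcoset m y) x \<partial>\<mu>) = 0"
proof -
  have gm: "g \<in> borel_measurable \<mu>" by (rule borel_measurable_integrable[OF g])
  note [measurable] = gm
  let ?s = "\<lambda>n x. g x * ((\<Sum>r<Suc n. padic_char m (x - y) ^ r) / of_nat (Suc n))"
  have ch: "padic_char m (x - y) = padic_char m x / padic_char m y" for x by (rule padic_char_diff)
  have int: "integrable \<mu> (\<lambda>x. g x * padic_char m x ^ r)" for r
    by (rule Bochner_Integration.integrable_bound[OF g]) (auto simp: norm_mult norm_power)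
  have zero_s: "(\<integral>x. ?s n x \<partial>\<mu>) = 0" for n
  proof -
    have "?s n = (\<lambda>x. \<Sum>r<Suc n. (g x * padic_char m x ^ r) * (1 / (padic_char m y ^ r * of_nat (Suc n))))"
      unfolding ch by (rule ext) (simp add: sum_divide_distrib sum_distrib_left power_divide del: sum.lessThan_Suc of_nat_Suc)
    then have "(\<integral>x. ?s n x \<partial>\<mu>) = (\<Sum>r<Suc n. \<integral>x. (g x * padic_char m x ^ r) * (1 / (padic_char m y ^ r * of_nat (Suc n))) \<partial>\<mu>)"
      using int by (simp del: sum.lessThan_Suc of_nat_Suc)
    also have "\<dots> = 0" by (rule sum.neutral) (simp add: zero del: of_nat_Suc)
    finally show ?thesis .
  qed
  have "(\<lambda>n. \<integral>x. ?s n x \<partial>\<mu>) \<longlonglongrightarrow> (\<integral>x. g x * indicator (pcoset m y) x \<partial>\<mu>)"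
  proof (rule integral_dominated_convergence[where w = "\<lambda>x. cmod (g x)"])
    show "AE x in \<mu>. (\<lambda>n. ?s n x) \<longlonglongrightarrow> g x * indicator (pcoset m y) x"
    proof (rule AE_I2)
      fix x
      have "(indicator (pcoset m y) x :: complex) = (if padic_char m (x - y) = 1 then 1 else 0)"
        by (simp add: indicator_def pcoset_def padic_char_eq_1_iff)
      then show "(\<lambda>n. ?s n x) \<longlonglongrightarrow> g x * indicator (pcoset m y) x"
        using tendsto_average_powers[of "padic_char m (x - y)"] by (intro tendsto_mult tendsto_const) simp
    qed
    show "AE x in \<mu>. norm (?s n x) \<le> cmod (g x)" for n
    proof (rule AE_I2)
      fix x
      have "cmod (\<Sum>r<Suc n. padic_char m (x - y) ^ r) \<le> (\<Sum>r<Suc n. cmod (padic_char m (x - y) ^ r))"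
        by (rule norm_sum)
      also have "\<dots> = real (Suc n)" by (simp add: norm_power del: sum.lessThan_Suc of_nat_Suc)
      finally have "cmod ((\<Sum>r<Suc n. padic_char m (x - y) ^ r) / of_nat (Suc n)) \<le> 1"
        by (simp add: norm_divide divide_le_eq del: sum.lessThan_Suc of_nat_Suc)
      then show "norm (?s n x) \<le> cmod (g x)"
        unfolding norm_mult by (rule mult_left_le) simp
    qed
    show "?s n \<in> borel_measurable \<mu>" for n unfolding ch by measurable
    show "(\<lambda>x. g x * indicator (pcoset m y) x) \<in> borel_measurable \<mu>" by measurable
  qed (use g in simp)
  then show ?thesis unfolding zero_s by (simp only: LIMSEQ_const_iff)
qed

text \<open>
  Two cosets of balls are disjoint or nested, so together with the empty set they form a generator
  of the Borel sets that is stable under intersection.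
\<close>

lemma AE_zero_of_integral_pcosets:
  fixes g :: "'p padic \<Rightarrow> complex"
  assumes g: "integrable \<mu> g" and zero: "\<And>m y. (\<integral>x. g x * indicator (pcoset m y) x \<partial>\<mu>) = 0"
  shows "AE x in \<mu>. g x = 0"
proof -
  have gm: "g \<in> borel_measurable \<mu>" by (rule borel_measurable_integrable[OF g])
  note [measurable] = gm
  define G :: "'p padic set set" where "G = insert {} {pcoset n c | n c. True}"
  have int: "integrable \<mu> (\<lambda>x. g x * indicator A x)" if "A \<in> sets borel" for A
    using integrable_mult_indicator[OF _ g, of A] that by (simp add: mult.commute scaleR_conv_of_real of_real_indicator)
  have total: "(\<integral>x. g x \<partial>\<mu>) = 0"
  proof -
    have "(\<lambda>n. \<integral>x. g x * indicator (pball (int n)) x \<partial>\<mu>) \<longlonglongrightarrow> (\<integral>x. g x \<partial>\<mu>)"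
    proof (rule integral_dominated_convergence[where w = "\<lambda>x. cmod (g x)"])
      show "AE x in \<mu>. (\<lambda>n. g x * indicator (pball (int n)) x) \<longlonglongrightarrow> g x"
      proof (rule AE_I2)
        fix x :: "'p padic"
        show "(\<lambda>n. g x * indicator (pball (int n)) x) \<longlonglongrightarrow> g x"
          by (rule tendsto_eventually, rule eventually_mono[OF eventually_mem_pball[of x]]) simp
      qed
    qed (use g in \<open>auto simp: indicator_def norm_mult\<close>)
    moreover have "(\<integral>x. g x * indicator (pball (int n)) x \<partial>\<mu>) = 0" for n
      using zero[of "int n" 0] by simp
    ultimately show ?thesis by (simp add: LIMSEQ_const_iff)
  qed
  have G: "sigma_sets UNIV G = sets borel"
  proof (rule antisym)
    show "sigma_sets UNIV G \<subseteq> sets borel"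
      unfolding G_def by (rule sets.sigma_sets_subset') auto
    show "sets borel \<subseteq> sigma_sets UNIV G"
      unfolding borel_eq_pcosets by (rule sigma_sets_mono') (auto simp: G_def)
  qed
  have "Int_stable G"
  proof (rule Int_stableI)
    have key: "pcoset m c \<inter> pcoset n d \<in> G" for m n c and d :: "'p padic"
    proof (cases "m \<le> n")
      case True
      then have "pcoset m c \<inter> pcoset n d = {} \<or> pcoset m c \<inter> pcoset n d = pcoset m c"
        using pcoset_subset_or_disjoint[OF True, of c d] by blast
      then show ?thesis unfolding G_def by auto
    next
      case False
      then have "pcoset m c \<inter> pcoset n d = {} \<or> pcoset m c \<inter> pcoset n d = pcoset n d"
        using pcoset_subset_or_disjoint[of n m d c] by auto
      then show ?thesis unfolding G_def by auto
    qed
    fix A B assume "A \<in> G" "B \<in> G"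
    then consider "A = {} \<or> B = {}" | m c n d where "A = pcoset m c" "B = pcoset n d"
      unfolding G_def by blast
    then show "A \<inter> B \<in> G"
    proof cases
      case 1
      then show ?thesis by (auto simp: G_def)
    next
      case 2
      then show ?thesis using key by simp
    qed
  qed
  have "G \<subseteq> Pow UNIV" by simp
  have all: "(\<integral>x. g x * indicator A x \<partial>\<mu>) = 0" if A: "A \<in> sets borel" for A
    using \<open>Int_stable G\<close> \<open>G \<subseteq> Pow UNIV\<close> A[folded G]
  proof (induction A rule: sigma_sets_induct_disjoint)
    case (basic A)
    then show ?case using zero by (auto simp: G_def)
  next
    case (compl A)
    have "(\<integral>x. g x * indicator (UNIV - A) x \<partial>\<mu>) = (\<integral>x. g x - g x * indicator A x \<partial>\<mu>)"
      by (rule Bochner_Integration.integral_cong) (auto simp: indicator_def)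
    also have "\<dots> = 0" using compl int[of A] g total unfolding G by simp
    finally show ?case .
  next
    case (union A)
    then have Am: "A i \<in> sets \<mu>" for i unfolding G by auto
    have gU: "set_integrable \<mu> (\<Union>i. A i) g"
      unfolding set_integrable_def by (rule integrable_mult_indicator) (use Am g in auto)
    have eq: "set_lebesgue_integral \<mu> B g = (\<integral>x. g x * indicator B x \<partial>\<mu>)" for B
      by (simp add: set_lebesgue_integral_def mult.commute scaleR_conv_of_real of_real_indicator)
    have "set_lebesgue_integral \<mu> (\<Union>i. A i) g = (\<Sum>i. set_lebesgue_integral \<mu> (A i) g)"
      by (rule lebesgue_integral_countable_add[OF Am _ gU]) (use union(1) in \<open>auto simp: disjoint_family_on_def\<close>)
    then show ?case using union(3) by (simp add: eq)
  qed (simp_all add: G_def)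
  interpret sigma_finite_measure \<mu> by (rule sigma_finite_haar)
  show ?thesis
  proof (rule density_unique_banach[OF g, of "\<lambda>_. 0"])
    fix A assume "A \<in> sets \<mu>"
    then have "set_lebesgue_integral \<mu> A g = 0"
      using all[of A] by (simp add: set_lebesgue_integral_def mult.commute scaleR_conv_of_real of_real_indicator)
    then show "set_lebesgue_integral \<mu> A g = set_lebesgue_integral \<mu> A (\<lambda>_. 0)"
      by (simp add: set_lebesgue_integral_def)
  qed simp
qed

end


section \<open>Cyclotomic polynomials of prime power order\<close>

text \<open>
  For \<open>s \<ge> 1\<close> and prime \<open>p\<close> this is the cyclotomic polynomial of order \<open>p\<^sup>s\<close>.
\<close>

definition cyclo_pp :: "nat \<Rightarrow> nat \<Rightarrow> int poly" where
  "cyclo_pp p s = (\<Sum>i<p. Polynomial.monom 1 (i * p ^ (s - 1)))"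

context fixes p s :: nat assumes p: "prime p" and s: "s \<ge> 1"
begin

lemma cyclo_pp_mult: "(Polynomial.monom 1 (p ^ (s - 1)) - 1) * cyclo_pp p s = Polynomial.monom 1 (p ^ s) - 1"
proof -
  let ?X = "Polynomial.monom (1::int) (p ^ (s - 1))"
  have pw: "?X ^ i = Polynomial.monom 1 (i * p ^ (s - 1))" for i
    by (simp add: Polynomial.monom_power mult.commute)
  have ps: "p ^ s = p * p ^ (s - 1)" using s by (cases s) auto
  have "?X ^ p = Polynomial.monom 1 (p ^ s)" unfolding pw ps ..
  moreover have "cyclo_pp p s = (\<Sum>i<p. ?X ^ i)" unfolding cyclo_pp_def pw ..
  ultimately show ?thesis using power_diff_1_eq[of ?X p] by simp
qed

lemma cyclo_pp_at_1: "poly (cyclo_pp p s) 1 = int p"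
  by (simp add: cyclo_pp_def poly_sum poly_monom)

lemma degree_lead_cyclo_pp: "degree (cyclo_pp p s) = (p - 1) * p ^ (s - 1)" "lead_coeff (cyclo_pp p s) = 1"
proof -
  have p1: "p > 1" using prime_gt_1_nat[OF p] .
  define d where "d = (p - 1) * p ^ (s - 1)"
  have c: "poly.coeff (cyclo_pp p s) k = (\<Sum>i<p. if i * p ^ (s - 1) = k then 1 else 0)" for k
    by (simp add: cyclo_pp_def coeff_sum)
  have "poly.coeff (cyclo_pp p s) d = (\<Sum>i<p. if i = p - 1 then 1 else 0)"
    unfolding c d_def using p1 by (intro sum.cong) auto
  then have 1: "poly.coeff (cyclo_pp p s) d = 1" using p1 by simp
  have "poly.coeff (cyclo_pp p s) k = 0" if "k > d" for k
    unfolding c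
  proof (intro sum.neutral ballI)
    fix i assume "i \<in> {..<p}"
    then have "i * p ^ (s - 1) \<le> d" unfolding d_def by (intro mult_right_mono) auto
    then show "(if i * p ^ (s - 1) = k then 1 else 0) = (0::int)" using that by auto
  qed
  then have "degree (cyclo_pp p s) \<le> d" by (intro degree_le) auto
  moreover have "degree (cyclo_pp p s) \<ge> d" using 1 by (intro le_degree) auto
  ultimately show "degree (cyclo_pp p s) = (p - 1) * p ^ (s - 1)" by (simp add: d_def)
  then show "lead_coeff (cyclo_pp p s) = 1" using 1 by (simp add: d_def)
qed

end

lemma of_int_mod_ring_eq_0_iff: "(of_int k :: 'p::prime_card mod_ring) = 0 \<longleftrightarrow> int CARD('p) dvd k"
  unfolding of_int_of_int_mod_ring by transfer (simp add: dvd_eq_mod_eq_0)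

text \<open>
  Modulo \<open>p\<close> the factor \<open>A\<close> divides \<open>X\<close> to the power \<open>p\<^sup>s\<close> minus \<open>1\<close>, which is the same power of
  \<open>X - 1\<close>.  The leading coefficient of \<open>A\<close> is a unit, so \<open>A\<close> stays nonconstant modulo \<open>p\<close> and must
  have the root \<open>1\<close> there.
\<close>

lemma factor_of_cyclo_pp_at_1:
  fixes A :: "int poly"
  assumes s: "s \<ge> 1" and AB: "A dvd cyclo_pp CARD('p::prime_card) s" and deg: "degree A > 0"
  shows "int CARD('p) dvd poly A 1"
proof -
  let ?p = "CARD('p)" and ?q = "CARD('p) ^ s"
  let ?h = "map_poly (of_int :: int \<Rightarrow> 'p mod_ring)"
  let ?L = "[:- 1, 1 :: 'p mod_ring:]"
  have p: "prime ?p" by (rule prime_card)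
  obtain B where B: "cyclo_pp ?p s = A * B" using AB by (auto elim: dvdE)
  have "A dvd Polynomial.monom 1 ?q - 1"
    unfolding cyclo_pp_mult[OF p s, symmetric] using AB by (rule dvd_mult)
  then obtain C where C: "Polynomial.monom 1 ?q - 1 = A * C" by (auto elim: dvdE)
  have "?h A * ?h C = ?h (Polynomial.monom 1 ?q - 1)"
    unfolding C by (simp add: of_int_poly_hom.hom_mult)
  also have "\<dots> = Polynomial.monom 1 ?q - 1"
    by (simp add: of_int_poly_hom.hom_minus map_poly_monom)
  also have "\<dots> = ?L ^ ?q"
  proof -
    have X: "Polynomial.monom 1 1 = ?L + 1" by (simp add: monom_altdef one_pCons)
    have "Polynomial.monom (1 :: 'p mod_ring) ?q = Polynomial.monom 1 1 ^ ?q"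
      by (simp add: monom_power)
    also have "\<dots> = ?L ^ ?q + 1 ^ ?q"
      unfolding X by (rule freshmans_dream'[where n = s]) (simp_all add: p)
    finally show ?thesis by simp
  qed
  finally have AC: "?h A * ?h C = ?L ^ ?q" .
  have "lead_coeff A * lead_coeff B = 1"
    using degree_lead_cyclo_pp(2)[OF p s] unfolding B lead_coeff_mult .
  then have "lead_coeff A = 1 \<or> lead_coeff A = - 1" by (auto simp: zmult_eq_1_iff)
  then have "(of_int (lead_coeff A) :: 'p mod_ring) \<noteq> 0" by auto
  then have "degree (?h A) = degree A" by (intro Ring_Hom_Poly.degree_map_poly) (use deg in auto)
  then have degA: "degree (?h A) > 0" using deg by simp
  have "poly (?h A) 1 = 0"
  proof (rule ccontr)
    assume n0: "poly (?h A) 1 \<noteq> 0"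
    have L0: "?L ^ ?q \<noteq> 0" by simp
    then have AC0: "?h A * ?h C \<noteq> 0" unfolding AC .
    have "Polynomial.order 1 (?h A * ?h C) = ?q" unfolding AC using order_power_n_n[of 1 ?q] by simp
    then have "Polynomial.order 1 (?h C) = ?q"
      using order_mult[OF AC0, of 1] n0 order_root[of "?h A" 1] by simp
    then have "?L ^ ?q dvd ?h C" using order_1[of 1 "?h C"] by simp
    then obtain D where D: "?h C = ?L ^ ?q * D" by (auto elim: dvdE)
    then have "?L ^ ?q * (?h A * D) = ?L ^ ?q * 1" using AC by (simp add: mult_ac)
    then have "?h A * D = 1" using L0 by (metis mult_cancel_left)
    then have "?h A dvd 1" by (metis dvdI)
    then show False using degA by (auto simp: poly_dvd_1)
  qed
  then have "(of_int (poly A 1) :: 'p mod_ring) = 0" by simp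
  then show ?thesis by (simp add: of_int_mod_ring_eq_0_iff)
qed

text \<open>
  If there were two nonconstant factors, the value at \<open>1\<close>, which is \<open>p\<close>, would be divisible by the
  square of \<open>p\<close>.
\<close>

lemma prime_elem_cyclo_pp:
  assumes s: "s \<ge> 1"
  shows "prime_elem (cyclo_pp CARD('p::prime_card) s)"
proof -
  let ?p = "CARD('p)"
  have p: "prime ?p" by (rule prime_card)
  have p1: "?p > 1" using prime_gt_1_nat[OF p] .
  have deg: "degree (cyclo_pp ?p s) > 0" unfolding degree_lead_cyclo_pp(1)[OF p s] using p1 by simp
  have unit: "A dvd 1" if "A * B = cyclo_pp ?p s" "degree A = 0" for A B
  proof -
    have l: "lead_coeff A * lead_coeff B = 1"
      using degree_lead_cyclo_pp(2)[OF p s] unfolding that(1)[symmetric] lead_coeff_mult .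
    obtain a where a: "A = [:a:]" using \<open>degree A = 0\<close> by (rule degree_eq_zeroE)
    have "a dvd 1" using l unfolding a by (metis dvdI lead_coeff_pCons(2))
    then show ?thesis unfolding a by (simp add: const_poly_dvd_1)
  qed
  have "irreducible (cyclo_pp ?p s)"
  proof (rule irreducibleI)
    show "cyclo_pp ?p s \<noteq> 0" using deg by auto
    show "\<not> cyclo_pp ?p s dvd 1" using deg by (auto simp: poly_dvd_1)
    fix A B assume AB: "cyclo_pp ?p s = A * B"
    show "A dvd 1 \<or> B dvd 1"
    proof (rule ccontr)
      assume "\<not> ?thesis"
      then have "degree A > 0" "degree B > 0" using unit[of A B] unit[of B A] AB by (auto simp: mult.commute)
      then have "int ?p dvd poly A 1" "int ?p dvd poly B 1"
        using factor_of_cyclo_pp_at_1[OF s, where 'p='p] AB by (metis dvd_triv_left, metis dvd_triv_right)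
      then have "int ?p * int ?p dvd poly A 1 * poly B 1" by (rule mult_dvd_mono)
      also have "poly A 1 * poly B 1 = int ?p" using cyclo_pp_at_1[OF p s] AB by (metis poly_mult)
      finally have "int ?p * int ?p dvd int ?p * 1" by simp
      then have "int ?p dvd 1" using p1 by (subst (asm) dvd_mult_cancel_left) auto
      then show False using p1 by simp
    qed
  qed
  then show ?thesis by (rule irreducible_imp_prime_elem_gcd)
qed

text \<open>
  Euclidean descent on the degree of \<open>P\<close>.  If \<open>P\<close> has smaller degree than \<open>F\<close>, pseudo-division of \<open>F\<close>
  by \<open>P\<close> leaves a remainder that again vanishes at \<open>z\<close>; by induction it is zero, and then \<open>F\<close> divides
  \<open>P\<close> or forces \<open>P\<close> to be constant.
\<close>

lemma prime_elem_dvd_of_common_root: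
  fixes F P :: "int poly" and z :: "'a::{field_char_0}"
  assumes F: "prime_elem F" "lead_coeff F = 1"
    and zF: "poly (of_int_poly F) z = 0" and zP: "poly (of_int_poly P) z = 0"
  shows "F dvd P"
  using zP
proof (induction "degree P" arbitrary: P rule: less_induct)
  case less
  have F0: "F \<noteq> 0" using F by auto
  show ?case
  proof (cases "P = 0")
    case P0: False
    show ?thesis
    proof (cases "degree F \<le> degree P")
      case True
      obtain q r where qr: "pseudo_divmod P F = (q, r)" by fastforce
      have P: "P = F * q + r" using pseudo_divmod(1)[OF F0 qr] F(2) by simp
      have r: "r = 0 \<or> degree r < degree F" using pseudo_divmod(2)[OF F0 qr] .
      have "poly (of_int_poly r) z = 0"
        using less.prems zF unfolding P by (simp add: of_int_poly_hom.hom_add of_int_poly_hom.hom_mult)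
      then have "F dvd r" using less.hyps[of r] r True by auto
      then show ?thesis unfolding P by simp
    next
      case False
      obtain q r where qr: "pseudo_divmod F P = (q, r)" by fastforce
      define c where "c = lead_coeff P ^ (Suc (degree F) - degree P)"
      have c0: "c \<noteq> 0" using P0 by (simp add: c_def)
      have cF: "Polynomial.smult c F = P * q + r" using pseudo_divmod(1)[OF P0 qr] by (simp add: c_def)
      have r: "r = 0 \<or> degree r < degree P" using pseudo_divmod(2)[OF P0 qr] .
      have "poly (of_int_poly (Polynomial.smult c F)) z = 0" using zF by (simp add: of_int_hom.map_poly_hom_smult)
      then have "poly (of_int_poly r) z = 0"
        using less.prems unfolding cF by (simp add: of_int_poly_hom.hom_add of_int_poly_hom.hom_mult)
      then have "F dvd r" using less.hyps[of r] r by auto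
      then have r0: "r = 0" using r False by (metis dvd_imp_degree_le less_trans not_le)
      have "F dvd Polynomial.smult c F" by (rule dvd_smult) simp
      then have "F dvd P * q" using cF r0 by simp
      then have "F dvd P \<or> F dvd q" using F(1) by (simp add: prime_elem_dvd_mult_iff)
      then show ?thesis
      proof
        assume "F dvd q"
        then obtain q' where q': "q = F * q'" by (auto elim: dvdE)
        have "F * [:c:] = F * (P * q')" using cF r0 q' by (simp add: mult_ac)
        then have cPq: "[:c:] = P * q'" using F0 by (metis mult_cancel_left)
        then have "P dvd [:c:]" by (metis dvdI)
        then have "degree P = 0" using c0 dvd_imp_degree_le[of P "[:c:]"] by simp
        then obtain a where a: "P = [:a:]" by (rule degree_eq_zeroE)
        then have "a = 0" using less.prems by (simp add: of_int_hom.map_poly_pCons_hom)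
        then show ?thesis using P0 a by simp
      qed
    qed
  qed simp
qed

lemma cyclo_pp_eval:
  "poly (of_int_poly (cyclo_pp p s)) (z :: complex) = (\<Sum>i<p. (z ^ (p ^ (s - 1))) ^ i)"
  by (simp add: cyclo_pp_def of_int_poly_hom.hom_sum poly_sum map_poly_monom poly_monom
      power_mult[symmetric] mult.commute)

text \<open>
  Every \<open>s\<close> splits off from \<open>P\<close> the cyclotomic polynomial of order \<open>p\<^sup>s\<close>, whose value at \<open>1\<close> is \<open>p\<close>;
  roots of unity of different order are not roots of it, so the factors can be removed one by one.
\<close>

lemma prime_power_dvd_of_roots:
  fixes P :: "int poly"
  assumes "finite S"
    and "\<And>s. s \<in> S \<Longrightarrow> s \<ge> 1 \<and> (\<exists>z::complex. z ^ (CARD('p::prime_card) ^ s) = 1 \<and>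
           z ^ (CARD('p) ^ (s - 1)) \<noteq> 1 \<and> poly (of_int_poly P) z = 0)"
  shows "int CARD('p) ^ card S dvd poly P 1"
  using assms
proof (induction S arbitrary: P rule: finite_induct)
  case (insert s S)
  let ?p = "CARD('p)"
  have p: "prime ?p" by (rule prime_card)
  obtain z :: complex where s: "s \<ge> 1" and z: "z ^ (?p ^ s) = 1" "z ^ (?p ^ (s - 1)) \<noteq> 1"
    "poly (of_int_poly P) z = 0"
    using insert.prems[of s] by auto
  have ps: "?p ^ s = ?p ^ (s - 1) * ?p" using s by (cases s) auto
  have geo: "(w ^ (?p ^ (s - 1)) - 1) * poly (of_int_poly (cyclo_pp ?p s)) w = w ^ (?p ^ s) - 1" for w :: complex
    using power_diff_1_eq[of "w ^ (?p ^ (s - 1))" ?p] unfolding cyclo_pp_eval ps power_mult by simp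
  have "poly (of_int_poly (cyclo_pp ?p s)) z = 0" using geo[of z] z by auto
  then have "cyclo_pp ?p s dvd P"
    using prime_elem_dvd_of_common_root[OF prime_elem_cyclo_pp[OF s] degree_lead_cyclo_pp(2)[OF p s]] z(3) by blast
  then obtain Q where Q: "P = cyclo_pp ?p s * Q" by (auto elim: dvdE)
  have "int ?p ^ card S dvd poly Q 1"
  proof (rule insert.IH)
    fix s' assume s': "s' \<in> S"
    then obtain w :: complex where s'1: "s' \<ge> 1" and w: "w ^ (?p ^ s') = 1" "w ^ (?p ^ (s' - 1)) \<noteq> 1"
      "poly (of_int_poly P) w = 0"
      using insert.prems[of s'] by auto
    have up: "w ^ (?p ^ b) = 1" if "w ^ (?p ^ a) = 1" "a \<le> b" for a b
    proof -
      have "?p ^ b = ?p ^ a * ?p ^ (b - a)" using that by (simp add: power_add[symmetric])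
      then show ?thesis using that by (simp add: power_mult)
    qed
    have "poly (of_int_poly (cyclo_pp ?p s)) w \<noteq> 0"
    proof
      assume 0: "poly (of_int_poly (cyclo_pp ?p s)) w = 0"
      then have "w ^ (?p ^ s) = 1" using geo[of w] by simp
      then have "\<not> s \<le> s' - 1" using up w(2) by blast
      moreover have "s \<noteq> s'" using s' insert.hyps by auto
      ultimately have "s' \<le> s - 1" by simp
      then have "w ^ (?p ^ (s - 1)) = 1" using up w(1) by blast
      then have "poly (of_int_poly (cyclo_pp ?p s)) w = of_nat ?p" unfolding cyclo_pp_eval by simp
      then show False using 0 by simp
    qed
    then have "poly (of_int_poly Q) w = 0" using w(3) unfolding Q by (simp add: of_int_poly_hom.hom_mult)
    then show "s' \<ge> 1 \<and> (\<exists>z::complex. z ^ (?p ^ s') = 1 \<and> z ^ (?p ^ (s' - 1)) \<noteq> 1 \<and> poly (of_int_poly Q) z = 0)"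
      using s'1 w by blast
  qed
  then have "int ?p * int ?p ^ card S dvd poly (cyclo_pp ?p s) 1 * poly Q 1"
    unfolding cyclo_pp_at_1[OF p s] by simp
  then show ?case using insert.hyps unfolding Q by simp
qed simp


section \<open>Character sums over the translations of a multi-tile\<close>

locale padic_tiling = padic_haar +
  fixes \<Omega> T :: "'p::prime_card padic set" and k :: nat
  assumes k: "k \<ge> 1"
    and Omega_borel [measurable]: "\<Omega> \<in> sets borel"
    and Omega_pos: "0 < emeasure \<mu> \<Omega>" and Omega_fin: "emeasure \<mu> \<Omega> < \<infinity>"
    and tiles: "AE x in \<mu>. ((\<lambda>t. indicator \<Omega> (x - t) :: real) has_sum real k) T"
begin

lemma Omega_fmeasurable: "\<Omega> \<in> fmeasurable \<mu>"
  using Omega_borel Omega_fin by (simp add: fmeasurable_def)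

lemma sub_Omega_fmeasurable: "A \<in> sets borel \<Longrightarrow> A \<subseteq> \<Omega> \<Longrightarrow> A \<in> fmeasurable \<mu>"
  by (rule fmeasurableI2[OF Omega_fmeasurable]) auto

lemma measure_Omega_pos: "measure \<mu> \<Omega> > 0"
  using Omega_pos Omega_fin by (simp add: measure_def enn2real_positive_iff)

lemma measurable_Omega_shift [measurable]: "(\<lambda>x. indicator \<Omega> (x - t) :: real) \<in> borel_measurable borel"
proof -
  have "(\<lambda>x. indicator \<Omega> (- t + x) :: real) \<in> borel_measurable borel"
    by (rule measurable_compose[OF borel_measurable_padic_shift]) measurable
  then show ?thesis by simp
qed

lemma tiles_finite_le:
  assumes "finite F" "F \<subseteq> T"
  shows "AE x in \<mu>. (\<Sum>t\<in>F. indicator \<Omega> (x - t) :: real) \<le> real k"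
  using tiles
proof eventually_elim
  case (elim x)
  then show ?case by (rule finite_sum_le_has_sum) (use assms in auto)
qed

lemma measure_Omega_pball_lim: "(\<lambda>n. measure \<mu> (\<Omega> \<inter> pball (int n))) \<longlonglongrightarrow> measure \<mu> \<Omega>"
proof -
  have U: "(\<Union>n. \<Omega> \<inter> pball (int n)) = \<Omega>" using pball_exhaust by auto
  have "(\<lambda>n. measure \<mu> (\<Omega> \<inter> pball (int n))) \<longlonglongrightarrow> measure \<mu> (\<Union>n. \<Omega> \<inter> pball (int n))"
  proof (rule Lim_measure_incseq)
    show "incseq (\<lambda>n. \<Omega> \<inter> pball (int n))"
      unfolding incseq_def by (intro allI impI Int_mono order_refl pball_mono) simp
    show "emeasure \<mu> (\<Union>n. \<Omega> \<inter> pball (int n)) \<noteq> \<infinity>" unfolding U using Omega_fin by simp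
  qed auto
  then show ?thesis unfolding U .
qed

lemma measure_Omega_outside: "measure \<mu> (\<Omega> - pball n) = measure \<mu> \<Omega> - measure \<mu> (\<Omega> \<inter> pball n)"
proof -
  have "\<Omega> - pball n = \<Omega> - (\<Omega> \<inter> pball n)" by auto
  then show ?thesis
    using measure_Diff[of \<mu> \<Omega> "\<Omega> \<inter> pball n"] Omega_fin by simp
qed

text \<open>
  For \<open>t \<in> pcoset m x\<close>, the translate of \<open>\<Omega>\<close> by \<open>t\<close> meets \<open>pcoset m x\<close> in a translate of
  \<open>\<Omega> \<inter> pball m\<close>.  Integrating the tiling equation over the coset bounds the number of these.
\<close>

lemma card_translations_le:
  assumes F: "finite F" "F \<subseteq> T \<inter> pcoset m x"
  shows "real (card F) * measure \<mu> (\<Omega> \<inter> pball m) \<le> real k * measure \<mu> (pball m)"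
proof -
  let ?f = "\<lambda>t z. indicator \<Omega> (z - t) * indicator (pcoset m x) z :: real"
  have one: "(\<integral>z. ?f t z \<partial>\<mu>) = measure \<mu> (\<Omega> \<inter> pball m)" and int: "integrable \<mu> (?f t)" if "t \<in> F" for t
  proof -
    have t: "padic_char m t = padic_char m x" using that F(2) by (auto simp: pcoset_iff)
    have eq: "?f t (t + y) = indicator (\<Omega> \<inter> pball m) y" for y
      by (simp add: indicator_def pcoset_iff padic_char_add t padic_char_eq_1_iff[symmetric])
    have "(\<integral>z. ?f t z \<partial>\<mu>) = (\<integral>y. ?f t (t + y) \<partial>\<mu>)"
      by (rule integral_shift[symmetric]) measurable
    also have "\<dots> = measure \<mu> (\<Omega> \<inter> pball m)" unfolding eq by simp
    finally show "(\<integral>z. ?f t z \<partial>\<mu>) = measure \<mu> (\<Omega> \<inter> pball m)" .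
    show "integrable \<mu> (?f t)"
      by (rule integrable_on_fmeasurable[OF _ pcoset_fmeasurable(1)[of m x], where B = 1])
        (measurable, simp add: indicator_def)
  qed
  have "real (card F) * measure \<mu> (\<Omega> \<inter> pball m) = (\<Sum>t\<in>F. \<integral>z. ?f t z \<partial>\<mu>)"
    using one by simp
  also have "\<dots> = (\<integral>z. (\<Sum>t\<in>F. ?f t z) \<partial>\<mu>)"
    by (rule Bochner_Integration.integral_sum[symmetric]) (rule int)
  also have "\<dots> \<le> (\<integral>z. real k * indicator (pcoset m x) z \<partial>\<mu>)"
  proof (rule integral_mono_AE)
    have "AE z in \<mu>. (\<Sum>t\<in>F. indicator \<Omega> (z - t) :: real) \<le> real k"
      by (rule tiles_finite_le) (use F in auto)
    then show "AE z in \<mu>. (\<Sum>t\<in>F. ?f t z) \<le> real k * indicator (pcoset m x) z"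
      by eventually_elim (simp add: sum_distrib_right[symmetric] mult_right_mono)
    show "integrable \<mu> (\<lambda>z. \<Sum>t\<in>F. ?f t z)"
      by (rule Bochner_Integration.integrable_sum) (rule int)
  qed (rule integrable_indicator_fmeasurable[OF pcoset_fmeasurable(1)])
  also have "\<dots> = real k * measure \<mu> (pball m)" by (simp add: measure_pcoset)
  finally show ?thesis .
qed

lemma ex_large_ball: "\<exists>m. measure \<mu> (\<Omega> \<inter> pball (int m)) > measure \<mu> \<Omega> / 2"
proof -
  have "\<forall>\<^sub>F n in sequentially. measure \<mu> \<Omega> / 2 < measure \<mu> (\<Omega> \<inter> pball (int n))"
    by (rule order_tendstoD(1)[OF measure_Omega_pball_lim]) (use measure_Omega_pos in simp)
  then show ?thesis by (auto simp: eventually_sequentially)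
qed

text \<open>
  It suffices to bound the number of translations in a coset of a larger ball, large enough to meet
  \<open>\<Omega>\<close> in positive measure.
\<close>

lemma translations_bounded: "\<exists>C. \<forall>x. finite (T \<inter> pcoset n x) \<and> card (T \<inter> pcoset n x) \<le> C"
proof -
  obtain m0 where m0: "measure \<mu> (\<Omega> \<inter> pball (int m0)) > measure \<mu> \<Omega> / 2" using ex_large_ball by blast
  define m where "m = max n (int m0)"
  have "measure \<mu> (\<Omega> \<inter> pball (int m0)) \<le> measure \<mu> (\<Omega> \<inter> pball m)"
  proof (rule measure_mono_fmeasurable)
    have "int m0 \<le> m" by (simp add: m_def)
    then show "\<Omega> \<inter> pball (int m0) \<subseteq> \<Omega> \<inter> pball m" by (intro Int_mono order_refl pball_mono)
    show "\<Omega> \<inter> pball m \<in> fmeasurable \<mu>" by (rule sub_Omega_fmeasurable) auto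
  qed simp
  then have pos: "measure \<mu> (\<Omega> \<inter> pball m) > 0" using m0 measure_Omega_pos by linarith
  define C where "C = nat \<lfloor>real k * measure \<mu> (pball m) / measure \<mu> (\<Omega> \<inter> pball m)\<rfloor>"
  have "finite (T \<inter> pcoset n x) \<and> card (T \<inter> pcoset n x) \<le> C" for x
  proof (rule finite_if_finite_subsets_card_bdd)
    fix F assume F: "F \<subseteq> T \<inter> pcoset n x" "finite F"
    have "F \<subseteq> T \<inter> pcoset m x" using F pcoset_mono[of n m x] by (auto simp: m_def)
    from card_translations_le[OF F(2) this]
    have "real (card F) \<le> real k * measure \<mu> (pball m) / measure \<mu> (\<Omega> \<inter> pball m)"
      using pos by (simp add: pos_le_divide_eq)
    then show "card F \<le> C" unfolding C_def by linarith
  qed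
  then show ?thesis by blast
qed

lemma finite_translations: "finite (T \<inter> pcoset n x)" "finite (T \<inter> pball n)"
proof -
  have *: "finite (T \<inter> pcoset n x)" for x using translations_bounded[of n] by blast
  show "finite (T \<inter> pcoset n x)" by (rule *)
  show "finite (T \<inter> pball n)" using *[of 0] by simp
qed

lemma tiles_lim: "AE z in \<mu>. (\<lambda>N. \<Sum>t\<in>T \<inter> pball (int N). indicator \<Omega> (z - t) :: real) \<longlonglongrightarrow> real k"
  using tiles
proof eventually_elim
  case (elim z)
  then have "(sum (\<lambda>t. indicator \<Omega> (z - t) :: real) \<longlongrightarrow> real k) (finite_subsets_at_top T)"
    by (simp add: has_sum_def)
  moreover have "filterlim (\<lambda>N. T \<inter> pball (int N)) (finite_subsets_at_top T) sequentially"
    unfolding filterlim_finite_subsets_at_top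
  proof (intro allI impI)
    fix X assume X: "finite X \<and> X \<subseteq> T"
    have "\<forall>\<^sub>F N in sequentially. \<forall>x\<in>X. x \<in> pball (int N)"
      using X by (simp add: eventually_ball_finite eventually_mem_pball)
    then show "\<forall>\<^sub>F N in sequentially. finite (T \<inter> pball (int N)) \<and> X \<subseteq> T \<inter> pball (int N) \<and> T \<inter> pball (int N) \<subseteq> T"
      by eventually_elim (use X finite_translations in auto)
  qed
  ultimately show ?case by (rule filterlim_compose)
qed

text \<open>
  After the substitution \<open>z = y + t\<close>, the factor \<open>\<psi> t * \<psi> y\<close> becomes \<open>\<psi> z\<close>, and the condition on \<open>t\<close>
  becomes \<open>z \<in> pcoset n x\<close>.  Summation over \<open>t\<close> therefore leaves \<open>k\<close> times the integral of \<open>\<psi>\<close> over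
  this coset.  The sum over \<open>T\<close> is approximated by the finite sums over \<open>T \<inter> pball N\<close>.
\<close>

lemma integral_Omega_character_sum:
  assumes \<psi>: "\<psi> \<in> characters" and h: "h \<in> pball n" "\<psi> h \<noteq> 1"
  shows "integrable \<mu> (\<lambda>y. indicator \<Omega> y * \<psi> y * (\<Sum>t\<in>T \<inter> pcoset n (x - y). \<psi> t))"
    and "(\<integral>y. indicator \<Omega> y * \<psi> y * (\<Sum>t\<in>T \<inter> pcoset n (x - y). \<psi> t) \<partial>\<mu>) = 0"
proof -
  have psi_m [measurable]: "\<psi> \<in> borel_measurable borel" by (rule borel_measurable_characters[OF \<psi>])
  obtain C where C: "\<And>x. finite (T \<inter> pcoset n x)" "\<And>x. card (T \<inter> pcoset n x) \<le> C"
    using translations_bounded[of n] by blast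
  define TN where "TN N = T \<inter> pball (int N)" for N
  have TN: "finite (TN N)" "TN N \<subseteq> T" for N using finite_translations by (auto simp: TN_def)
  define v where "v y = (\<Sum>t\<in>T \<inter> pcoset n (x - y). \<psi> t)" for y
  \<comment> \<open>A measurable form of the partial sum, in which \<open>x\<close> is fixed.\<close>
  define w where "w N y = (\<Sum>t\<in>TN N. indicator (pcoset n (x - t)) y * \<psi> t)" for N y
  have sym: "y \<in> pcoset n (x - t) \<longleftrightarrow> t \<in> pcoset n (x - y)" for y t
    by (auto simp: pcoset_iff padic_char_diff field_simps)
  have w_eq: "w N y = (\<Sum>t\<in>TN N \<inter> pcoset n (x - y). \<psi> t)" for N y
  proof -
    have "w N y = (\<Sum>t\<in>TN N. if t \<in> pcoset n (x - y) then \<psi> t else 0)"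
      unfolding w_def by (rule sum.cong[OF refl]) (simp add: indicator_def sym)
    then show ?thesis by (simp only: sum.inter_restrict[OF TN(1)])
  qed
  have w_le: "cmod (w N y) \<le> real C" for N y
  proof -
    have "cmod (w N y) \<le> (\<Sum>t\<in>TN N \<inter> pcoset n (x - y). cmod (\<psi> t))" unfolding w_eq by (rule norm_sum)
    also have "\<dots> = real (card (TN N \<inter> pcoset n (x - y)))" by (simp add: character_norm[OF \<psi>])
    finally have "cmod (w N y) \<le> real (card (TN N \<inter> pcoset n (x - y)))" .
    moreover have "card (TN N \<inter> pcoset n (x - y)) \<le> card (T \<inter> pcoset n (x - y))"
      by (rule card_mono[OF C(1) Int_mono[OF TN(2) order_refl]])
    ultimately show ?thesis using C(2)[of "x - y"] by linarith
  qed
  have w_lim: "(\<lambda>N. w N y) \<longlonglongrightarrow> v y" for y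
  proof -
    have "\<forall>\<^sub>F N in sequentially. \<forall>t\<in>T \<inter> pcoset n (x - y). t \<in> pball (int N)"
      using C(1) by (simp add: eventually_ball_finite eventually_mem_pball)
    then have "\<forall>\<^sub>F N in sequentially. w N y = v y"
    proof eventually_elim
      case (elim N)
      then have "TN N \<inter> pcoset n (x - y) = T \<inter> pcoset n (x - y)" by (auto simp: TN_def)
      then show ?case by (simp add: w_eq v_def)
    qed
    then show ?thesis by (rule tendsto_eventually)
  qed
  have w_m [measurable]: "w N \<in> borel_measurable borel" for N
    unfolding w_def by measurable
  have v_m [measurable]: "v \<in> borel_measurable borel"
    by (rule borel_measurable_LIMSEQ_metric[OF w_m w_lim])
  have v_le: "cmod (v y) \<le> real C" for y
    by (rule LIMSEQ_le_const2[OF tendsto_norm[OF w_lim]]) (use w_le in blast)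
  have dom: "integrable \<mu> (\<lambda>y. real C * indicator \<Omega> y)"
    by (rule integrable_indicator_fmeasurable[OF Omega_fmeasurable])
  show int: "integrable \<mu> (\<lambda>y. indicator \<Omega> y * \<psi> y * (\<Sum>t\<in>T \<inter> pcoset n (x - y). \<psi> t))"
    unfolding v_def[symmetric]
    by (rule integrable_on_fmeasurable[OF _ Omega_fmeasurable, where B = "real C"])
      (measurable, simp add: norm_mult character_norm[OF \<psi>] v_le indicator_def)
  have l1: "(\<lambda>N. \<integral>y. indicator \<Omega> y * \<psi> y * w N y \<partial>\<mu>) \<longlonglongrightarrow> (\<integral>y. indicator \<Omega> y * \<psi> y * v y \<partial>\<mu>)"
  proof (rule integral_dominated_convergence[OF _ _ dom])
    show "AE y in \<mu>. (\<lambda>N. indicator \<Omega> y * \<psi> y * w N y) \<longlonglongrightarrow> indicator \<Omega> y * \<psi> y * v y"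
      by (intro AE_I2 tendsto_mult tendsto_const w_lim)
    show "AE y in \<mu>. norm (indicator \<Omega> y * \<psi> y * w N y) \<le> real C * indicator \<Omega> y" for N
      by (rule AE_I2) (simp add: norm_mult character_norm[OF \<psi>] w_le indicator_def)
  qed measurable
  let ?S = "\<lambda>N z. \<Sum>t\<in>TN N. indicator \<Omega> (z - t) :: real"
  have sw: "(\<integral>y. indicator \<Omega> y * \<psi> y * w N y \<partial>\<mu>) = (\<integral>z. \<psi> z * indicator (pcoset n x) z * of_real (?S N z) \<partial>\<mu>)" for N
  proof -
    let ?g = "\<lambda>t y. indicator \<Omega> y * \<psi> y * (indicator (pcoset n (x - t)) y * \<psi> t)"
    let ?h = "\<lambda>t z. \<psi> z * indicator (pcoset n x) z * of_real (indicator \<Omega> (z - t))"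
    have hm: "?h t \<in> borel_measurable borel" for t by measurable
    have gh: "?g t y = ?h t (t + y)" for t y
      by (simp add: indicator_def pcoset_iff padic_char_diff padic_char_add character_add[OF \<psi>] field_simps)
    have ig: "integrable \<mu> (?g t)" for t
      by (rule integrable_on_fmeasurable[OF _ Omega_fmeasurable, where B = 1])
        (measurable, simp add: norm_mult character_norm[OF \<psi>] indicator_def)
    have ih: "integrable \<mu> (?h t)" for t
      by (rule integrable_on_fmeasurable[OF hm pcoset_fmeasurable(1)[of n x], where B = 1])
        (simp add: norm_mult character_norm[OF \<psi>] indicator_def)
    have "(\<integral>y. indicator \<Omega> y * \<psi> y * w N y \<partial>\<mu>) = (\<integral>y. (\<Sum>t\<in>TN N. ?g t y) \<partial>\<mu>)"
      by (simp add: w_def sum_distrib_left)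
    also have "\<dots> = (\<Sum>t\<in>TN N. \<integral>y. ?g t y \<partial>\<mu>)"
      by (rule Bochner_Integration.integral_sum) (rule ig)
    also have "\<dots> = (\<Sum>t\<in>TN N. \<integral>z. ?h t z \<partial>\<mu>)"
      unfolding gh by (intro sum.cong refl integral_shift hm)
    also have "\<dots> = (\<integral>z. (\<Sum>t\<in>TN N. ?h t z) \<partial>\<mu>)"
      by (rule Bochner_Integration.integral_sum[symmetric]) (rule ih)
    finally show ?thesis by (simp add: sum_distrib_left)
  qed
  have l2: "(\<lambda>N. \<integral>z. \<psi> z * indicator (pcoset n x) z * of_real (?S N z) \<partial>\<mu>)
      \<longlonglongrightarrow> (\<integral>z. \<psi> z * indicator (pcoset n x) z * of_real (real k) \<partial>\<mu>)"
  proof (rule integral_dominated_convergence)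
    show "integrable \<mu> (\<lambda>z. real k * indicator (pcoset n x) z)"
      by (rule integrable_indicator_fmeasurable[OF pcoset_fmeasurable(1)])
    show "AE z in \<mu>. (\<lambda>N. \<psi> z * indicator (pcoset n x) z * of_real (?S N z)) \<longlonglongrightarrow> \<psi> z * indicator (pcoset n x) z * of_real (real k)"
      using tiles_lim
    proof eventually_elim
      case (elim z)
      then show ?case unfolding TN_def by (intro tendsto_mult tendsto_const tendsto_of_real)
    qed
    show "AE z in \<mu>. norm (\<psi> z * indicator (pcoset n x) z * of_real (?S N z)) \<le> real k * indicator (pcoset n x) z" for N
      using tiles_finite_le[OF TN(1)[of N] TN(2)[of N]]
    proof eventually_elim
      case (elim z)
      have "norm (\<psi> z * indicator (pcoset n x) z * of_real (?S N z)) = indicator (pcoset n x) z * \<bar>?S N z\<bar>"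
        by (simp only: norm_mult norm_of_real character_norm[OF \<psi>]) (simp add: indicator_def)
      also have "\<bar>?S N z\<bar> = ?S N z" by (intro abs_of_nonneg sum_nonneg) auto
      finally show ?case using elim by (simp add: indicator_def)
    qed
  qed measurable
  have "(\<integral>z. \<psi> z * indicator (pcoset n x) z * of_real (real k) \<partial>\<mu>) = 0"
    using integral_character_pcoset[OF \<psi> h] by simp
  then have "(\<integral>y. indicator \<Omega> y * \<psi> y * v y \<partial>\<mu>) = 0"
    using LIMSEQ_unique[OF l1[unfolded sw] l2] by simp
  then show "(\<integral>y. indicator \<Omega> y * \<psi> y * (\<Sum>t\<in>T \<inter> pcoset n (x - y). \<psi> t) \<partial>\<mu>) = 0"
    by (simp add: v_def)
qed

text \<open>
  The character sum depends only on the coset of \<open>x\<close>, so in the vanishing integral of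
  \<open>integral_Omega_character_sum\<close> it can be pulled out of the part over \<open>\<Omega> \<inter> pball n\<close>.  The remaining
  part is at most the measure of \<open>\<Omega> - pball n\<close> times the supremum of all these character sums, which
  is too small unless that supremum is zero.
\<close>

theorem character_sum_translations_zero:
  assumes \<psi>: "\<psi> \<in> characters" and h: "h \<in> pball n" "\<psi> h \<noteq> 1"
    and big: "cmod (\<integral>y. indicator (\<Omega> \<inter> pball n) y * \<psi> y \<partial>\<mu>) > measure \<mu> (\<Omega> - pball n)"
  shows "(\<Sum>t\<in>T \<inter> pcoset n x. \<psi> t) = 0"
proof -
  have psi_m [measurable]: "\<psi> \<in> borel_measurable borel" by (rule borel_measurable_characters[OF \<psi>])
  define a where "a = (\<integral>y. indicator (\<Omega> \<inter> pball n) y * \<psi> y \<partial>\<mu>)"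
  define b where "b = measure \<mu> (\<Omega> - pball n)"
  define v where "v x = (\<Sum>t\<in>T \<inter> pcoset n x. \<psi> t)" for x
  obtain C where C: "\<And>x. finite (T \<inter> pcoset n x)" "\<And>x. card (T \<inter> pcoset n x) \<le> C"
    using translations_bounded[of n] by blast
  have v_le: "cmod (v x) \<le> real C" for x
  proof -
    have "cmod (v x) \<le> (\<Sum>t\<in>T \<inter> pcoset n x. cmod (\<psi> t))" unfolding v_def by (rule norm_sum)
    also have "\<dots> = real (card (T \<inter> pcoset n x))" by (simp add: character_norm[OF \<psi>])
    finally show ?thesis using C(2)[of x] by linarith
  qed
  have bdd: "bdd_above (range (\<lambda>x. cmod (v x)))" by (rule bdd_aboveI2[where M = "real C"]) (rule v_le)
  define V where "V = (SUP x. cmod (v x))"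
  have V: "cmod (v x) \<le> V" for x unfolding V_def by (rule cSUP_upper[OF UNIV_I bdd])
  have V0: "V \<ge> 0" using V[of 0] norm_ge_zero order_trans by blast
  have step: "cmod (v x) * cmod a \<le> V * b" for x
  proof -
    let ?F = "\<lambda>y. indicator \<Omega> y * \<psi> y * v (x - y)"
    note I = integral_Omega_character_sum[OF \<psi> h, of x, folded v_def]
    have inv: "v (x - y) = v x" if "y \<in> pball n" for y
      using pcoset_eq[of "x - y" x n] pball_minus[OF that] by (simp add: v_def)
    have i1: "integrable \<mu> (\<lambda>y. v x * (indicator (\<Omega> \<inter> pball n) y * \<psi> y))"
      by (intro integrable_mult_right, rule integrable_on_fmeasurable[OF _ Omega_fmeasurable, where B = 1])
        (measurable, simp add: norm_mult character_norm[OF \<psi>] indicator_def)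
    have i2: "integrable \<mu> (\<lambda>y. indicator (- pball n) y *\<^sub>R ?F y)"
      by (rule integrable_mult_indicator[OF _ I(1)]) auto
    have split: "?F y = v x * (indicator (\<Omega> \<inter> pball n) y * \<psi> y) + indicator (- pball n) y *\<^sub>R ?F y" for y
      using inv[of y] by (auto simp: indicator_def)
    have "0 = (\<integral>y. v x * (indicator (\<Omega> \<inter> pball n) y * \<psi> y) + indicator (- pball n) y *\<^sub>R ?F y \<partial>\<mu>)"
      unfolding split[symmetric] using I(2) by simp
    also have "\<dots> = v x * a + (\<integral>y. indicator (- pball n) y *\<^sub>R ?F y \<partial>\<mu>)"
      unfolding a_def using i1 i2 by (subst Bochner_Integration.integral_add) simp_all
    finally have "v x * a = - (\<integral>y. indicator (- pball n) y *\<^sub>R ?F y \<partial>\<mu>)"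
      by (simp add: eq_neg_iff_add_eq_0)
    then have "cmod (v x) * cmod a = cmod (\<integral>y. indicator (- pball n) y *\<^sub>R ?F y \<partial>\<mu>)"
      by (metis norm_minus_cancel norm_mult)
    also have "\<dots> \<le> (\<integral>y. norm (indicator (- pball n) y *\<^sub>R ?F y) \<partial>\<mu>)" by (rule integral_norm_bound)
    also have "\<dots> \<le> (\<integral>y. V * indicator (\<Omega> - pball n) y \<partial>\<mu>)"
    proof (rule integral_mono)
      show "integrable \<mu> (\<lambda>y. norm (indicator (- pball n) y *\<^sub>R ?F y))" using i2 by (rule integrable_norm)
      show "integrable \<mu> (\<lambda>y. V * indicator (\<Omega> - pball n) y)"
        by (rule integrable_indicator_fmeasurable, rule sub_Omega_fmeasurable) auto
      show "norm (indicator (- pball n) y *\<^sub>R ?F y) \<le> V * indicator (\<Omega> - pball n) y" for y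
        using V[of "x - y"] by (auto simp: norm_mult character_norm[OF \<psi>] indicator_def)
    qed
    also have "\<dots> = V * b" by (simp add: b_def)
    finally show ?thesis .
  qed
  have a0: "cmod a > b" "b \<ge> 0" using big by (simp_all add: a_def b_def)
  then have a1: "cmod a > 0" by linarith
  have "V \<le> V * b / cmod a"
    unfolding V_def
  proof (rule cSUP_least)
    fix x show "cmod (v x) \<le> (SUP x. cmod (v x)) * b / cmod a"
      using step[of x] unfolding V_def[symmetric] pos_le_divide_eq[OF a1] .
  qed simp
  then have "V * cmod a \<le> V * b" by (simp only: pos_le_divide_eq[OF a1])
  then have "V = 0" using a0(1) V0 mult_le_cancel_left_pos[of V "cmod a" b] by (cases "V = 0") auto
  then have "cmod (v x) \<le> 0" using V[of x] by simp
  then show ?thesis by (simp add: v_def)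
qed

end


section \<open>Levels at which the transform of a multi-tile is nonzero\<close>

lemma cis_root_power_neq_1:
  assumes r: "\<not> p dvd r" and p: "p > 0"
  shows "cis (2 * pi / real p) ^ r \<noteq> 1"
proof
  assume "cis (2 * pi / real p) ^ r = 1"
  then have "cis (2 * pi * (real r / real p)) = 1" unfolding cis_power_root by simp
  then have "real r / real p \<in> \<int>" by (simp only: cis_2pi_eq_1_iff)
  then obtain i :: int where "real r / real p = of_int i" by (auto elim: Ints_cases)
  then have "real_of_int (int r) = real_of_int (i * int p)" using p by (simp add: field_simps)
  then have "int r = i * int p" by (simp only: of_int_eq_iff)
  then have "int p dvd int r" by simp
  then show False using r by (simp only: int_dvd_int_iff)
qed

context padic_tiling
begin

lemma pgen_self: "pgen n \<in> pball n"
  using pgen_in_pball[of 1 n] by simp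

lemma padic_char_power_nontrivial:
  assumes r: "\<not> CARD('p) dvd r" and mn: "m < n"
  shows "\<exists>h\<in>pball n. padic_char m (h :: 'p padic) ^ r \<noteq> 1"
proof
  show "pgen (m + int 1) \<in> pball n"
    using pgen_self[of "m + int 1"] pball_mono[of "m + int 1" n] mn by auto
  have "padic_char m (pgen (m + int 1) :: 'p padic) ^ r = cis (2 * pi / real CARD('p)) ^ r"
    using padic_char_pgen[of m 1, where 'p='p] by simp
  also have "\<dots> \<noteq> 1" by (rule cis_root_power_neq_1[OF r]) (use p_gt_1[where 'p='p] in simp)
  finally show "padic_char m (pgen (m + int 1) :: 'p padic) ^ r \<noteq> 1" .
qed

lemma norm_integral_Omega_le:
  assumes \<psi>: "\<psi> \<in> characters" and A: "A \<in> sets borel" "A \<subseteq> \<Omega>"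
  shows "integrable \<mu> (\<lambda>y. indicator A y * \<psi> y)" "cmod (\<integral>y. indicator A y * \<psi> y \<partial>\<mu>) \<le> measure \<mu> A"
proof -
  have [measurable]: "\<psi> \<in> borel_measurable borel" "A \<in> sets borel"
    using borel_measurable_characters[OF \<psi>] A by auto
  have Af: "A \<in> fmeasurable \<mu>" by (rule sub_Omega_fmeasurable[OF A])
  show "integrable \<mu> (\<lambda>y. indicator A y * \<psi> y)"
    by (rule integrable_on_fmeasurable[OF _ Af, where B = 1])
      (measurable, simp add: norm_mult character_norm[OF \<psi>] indicator_def)
  have "cmod (\<integral>y. indicator A y * \<psi> y \<partial>\<mu>) \<le> (\<integral>y. norm (indicator A y * \<psi> y) \<partial>\<mu>)"
    by (rule integral_norm_bound)
  also have "\<dots> = (\<integral>y. indicator A y \<partial>\<mu>)"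
    by (rule Bochner_Integration.integral_cong[OF refl]) (simp add: norm_mult character_norm[OF \<psi>] indicator_def)
  also have "\<dots> = measure \<mu> A" by simp
  finally show "cmod (\<integral>y. indicator A y * \<psi> y \<partial>\<mu>) \<le> measure \<mu> A" .
qed

text \<open>
  A level from which on the characters of the tower are trivial on more than half of \<open>\<Omega>\<close>, so that
  their integral over \<open>\<Omega>\<close> cannot vanish.
\<close>

definition base_level :: int where
  "base_level = int (SOME m. measure \<mu> (\<Omega> \<inter> pball (int m)) > measure \<mu> \<Omega> / 2)"

lemma base_level: "measure \<mu> (\<Omega> \<inter> pball base_level) > measure \<mu> \<Omega> / 2"
  unfolding base_level_def using someI_ex[OF ex_large_ball] .

lemma measure_Omega_pball_mono: "m \<le> n \<Longrightarrow> measure \<mu> (\<Omega> \<inter> pball m) \<le> measure \<mu> (\<Omega> \<inter> pball n)"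
  by (intro measure_mono_fmeasurable Int_mono order_refl pball_mono sub_Omega_fmeasurable) auto

text \<open>
  The character equals \<open>1\<close> on \<open>\<Omega> \<inter> pball m\<close>, which has more than half of the measure of \<open>\<Omega>\<close>; the
  rest of \<open>\<Omega>\<close> cannot compensate for it.
\<close>

lemma low_frequency_sum_zero:
  assumes m: "base_level \<le> m" "m < n"
  shows "(\<Sum>t\<in>T \<inter> pball n. padic_char m t) = 0"
proof -
  have \<psi>: "padic_char m \<in> characters" using padic_char_power_characters[of m 1] by simp
  have "\<not> CARD('p) dvd 1" using p_gt_1[where 'p='p] by simp
  then obtain h where h: "h \<in> pball n" "padic_char m (h :: 'p padic) \<noteq> 1"
    using padic_char_power_nontrivial[of 1 m n] m by auto
  let ?A = "\<Omega> \<inter> pball m" and ?B = "\<Omega> \<inter> (pball n - pball m)"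
  have Bb: "?B \<in> sets borel" "?B \<subseteq> \<Omega>" "?A \<in> sets borel" "?A \<subseteq> \<Omega>" by auto
  have mn: "pball m \<subseteq> (pball n :: 'p padic set)" using m by (intro pball_mono) simp
  have "(\<integral>y. indicator (\<Omega> \<inter> pball n) y * padic_char m y \<partial>\<mu>) =
      (\<integral>y. of_real (indicator ?A y) + indicator ?B y * padic_char m y \<partial>\<mu>)"
    by (rule Bochner_Integration.integral_cong[OF refl])
      (use mn in \<open>auto simp: indicator_def padic_char_eq_1_iff[symmetric]\<close>)
  also have "\<dots> = (\<integral>y. of_real (indicator ?A y) \<partial>\<mu>) + (\<integral>y. indicator ?B y * padic_char m y \<partial>\<mu>)"
  proof (rule Bochner_Integration.integral_add)
    show "integrable \<mu> (\<lambda>y. complex_of_real (indicator ?A y))"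
      using integrable_indicator_fmeasurable[OF sub_Omega_fmeasurable[OF Bb(3,4)], of 1] by simp
  qed (rule norm_integral_Omega_le[OF \<psi> Bb(1,2)])
  also have "(\<integral>y. of_real (indicator ?A y) \<partial>\<mu>) = complex_of_real (measure \<mu> ?A)"
    by simp
  finally have eq: "(\<integral>y. indicator (\<Omega> \<inter> pball n) y * padic_char m y \<partial>\<mu>) =
      complex_of_real (measure \<mu> ?A) + (\<integral>y. indicator ?B y * padic_char m y \<partial>\<mu>)" .
  have "measure \<mu> ?A - measure \<mu> ?B \<le> cmod (\<integral>y. indicator (\<Omega> \<inter> pball n) y * padic_char m y \<partial>\<mu>)"
    unfolding eq using norm_integral_Omega_le(2)[OF \<psi> Bb(1,2)]
      norm_diff_ineq[of "complex_of_real (measure \<mu> ?A)" "\<integral>y. indicator ?B y * padic_char m y \<partial>\<mu>"]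
    by simp
  moreover have "measure \<mu> (\<Omega> \<inter> pball n) = measure \<mu> ?A + measure \<mu> ?B"
  proof -
    have "\<Omega> \<inter> pball n = ?A \<union> ?B" using mn by auto
    moreover have "measure \<mu> (?A \<union> ?B) = measure \<mu> ?A + measure \<mu> ?B"
      by (rule measure_Union) (use Bb sub_Omega_fmeasurable[OF Bb(1,2)] sub_Omega_fmeasurable[OF Bb(3,4)]
        in \<open>auto simp: fmeasurable_def less_top\<close>)
    ultimately show ?thesis by simp
  qed
  moreover have "measure \<mu> ?A > measure \<mu> \<Omega> / 2"
    using base_level measure_Omega_pball_mono[OF m(1)] by simp
  ultimately have big: "measure \<mu> (\<Omega> - pball n) < cmod (\<integral>y. indicator (\<Omega> \<inter> pball n) y * padic_char m y \<partial>\<mu>)"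
    unfolding measure_Omega_outside by linarith
  show ?thesis using character_sum_translations_zero[OF \<psi> h big, of 0] by simp
qed

text \<open>
  Exponents \<open>r\<close> not divisible by \<open>p\<close> are the ones for which the kernel of \<open>padic_char m ^ r\<close> is still
  the ball of radius \<open>p\<^sup>m\<close>.
\<close>

definition exceptional_levels :: "int set" where
  "exceptional_levels = {m. m < base_level \<and> (\<exists>r. \<not> CARD('p) dvd r \<and> (\<integral>y. indicator \<Omega> y * padic_char m y ^ r \<partial>\<mu>) \<noteq> 0)}"

text \<open>
  As \<open>N\<close> grows, the integral over \<open>\<Omega> \<inter> pball N\<close> tends to the nonzero integral over \<open>\<Omega>\<close>, while the
  measure of \<open>\<Omega> - pball N\<close> tends to zero.
\<close>

lemma exceptional_level_sum_zero:
  assumes m: "m \<in> exceptional_levels"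
  shows "\<exists>r. \<not> CARD('p) dvd r \<and>
    (\<forall>\<^sub>F N in sequentially. (\<Sum>t\<in>T \<inter> pball (int N). padic_char m t ^ r) = 0)"
proof -
  obtain r where r: "\<not> CARD('p) dvd r" and nz: "(\<integral>y. indicator \<Omega> y * padic_char m y ^ r \<partial>\<mu>) \<noteq> 0"
    using m by (auto simp: exceptional_levels_def)
  define \<psi> where "\<psi> = (\<lambda>x :: 'p padic. padic_char m x ^ r)"
  have \<psi>: "\<psi> \<in> characters" unfolding \<psi>_def by (rule padic_char_power_characters)
  have psi_m [measurable]: "\<psi> \<in> borel_measurable borel" by (rule borel_measurable_characters[OF \<psi>])
  define I where "I = (\<integral>y. indicator \<Omega> y * \<psi> y \<partial>\<mu>)"
  have I: "cmod I > 0" using nz by (simp add: I_def \<psi>_def)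
  have lim1: "(\<lambda>N. \<integral>y. indicator (\<Omega> \<inter> pball (int N)) y * \<psi> y \<partial>\<mu>) \<longlonglongrightarrow> I"
    unfolding I_def
  proof (rule integral_dominated_convergence[OF _ _ integrable_indicator_fmeasurable[OF Omega_fmeasurable, of 1]])
    show "AE y in \<mu>. (\<lambda>N. indicator (\<Omega> \<inter> pball (int N)) y * \<psi> y) \<longlonglongrightarrow> indicator \<Omega> y * \<psi> y"
    proof (rule AE_I2)
      fix y :: "'p padic"
      show "(\<lambda>N. indicator (\<Omega> \<inter> pball (int N)) y * \<psi> y) \<longlonglongrightarrow> indicator \<Omega> y * \<psi> y"
        by (rule tendsto_eventually, rule eventually_mono[OF eventually_mem_pball[of y]]) (simp add: indicator_def)
    qed
    show "AE y in \<mu>. norm (indicator (\<Omega> \<inter> pball (int N)) y * \<psi> y) \<le> 1 * indicator \<Omega> y" for N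
      by (rule AE_I2) (simp add: norm_mult character_norm[OF \<psi>] indicator_def)
  qed measurable
  have lim2: "(\<lambda>N. measure \<mu> (\<Omega> - pball (int N))) \<longlonglongrightarrow> 0"
    unfolding measure_Omega_outside using tendsto_diff[OF tendsto_const measure_Omega_pball_lim, of "measure \<mu> \<Omega>"] by simp
  have "(\<lambda>N. cmod (\<integral>y. indicator (\<Omega> \<inter> pball (int N)) y * \<psi> y \<partial>\<mu>) - measure \<mu> (\<Omega> - pball (int N))) \<longlonglongrightarrow> cmod I - 0"
    by (intro tendsto_diff tendsto_norm lim1 lim2)
  then have "\<forall>\<^sub>F N in sequentially. 0 < cmod (\<integral>y. indicator (\<Omega> \<inter> pball (int N)) y * \<psi> y \<partial>\<mu>) - measure \<mu> (\<Omega> - pball (int N))"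
    using I by (intro order_tendstoD(1)) auto
  then have "\<forall>\<^sub>F N in sequentially. (\<Sum>t\<in>T \<inter> pball (int N). padic_char m t ^ r) = 0"
    using eventually_gt_at_top[of "nat m"]
  proof eventually_elim
    case (elim N)
    have "m < int N" using elim(2) by linarith
    then obtain h where "h \<in> pball (int N)" "padic_char m (h :: 'p padic) ^ r \<noteq> 1"
      using padic_char_power_nontrivial[OF r] by blast
    then show ?case
      using character_sum_translations_zero[OF \<psi>, of h "int N" 0] elim(1) by (simp add: \<psi>_def)
  qed
  then show ?thesis using r by blast
qed

lemma translations_nonempty: "T \<noteq> {}"
proof
  assume T: "T = {}"
  have "AE x in \<mu>. False"
    using tiles
  proof eventually_elim
    case (elim x)
    then have "((\<lambda>t. indicator \<Omega> (x - t) :: real) has_sum real k) {}" using T by simp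
    then have "real k = 0" using has_sum_empty has_sum_unique by blast
    then show False using k by simp
  qed
  then have "emeasure \<mu> UNIV = 0" 
    using AE_iff_measurable[of UNIV \<mu> "\<lambda>_. False"] by simp
  then show False using haar by (simp add: haar_measure_def)
qed

text \<open>
  Modulo the smallest kernel that occurs, every point \<open>t\<close> of the ball is a multiple \<open>a t\<close> of one
  element \<open>g\<close>.  All the character sums are then values of the single polynomial with exponents \<open>a t\<close>,
  and a character of level \<open>m\<close> evaluates it at a root of unity of exact order \<open>p\<close> to the \<open>n - m\<close>.
\<close>

lemma vanishing_sum_dvd_card:
  fixes S :: "int set"
  assumes S: "finite S" "\<And>m. m \<in> S \<Longrightarrow> m < n"
    and zero: "\<And>m. m \<in> S \<Longrightarrow> \<exists>r. \<not> CARD('p) dvd r \<and> (\<Sum>t\<in>T \<inter> pball n. padic_char m t ^ r) = 0"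
  shows "CARD('p) ^ card S dvd card (T \<inter> pball n)"
proof (cases "S = {}")
  case False
  define l where "l = Min S"
  have l: "l \<in> S" "\<And>m. m \<in> S \<Longrightarrow> l \<le> m" using S False by (auto simp: l_def)
  define J where "J = nat (n - l)"
  have nJ: "n = l + int J" using S(2)[OF l(1)] by (simp add: J_def)
  define g where "g = (pgen n :: 'p padic)"
  have "\<exists>r. t \<in> pcoset l (of_nat r * g)" if "t \<in> pball n" for t :: "'p padic"
    using pball_decompose[of t l J] that unfolding g_def nJ by blast
  then obtain a where a: "\<And>t. t \<in> pball n \<Longrightarrow> t \<in> pcoset l (of_nat (a t) * g)" by metis
  define P :: "int poly" where "P = (\<Sum>t\<in>T \<inter> pball n. Polynomial.monom 1 (a t))"
  have P1: "poly P 1 = int (card (T \<inter> pball n))" by (simp add: P_def poly_sum poly_monom)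
  have Pz: "poly (of_int_poly P) z = (\<Sum>t\<in>T \<inter> pball n. z ^ a t)" for z :: complex
    by (simp add: P_def of_int_poly_hom.hom_sum poly_sum map_poly_monom poly_monom)
  have roots: "nat (n - m) \<ge> 1 \<and> (\<exists>z::complex. z ^ (CARD('p) ^ nat (n - m)) = 1 \<and>
           z ^ (CARD('p) ^ (nat (n - m) - 1)) \<noteq> 1 \<and> poly (of_int_poly P) z = 0)" if m: "m \<in> S" for m
  proof -
    obtain r where r: "\<not> CARD('p) dvd r" and z0: "(\<Sum>t\<in>T \<inter> pball n. padic_char m t ^ r) = 0"
      using zero[OF m] by blast
    define s where "s = nat (n - m)"
    have s: "s \<ge> 1" "n = m + int s" using S(2)[OF m] by (auto simp: s_def)
    define z where "z = padic_char m g ^ r"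
    have "padic_char m g ^ (CARD('p) ^ s) = padic_char n g" unfolding s(2) by (rule padic_char_Suc[symmetric])
    also have "\<dots> = 1" unfolding padic_char_eq_1_iff g_def by (rule pgen_self)
    finally have gs: "padic_char m g ^ (CARD('p) ^ s) = 1" .
    have "z ^ (CARD('p) ^ s) = (padic_char m g ^ (CARD('p) ^ s)) ^ r"
      by (simp only: z_def power_mult[symmetric] mult.commute)
    then have z1: "z ^ (CARD('p) ^ s) = 1" unfolding gs by simp
    have "m + int (s - 1) = n - 1" using s by simp
    then have "padic_char m g ^ (CARD('p) ^ (s - 1)) = padic_char (n - 1) g"
      by (simp only: padic_char_Suc[symmetric])
    also have "\<dots> = cis (2 * pi / real CARD('p))"
      using padic_char_pgen[of "n - 1" 1, where 'p='p] by (simp add: g_def)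
    finally have "padic_char m g ^ (CARD('p) ^ (s - 1)) = cis (2 * pi / real CARD('p))" .
    moreover have "cis (2 * pi / real CARD('p)) ^ r \<noteq> 1"
      by (rule cis_root_power_neq_1[OF r]) (use p_gt_1[where 'p='p] in simp)
    moreover have "z ^ (CARD('p) ^ (s - 1)) = (padic_char m g ^ (CARD('p) ^ (s - 1))) ^ r"
      by (simp only: z_def power_mult[symmetric] mult.commute)
    ultimately have z2: "z ^ (CARD('p) ^ (s - 1)) \<noteq> 1" by simp
    have "padic_char m t ^ r = z ^ a t" if t: "t \<in> T \<inter> pball n" for t
    proof -
      have "t \<in> pcoset m (of_nat (a t) * g)" using a[of t] t pcoset_mono[OF l(2)[OF m]] by blast
      then have "padic_char m t = padic_char m g ^ a t"
        by (simp only: pcoset_iff padic_char_of_nat_mult)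
      then show ?thesis by (simp only: z_def power_mult[symmetric] mult.commute)
    qed
    then have "poly (of_int_poly P) z = 0" unfolding Pz using z0 by simp
    then show ?thesis using z1 z2 s(1) unfolding s_def by blast
  qed
  have inj: "inj_on (\<lambda>m. nat (n - m)) S"
    using S(2) by (intro inj_onI) (metis diff_gt_0_iff_gt diff_left_imp_eq eq_nat_nat_iff less_imp_le)
  have "int CARD('p) ^ card ((\<lambda>m. nat (n - m)) ` S) dvd poly P 1"
  proof (rule prime_power_dvd_of_roots)
    fix s assume "s \<in> (\<lambda>m. nat (n - m)) ` S"
    then show "s \<ge> 1 \<and> (\<exists>z::complex. z ^ (CARD('p) ^ s) = 1 \<and>
           z ^ (CARD('p) ^ (s - 1)) \<noteq> 1 \<and> poly (of_int_poly P) z = 0)"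
      using roots by blast
  qed (use S in simp)
  then have "int (CARD('p) ^ card S) dvd int (card (T \<inter> pball n))"
    unfolding P1 card_image[OF inj] by simp
  then show ?thesis by (simp only: int_dvd_int_iff)
qed simp

text \<open>
  For large \<open>n\<close>, the sums vanish at the levels in \<open>S\<close> and at all levels between \<open>base_level\<close> and \<open>n\<close>.
  So \<open>p\<close> to the power \<open>card S + n - base_level\<close> divides the number of translations in \<open>pball n\<close>, which
  is at most a constant times \<open>p\<^sup>n\<close>.
\<close>

lemma finite_exceptional_levels: "finite exceptional_levels"
proof -
  define D where "D = nat \<lfloor>real k * measure \<mu> (pball base_level) / (measure \<mu> \<Omega> / 2)\<rfloor>"
  have "finite exceptional_levels \<and> card exceptional_levels \<le> D"
  proof (rule finite_if_finite_subsets_card_bdd)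
    fix S assume S: "S \<subseteq> exceptional_levels" "finite S"
    have "\<forall>m\<in>S. \<exists>r. \<not> CARD('p) dvd r \<and>
        (\<forall>\<^sub>F N in sequentially. (\<Sum>t\<in>T \<inter> pball (int N). padic_char m t ^ r) = 0)"
      using S exceptional_level_sum_zero by blast
    then obtain r where r: "\<And>m. m \<in> S \<Longrightarrow> \<not> CARD('p) dvd r m"
      and ev: "\<And>m. m \<in> S \<Longrightarrow> \<forall>\<^sub>F N in sequentially. (\<Sum>t\<in>T \<inter> pball (int N). padic_char m t ^ r m) = 0"
      by metis
    have "\<forall>\<^sub>F N in sequentially. \<forall>m\<in>S. (\<Sum>t\<in>T \<inter> pball (int N). padic_char m t ^ r m) = 0"
      using S(2) ev by (simp add: eventually_ball_finite)
    moreover have "\<forall>\<^sub>F N in sequentially. N > nat base_level" by (rule eventually_gt_at_top)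
    moreover obtain t0 where t0: "t0 \<in> T" using translations_nonempty by blast
    obtain K0 :: nat where K0: "t0 \<in> pball (int K0)" using pball_exhaust by blast
    have "\<forall>\<^sub>F N in sequentially. N \<ge> K0" by (rule eventually_ge_at_top)
    ultimately have "\<forall>\<^sub>F N in sequentially. (\<forall>m\<in>S. (\<Sum>t\<in>T \<inter> pball (int N). padic_char m t ^ r m) = 0) \<and> N > nat base_level \<and> N \<ge> K0"
      by eventually_elim simp
    then obtain N where N: "\<And>m. m \<in> S \<Longrightarrow> (\<Sum>t\<in>T \<inter> pball (int N). padic_char m t ^ r m) = 0"
      "N > nat base_level" "N \<ge> K0"
      unfolding eventually_sequentially by blast
    define n where "n = int N"
    have n: "base_level < n" using N(2) by (simp add: n_def)
    have ne: "T \<inter> pball n \<noteq> {}"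
      using t0 K0 pball_mono[of "int K0" n] N(3) by (auto simp: n_def)
    \<comment> \<open>All levels at which the sum over \<open>pball n\<close> is known to vanish.\<close>
    define S' where "S' = S \<union> {base_level..<n}"
    have Slt: "m < base_level" if "m \<in> S" for m using that S by (auto simp: exceptional_levels_def)
    have "CARD('p) ^ card S' dvd card (T \<inter> pball n)"
    proof (rule vanishing_sum_dvd_card)
      show "finite S'" using S by (simp add: S'_def)
      fix m assume m: "m \<in> S'"
      show "m < n" using m Slt n by (fastforce simp: S'_def)
      show "\<exists>r. \<not> CARD('p) dvd r \<and> (\<Sum>t\<in>T \<inter> pball n. padic_char m t ^ r) = 0"
      proof (cases "m \<in> S")
        case True
        then show ?thesis using r N(1) unfolding n_def by blast
      next
        case False
        then have "(\<Sum>t\<in>T \<inter> pball n. padic_char m t ^ 1) = 0"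
          using low_frequency_sum_zero[of m n] m by (simp add: S'_def)
        moreover have "\<not> CARD('p) dvd 1" using p_gt_1[where 'p='p] by simp
        ultimately show ?thesis by blast
      qed
    qed
    moreover have "card (T \<inter> pball n) > 0" using ne finite_translations(2) by (simp add: card_gt_0_iff)
    ultimately have le: "CARD('p) ^ card S' \<le> card (T \<inter> pball n)" by (rule dvd_imp_le)
    have cS': "card S' = card S + nat (n - base_level)"
      unfolding S'_def using S Slt by (subst card_Un_disjoint) fastforce+
    have nm0: "n = base_level + int (nat (n - base_level))" using n by simp
    have Mpos: "measure \<mu> (\<Omega> \<inter> pball n) > measure \<mu> \<Omega> / 2"
      using base_level measure_Omega_pball_mono[of base_level n] n by simp
    let ?q = "real (CARD('p) ^ nat (n - base_level))"
    have q: "?q > 0" using p_gt_1[where 'p='p] by simp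
    have "?q * (real (CARD('p) ^ card S) * (measure \<mu> \<Omega> / 2)) = real (CARD('p) ^ card S') * (measure \<mu> \<Omega> / 2)"
      by (simp add: cS' power_add)
    also have "\<dots> \<le> real (card (T \<inter> pball n)) * measure \<mu> (\<Omega> \<inter> pball n)"
      using le Mpos measure_Omega_pos by (intro mult_mono) (simp_all add: of_nat_le_iff del: of_nat_power)
    also have "\<dots> \<le> real k * measure \<mu> (pball n)"
      by (rule card_translations_le[where x = 0]) (simp_all add: finite_translations)
    also have "\<dots> = ?q * (real k * measure \<mu> (pball base_level))"
      using measure_pball_add[of base_level "nat (n - base_level)"] nm0 by simp
    finally have "real (CARD('p) ^ card S) * (measure \<mu> \<Omega> / 2) \<le> real k * measure \<mu> (pball base_level)"
      using q by (simp only: mult_le_cancel_left_pos)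
    then have "real (CARD('p) ^ card S) \<le> real k * measure \<mu> (pball base_level) / (measure \<mu> \<Omega> / 2)"
      using measure_Omega_pos by (simp add: pos_le_divide_eq del: of_nat_power)
    then have "CARD('p) ^ card S \<le> D" unfolding D_def by linarith
    moreover have "card S < CARD('p) ^ card S" using p_gt_1[where 'p='p] by (intro less_exp[of "card S", THEN less_le_trans] power_mono) auto
    ultimately show "card S \<le> D" by linarith
  qed
  then show ?thesis ..
qed

text \<open>
  Below all exceptional levels the integrals vanish; powers of \<open>p\<close> in the exponent \<open>r\<close> only raise the
  level.
\<close>

lemma high_frequency_transform_zero:
  "\<exists>M. \<forall>L r h. h \<in> pball M \<longrightarrow> padic_char L (h :: 'p padic) ^ r \<noteq> 1 \<longrightarrow>
     (\<integral>y. indicator \<Omega> y * padic_char L y ^ r \<partial>\<mu>) = 0"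
proof -
  define M where "M = Min (insert base_level exceptional_levels)"
  have M: "M \<le> base_level" "\<And>m. m \<in> exceptional_levels \<Longrightarrow> M \<le> m"
    using finite_exceptional_levels by (auto simp: M_def)
  have "(\<integral>y. indicator \<Omega> y * padic_char L y ^ r \<partial>\<mu>) = 0"
    if h: "h \<in> pball M" "padic_char L (h :: 'p padic) ^ r \<noteq> 1" for L r h
  proof -
    have r0: "r > 0" using h by (cases r) auto
    have p: "prime CARD('p)" by (rule prime_card)
    obtain q where q: "r = CARD('p) ^ multiplicity CARD('p) r * q" "\<not> CARD('p) dvd q"
      using multiplicity_decompose'[of r "CARD('p)"] r0 p_gt_1[where 'p='p] by auto
    define v where "v = multiplicity CARD('p) r"
    have eq: "padic_char L y ^ r = padic_char (L + int v) y ^ q" for y :: "'p padic"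
      unfolding padic_char_Suc power_mult[symmetric] v_def q(1)[symmetric] ..
    have "L + int v < M"
    proof (rule ccontr)
      assume "\<not> ?thesis"
      then have "h \<in> pball (L + int v)" using h(1) pball_mono[of M "L + int v"] by auto
      then have "padic_char (L + int v) h = 1" by (simp only: padic_char_eq_1_iff)
      then show False using h(2) unfolding eq by simp
    qed
    then have "L + int v \<notin> exceptional_levels" "L + int v < base_level" using M by force+
    then show ?thesis unfolding eq using q(2) by (auto simp: exceptional_levels_def)
  qed
  then show ?thesis by blast
qed

end


section \<open>A multi-tile is a finite union of cosets\<close>

context padic_tiling
begin

text \<open>
  On the coset \<open>H\<close>, compare \<open>\<Omega>\<close> with its density \<open>\<alpha>\<close>: the difference of the indicator function of
  \<open>\<Omega> \<inter> H\<close> and \<open>\<alpha>\<close> times that of \<open>H\<close> has integral zero against every character of the tower, by the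
  choice of \<open>\<alpha>\<close> if the character is trivial on \<open>pball M\<close>, and by assumption otherwise.  Hence the
  difference is zero almost everywhere, so \<open>\<alpha>\<close> is \<open>0\<close> or \<open>1\<close>.
\<close>

lemma Omega_coset_dichotomy:
  assumes M: "\<And>L r h. h \<in> pball M \<Longrightarrow> padic_char L (h :: 'p padic) ^ r \<noteq> 1 \<Longrightarrow>
     (\<integral>y. indicator \<Omega> y * padic_char L y ^ r \<partial>\<mu>) = 0"
  shows "measure \<mu> (\<Omega> \<inter> pcoset M c) = 0 \<or> measure \<mu> (pcoset M c - \<Omega>) = 0"
proof -
  let ?H = "pcoset M c"
  define \<alpha> where "\<alpha> = measure \<mu> (\<Omega> \<inter> ?H) / measure \<mu> (pball M)"
  have \<alpha>: "measure \<mu> (\<Omega> \<inter> ?H) = \<alpha> * measure \<mu> (pball M)"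
    using measure_pball_pos[of M] by (simp add: \<alpha>_def)
  have sub: "\<Omega> \<inter> ?H \<in> fmeasurable \<mu>" by (rule sub_Omega_fmeasurable) auto
  define g where "g = (\<lambda>x. indicator (\<Omega> \<inter> ?H) x - complex_of_real \<alpha> * indicator ?H x)"
  have ig: "integrable \<mu> (\<lambda>x. indicator (\<Omega> \<inter> ?H) x :: complex)" "integrable \<mu> (\<lambda>x. indicator ?H x :: complex)"
    by (rule integrable_on_fmeasurable[OF _ sub, where B = 1], measurable, simp add: indicator_def)
      (rule integrable_on_fmeasurable[OF _ pcoset_fmeasurable(1)[of M c], where B = 1], measurable, simp add: indicator_def)
  have g: "integrable \<mu> g"
    unfolding g_def by (intro Bochner_Integration.integrable_diff integrable_mult_right ig)
  have transform: "(\<integral>x. g x * padic_char L x ^ r \<partial>\<mu>) = 0" for L r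
  proof -
    let ?\<psi> = "\<lambda>x :: 'p padic. padic_char L x ^ r"
    have \<psi>: "?\<psi> \<in> characters" by (rule padic_char_power_characters)
    have i1: "integrable \<mu> (\<lambda>x. indicator (\<Omega> \<inter> ?H) x * ?\<psi> x)"
      by (rule integrable_on_fmeasurable[OF _ sub, where B = 1]) (measurable, simp add: norm_mult norm_power indicator_def)
    have i2: "integrable \<mu> (\<lambda>x. ?\<psi> x * indicator ?H x)"
      by (rule integrable_on_fmeasurable[OF _ pcoset_fmeasurable(1)[of M c], where B = 1])
        (measurable, simp add: norm_mult norm_power indicator_def)
    have "(\<integral>x. g x * ?\<psi> x \<partial>\<mu>) =
        (\<integral>x. indicator (\<Omega> \<inter> ?H) x * ?\<psi> x - complex_of_real \<alpha> * (?\<psi> x * indicator ?H x) \<partial>\<mu>)"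
      by (rule Bochner_Integration.integral_cong[OF refl]) (simp add: g_def algebra_simps)
    also have "\<dots> = (\<integral>x. indicator (\<Omega> \<inter> ?H) x * ?\<psi> x \<partial>\<mu>) - complex_of_real \<alpha> * (\<integral>x. ?\<psi> x * indicator ?H x \<partial>\<mu>)"
      using i1 i2 by (subst Bochner_Integration.integral_diff) simp_all
    also have "\<dots> = 0"
    proof (cases "\<forall>h\<in>pball M. ?\<psi> h = 1")
      case True
      have const: "?\<psi> x = ?\<psi> c" if "x \<in> ?H" for x
      proof -
        have "?\<psi> x = ?\<psi> (x - c) * ?\<psi> c" using character_add[OF \<psi>, of "x - c" c] by simp
        then show ?thesis using True that by (simp add: pcoset_def)
      qed
      have "(\<integral>x. indicator (\<Omega> \<inter> ?H) x * ?\<psi> x \<partial>\<mu>) = (\<integral>x. ?\<psi> c * complex_of_real (indicator (\<Omega> \<inter> ?H) x) \<partial>\<mu>)"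
      proof (rule Bochner_Integration.integral_cong[OF refl])
        fix x
        show "indicator (\<Omega> \<inter> ?H) x * ?\<psi> x = ?\<psi> c * complex_of_real (indicator (\<Omega> \<inter> ?H) x)"
        proof (cases "x \<in> ?H")
          case True
          show ?thesis unfolding const[OF True] by (simp add: indicator_def)
        qed (simp add: indicator_def)
      qed
      also have "\<dots> = ?\<psi> c * complex_of_real (measure \<mu> (\<Omega> \<inter> ?H))" by simp
      finally have 1: "(\<integral>x. indicator (\<Omega> \<inter> ?H) x * ?\<psi> x \<partial>\<mu>) = ?\<psi> c * complex_of_real (measure \<mu> (\<Omega> \<inter> ?H))" .
      have "(\<integral>x. ?\<psi> x * indicator ?H x \<partial>\<mu>) = (\<integral>x. ?\<psi> c * complex_of_real (indicator ?H x) \<partial>\<mu>)"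
      proof (rule Bochner_Integration.integral_cong[OF refl])
        fix x
        show "?\<psi> x * indicator ?H x = ?\<psi> c * complex_of_real (indicator ?H x)"
        proof (cases "x \<in> ?H")
          case True
          show ?thesis unfolding const[OF True] by (simp add: indicator_def)
        qed (simp add: indicator_def)
      qed
      also have "\<dots> = ?\<psi> c * complex_of_real (measure \<mu> (pball M))" by (simp add: measure_pcoset)
      finally have 2: "(\<integral>x. ?\<psi> x * indicator ?H x \<partial>\<mu>) = ?\<psi> c * complex_of_real (measure \<mu> (pball M))" .
      show ?thesis unfolding 1 2 \<alpha> by simp
    next
      case False
      then obtain h where h: "h \<in> pball M" "?\<psi> h \<noteq> 1" by blast
      have LM: "L < M"
      proof (rule ccontr)
        assume "\<not> L < M"
        then have "h \<in> pball L" using h(1) pball_mono[of M L] by auto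
        then show False using h(2) by (simp add: padic_char_eq_1_iff[symmetric])
      qed
      \<comment> \<open>Powers of the character with kernel \<open>pball M\<close> are powers of \<open>padic_char L\<close>, so multiplying by
        them leads again to characters that are nontrivial at \<open>h\<close>.\<close>
      define v where "v = CARD('p) ^ nat (M - L)"
      have chM: "padic_char M x = padic_char L x ^ v" for x :: "'p padic"
        using padic_char_Suc[of L "nat (M - L)" x] LM by (simp add: v_def)
      have hM: "padic_char M h = 1" using h(1) by (simp only: padic_char_eq_1_iff)
      have "(\<integral>x. (indicator \<Omega> x * ?\<psi> x) * indicator ?H x \<partial>\<mu>) = 0"
      proof (rule integral_pcoset_zero_of_powers)
        show "integrable \<mu> (\<lambda>x. indicator \<Omega> x * ?\<psi> x)"
          by (rule integrable_on_fmeasurable[OF _ Omega_fmeasurable, where B = 1])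
            (measurable, simp add: norm_mult norm_power indicator_def)
        fix j
        have eq: "padic_char L x ^ (r + v * j) = ?\<psi> x * padic_char M x ^ j" for x :: "'p padic"
          by (simp add: chM power_add power_mult)
        have "padic_char L h ^ (r + v * j) \<noteq> 1" unfolding eq hM using h(2) by simp
        from M[OF h(1) this] show "(\<integral>x. indicator \<Omega> x * ?\<psi> x * padic_char M x ^ j \<partial>\<mu>) = 0"
          unfolding eq by (simp add: mult.assoc)
      qed
      moreover have "indicator \<Omega> x * ?\<psi> x * indicator ?H x = indicator (\<Omega> \<inter> ?H) x * ?\<psi> x" for x
        by (simp add: indicator_def)
      ultimately have 1: "(\<integral>x. indicator (\<Omega> \<inter> ?H) x * ?\<psi> x \<partial>\<mu>) = 0" by simp
      have 2: "(\<integral>x. ?\<psi> x * indicator ?H x \<partial>\<mu>) = 0"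
        by (rule integral_character_pcoset[OF \<psi> h])
      show ?thesis unfolding 1 2 by simp
    qed
    finally show ?thesis .
  qed
  have "AE x in \<mu>. g x = 0"
    by (rule AE_zero_of_integral_pcosets[OF g]) (rule integral_pcoset_zero_of_powers[OF g transform])
  show ?thesis
  proof (cases "\<alpha> = 0")
    case False
    have "AE x in \<mu>. x \<notin> ?H - \<Omega>"
      using \<open>AE x in \<mu>. g x = 0\<close>
    proof eventually_elim
      case (elim x)
      have "g x = - complex_of_real \<alpha>" if "x \<in> ?H - \<Omega>" using that by (simp add: g_def)
      then show ?case using False elim by auto
    qed
    then have "emeasure \<mu> (?H - \<Omega>) = 0"
      using AE_iff_measurable[of "?H - \<Omega>" \<mu> "\<lambda>x. x \<notin> ?H - \<Omega>"] by auto
    then show ?thesis by (simp add: measure_def)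
  qed (simp add: \<alpha>)
qed

lemma AE_not_in_of_measure_zero:
  assumes "A \<in> fmeasurable \<mu>" "measure \<mu> A = 0"
  shows "AE x in \<mu>. x \<notin> A"
proof (rule AE_not_in)
  have "emeasure \<mu> A = 0" using assms by (simp add: emeasure_eq_measure2)
  then show "A \<in> null_sets \<mu>" using assms by (auto simp: null_sets_def)
qed

text \<open>
  Only finitely many cosets can be filled, because each of them takes the same positive amount of
  the finite measure of \<open>\<Omega>\<close>.
\<close>

theorem Omega_AE_union_of_cosets:
  assumes M: "\<And>L r h. h \<in> pball M \<Longrightarrow> padic_char L (h :: 'p padic) ^ r \<noteq> 1 \<Longrightarrow>
     (\<integral>y. indicator \<Omega> y * padic_char L y ^ r \<partial>\<mu>) = 0"
  shows "\<exists>J c. inj_on (\<lambda>i. padic_char M (c i :: 'p padic)) {..<J::nat} \<and>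
    (AE x in \<mu>. x \<in> \<Omega> \<longleftrightarrow> (\<exists>i<J. x \<in> pcoset M (c i)))"
proof -
  define \<C> where "\<C> = {C \<in> range (pcoset M). measure \<mu> (\<Omega> \<inter> C) \<noteq> 0}"
  have dich: "measure \<mu> (\<Omega> \<inter> pcoset M c) = 0 \<or> measure \<mu> (pcoset M c - \<Omega>) = 0" for c
    by (rule Omega_coset_dichotomy[OF M])
  have fm: "\<Omega> \<inter> pcoset M c \<in> fmeasurable \<mu>" "pcoset M c - \<Omega> \<in> fmeasurable \<mu>" for c
    by (rule sub_Omega_fmeasurable; simp) (rule fmeasurableI2[OF pcoset_fmeasurable(1)[of M c]]; auto)
  have full: "measure \<mu> (C - \<Omega>) = 0" "measure \<mu> (\<Omega> \<inter> C) = measure \<mu> (pball M)" if C: "C \<in> \<C>" for C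
  proof -
    obtain c where c: "C = pcoset M c" using C by (auto simp: \<C>_def)
    show 0: "measure \<mu> (C - \<Omega>) = 0" using dich[of c] C c by (auto simp: \<C>_def)
    have "measure \<mu> ((\<Omega> \<inter> C) \<union> (C - \<Omega>)) = measure \<mu> (\<Omega> \<inter> C) + measure \<mu> (C - \<Omega>)"
      unfolding c by (rule measure_Union) (use fm[of c] in \<open>auto simp: fmeasurable_def less_top\<close>)
    moreover have "(\<Omega> \<inter> C) \<union> (C - \<Omega>) = C" by auto
    ultimately show "measure \<mu> (\<Omega> \<inter> C) = measure \<mu> (pball M)" using 0 by (simp add: c measure_pcoset)
  qed
  have disj: "C \<inter> D = {}" if "C \<in> range (pcoset M)" "D \<in> range (pcoset M)" "C \<noteq> D" for C D :: "'p padic set"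
    using that by (auto simp: pcoset_iff)
  have "finite \<C> \<and> card \<C> \<le> nat \<lfloor>measure \<mu> \<Omega> / measure \<mu> (pball M)\<rfloor>"
  proof (rule finite_if_finite_subsets_card_bdd)
    fix G assume G: "G \<subseteq> \<C>" "finite G"
    have Gr: "C \<in> range (pcoset M)" if "C \<in> G" for C using G that by (auto simp: \<C>_def)
    have "real (card G) * measure \<mu> (pball M) = (\<Sum>C\<in>G. measure \<mu> (\<Omega> \<inter> C))"
      using full(2) G by (simp add: subset_eq)
    also have "\<dots> = measure \<mu> (\<Union>C\<in>G. \<Omega> \<inter> C)"
    proof (rule measure_finite_Union[symmetric])
      show "(\<lambda>C. \<Omega> \<inter> C) ` G \<subseteq> sets \<mu>"
      proof (rule image_subsetI)
        fix C assume "C \<in> G"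
        then obtain c where "C = pcoset M c" using Gr by blast
        then show "\<Omega> \<inter> C \<in> sets \<mu>" by simp
      qed
      show "disjoint_family_on (\<lambda>C. \<Omega> \<inter> C) G"
        unfolding disjoint_family_on_def
      proof (intro ballI impI)
        fix C D assume "C \<in> G" "D \<in> G" "C \<noteq> D"
        from disj[OF Gr[OF this(1)] Gr[OF this(2)] this(3)] show "(\<Omega> \<inter> C) \<inter> (\<Omega> \<inter> D) = {}" by blast
      qed
      fix C assume "C \<in> G"
      then obtain c where "C = pcoset M c" using Gr by blast
      then show "emeasure \<mu> (\<Omega> \<inter> C) \<noteq> \<infinity>" using fm(1)[of c] by (simp add: fmeasurable_def)
    qed (rule G(2))
    also have "\<dots> \<le> measure \<mu> \<Omega>"
    proof (rule measure_mono_fmeasurable[OF _ _ Omega_fmeasurable])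
      show "(\<Union>C\<in>G. \<Omega> \<inter> C) \<in> sets \<mu>"
      proof (rule sets.finite_UN[OF G(2)])
        fix C assume "C \<in> G"
        then obtain c where "C = pcoset M c" using Gr by blast
        then show "\<Omega> \<inter> C \<in> sets \<mu>" by simp
      qed
    qed auto
    finally have "real (card G) \<le> measure \<mu> \<Omega> / measure \<mu> (pball M)"
      by (simp only: pos_le_divide_eq[OF measure_pball_pos])
    then show "card G \<le> nat \<lfloor>measure \<mu> \<Omega> / measure \<mu> (pball M)\<rfloor>" by linarith
  qed
  then have fin: "finite \<C>" ..
  define J where "J = card \<C>"
  obtain f where f: "bij_betw f {0..<J} \<C>" using ex_bij_betw_nat_finite[OF fin] unfolding J_def by blast
  have "\<exists>c. f i = pcoset M c" if "i < J" for i
  proof -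
    have "f i \<in> \<C>" using f that by (intro bij_betwE[OF f, rule_format]) simp
    then show ?thesis by (auto simp: \<C>_def)
  qed
  then obtain c where c: "\<And>i. i < J \<Longrightarrow> f i = pcoset M (c i)" by metis
  have f_im: "f ` {0..<J} = \<C>" and f_inj: "inj_on f {0..<J}" using f by (auto simp: bij_betw_def)
  have "inj_on (\<lambda>i. padic_char M (c i)) {..<J}"
  proof (rule inj_onI)
    fix i j assume ij: "i \<in> {..<J}" "j \<in> {..<J}" "padic_char M (c i) = padic_char M (c j)"
    then have "pcoset M (c i) = pcoset M (c j)" by (auto simp: pcoset_iff)
    then have "f i = f j" using ij c by simp
    then show "i = j" using inj_onD[OF f_inj] ij by auto
  qed
  moreover have "AE x in \<mu>. x \<in> \<Omega> \<longleftrightarrow> (\<exists>i<J. x \<in> pcoset M (c i))"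
  proof -
    have cnt: "countable (range (pcoset M :: 'p padic \<Rightarrow> _))"
      by (rule countable_subset[OF _ countable_pcosets]) auto
    have "\<forall>C\<in>range (pcoset M). AE x in \<mu>. x \<in> C \<longrightarrow> (x \<in> \<Omega> \<longleftrightarrow> C \<in> \<C>)"
    proof
      fix C :: "'p padic set" assume C: "C \<in> range (pcoset M)"
      then obtain d where d: "C = pcoset M d" by blast
      show "AE x in \<mu>. x \<in> C \<longrightarrow> (x \<in> \<Omega> \<longleftrightarrow> C \<in> \<C>)"
      proof (cases "C \<in> \<C>")
        case True
        have "AE x in \<mu>. x \<notin> C - \<Omega>"
          using AE_not_in_of_measure_zero[OF fm(2)[of d]] full(1)[OF True] by (simp add: d)
        then show ?thesis by eventually_elim (use True in auto)
      next
        case False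
        then have "measure \<mu> (\<Omega> \<inter> C) = 0" using C by (simp add: \<C>_def)
        then have "AE x in \<mu>. x \<notin> \<Omega> \<inter> C"
          using AE_not_in_of_measure_zero[OF fm(1)[of d]] by (simp add: d)
        then show ?thesis by eventually_elim (use False in auto)
      qed
    qed
    then have "AE x in \<mu>. \<forall>C\<in>range (pcoset M). x \<in> C \<longrightarrow> (x \<in> \<Omega> \<longleftrightarrow> C \<in> \<C>)"
      by (simp only: AE_ball_countable[OF cnt])
    then show ?thesis
    proof eventually_elim
      case (elim x)
      then have "x \<in> \<Omega> \<longleftrightarrow> pcoset M x \<in> \<C>" by auto
      also have "\<dots> \<longleftrightarrow> (\<exists>i<J. pcoset M x = pcoset M (c i))"
        unfolding f_im[symmetric] using c by (auto simp: image_iff)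
      also have "\<dots> \<longleftrightarrow> (\<exists>i<J. x \<in> pcoset M (c i))"
      proof -
        have "pcoset M x = pcoset M d \<longleftrightarrow> x \<in> pcoset M d" for d
          by (auto simp: pcoset_iff)
        then show ?thesis by simp
      qed
      finally show ?case .
    qed
  qed
  ultimately show ?thesis by blast
qed

end


section \<open>The Hilbert space of square-integrable functions\<close>

abbreviation L2_dist :: "'a measure \<Rightarrow> ('a \<Rightarrow> complex) \<Rightarrow> ('a \<Rightarrow> complex) \<Rightarrow> real" where
  "L2_dist M f g \<equiv> L2_norm M (\<lambda>x. f x - g x)"

abbreviation lincomb :: "'i set \<Rightarrow> ('i \<Rightarrow> complex) \<Rightarrow> ('i \<Rightarrow> 'a \<Rightarrow> complex) \<Rightarrow> 'a \<Rightarrow> complex" where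
  "lincomb F c u \<equiv> (\<lambda>x. \<Sum>i\<in>F. c i * u i x)"

lemma L2_measurable: "f \<in> L2 M \<Longrightarrow> f \<in> borel_measurable M"
  and L2_integrable_sq: "f \<in> L2 M \<Longrightarrow> integrable M (\<lambda>x. (cmod (f x))\<^sup>2)"
  by (auto simp: L2_def)

lemma L2_integrable_norm_mult:
  assumes "f \<in> L2 M" "g \<in> L2 M"
  shows "integrable M (\<lambda>x. cmod (f x) * cmod (g x))"
proof (rule Bochner_Integration.integrable_bound)
  show "integrable M (\<lambda>x. (cmod (f x))\<^sup>2 + (cmod (g x))\<^sup>2)"
    by (intro Bochner_Integration.integrable_add L2_integrable_sq assms)
  have [measurable]: "f \<in> borel_measurable M" "g \<in> borel_measurable M"
    by (simp_all add: L2_measurable assms)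
  show "(\<lambda>x. cmod (f x) * cmod (g x)) \<in> borel_measurable M" by measurable
  have "a * b \<le> a\<^sup>2 + b\<^sup>2" if "a \<ge> 0" "b \<ge> 0" for a b :: real
    using sum_squares_bound[of a b] mult_nonneg_nonneg[OF that] by linarith
  then show "AE x in M. norm (cmod (f x) * cmod (g x)) \<le> norm ((cmod (f x))\<^sup>2 + (cmod (g x))\<^sup>2)"
    by simp
qed

lemma L2_integrable_mult:
  assumes "f \<in> L2 M" "g \<in> L2 M"
  shows "integrable M (\<lambda>x. f x * g x)"
proof (rule Bochner_Integration.integrable_bound[OF L2_integrable_norm_mult[OF assms]])
  have [measurable]: "f \<in> borel_measurable M" "g \<in> borel_measurable M"
    by (simp_all add: L2_measurable assms)
  show "(\<lambda>x. f x * g x) \<in> borel_measurable M" by measurable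
qed (simp add: norm_mult)

lemma borel_measurable_cnj [measurable (raw)]:
  "f \<in> borel_measurable M \<Longrightarrow> (\<lambda>x. cnj (f x)) \<in> borel_measurable M"
  by (rule borel_measurable_continuous_on[where f = cnj]) (auto intro: continuous_intros)

lemma L2_cnj: "f \<in> L2 M \<Longrightarrow> (\<lambda>x. cnj (f x)) \<in> L2 M"
  by (auto simp: L2_def borel_measurable_cnj)

lemma L2_zero: "(\<lambda>x. 0) \<in> L2 M"
  by (simp add: L2_def)

lemma L2_scale: "f \<in> L2 M \<Longrightarrow> (\<lambda>x. c * f x) \<in> L2 M"
  by (auto simp: L2_def norm_mult power_mult_distrib)

lemma L2_add:
  assumes "f \<in> L2 M" "g \<in> L2 M"
  shows "(\<lambda>x. f x + g x) \<in> L2 M"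
proof -
  have [measurable]: "f \<in> borel_measurable M" "g \<in> borel_measurable M"
    by (simp_all add: L2_measurable assms)
  have "integrable M (\<lambda>x. (cmod (f x + g x))\<^sup>2)"
  proof (rule Bochner_Integration.integrable_bound)
    show "integrable M (\<lambda>x. (cmod (f x))\<^sup>2 + 2 * (cmod (f x) * cmod (g x)) + (cmod (g x))\<^sup>2)"
      by (intro Bochner_Integration.integrable_add integrable_mult_right L2_integrable_sq L2_integrable_norm_mult assms)
    have "(cmod (a + b))\<^sup>2 \<le> (cmod a)\<^sup>2 + 2 * (cmod a * cmod b) + (cmod b)\<^sup>2" for a b
      using power_mono[OF norm_triangle_ineq[of a b] norm_ge_zero, of 2] by (simp add: power2_sum)
    then show "AE x in M. norm ((cmod (f x + g x))\<^sup>2)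
        \<le> norm ((cmod (f x))\<^sup>2 + 2 * (cmod (f x) * cmod (g x)) + (cmod (g x))\<^sup>2)"
      by simp
  qed measurable
  then show ?thesis by (simp add: L2_def)
qed

lemma L2_diff: "f \<in> L2 M \<Longrightarrow> g \<in> L2 M \<Longrightarrow> (\<lambda>x. f x - g x) \<in> L2 M"
  using L2_add[of f M "\<lambda>x. - 1 * g x"] L2_scale[of g M "- 1"] by simp

lemma L2_sum: "(\<And>i. i \<in> F \<Longrightarrow> u i \<in> L2 M) \<Longrightarrow> (lincomb F c u) \<in> L2 M"
  by (induction F rule: infinite_finite_induct) (auto intro!: L2_zero L2_add L2_scale)

lemma L2_bounded:
  assumes "finite_measure M" and [measurable]: "f \<in> borel_measurable M" and "\<And>x. cmod (f x) \<le> B"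
  shows "f \<in> L2 M"
proof -
  interpret finite_measure M by fact
  have "integrable M (\<lambda>x. (cmod (f x))\<^sup>2)"
    by (rule integrable_const_bound[where B = "B\<^sup>2"]) (auto intro!: power_mono assms)
  then show ?thesis by (simp add: L2_def)
qed

lemma L2_norm_nonneg [simp]: "0 \<le> L2_norm M f"
  by (simp add: L2_norm_def)

lemma L2_norm_sq: "(L2_norm M f)\<^sup>2 = (\<integral>x. (cmod (f x))\<^sup>2 \<partial>M)"
  by (simp add: L2_norm_def)

lemma L2_norm_cong_AE:
  assumes "f \<in> L2 M" "g \<in> L2 M" "AE x in M. f x = g x"
  shows "L2_norm M f = L2_norm M g"
proof -
  have [measurable]: "f \<in> borel_measurable M" "g \<in> borel_measurable M"
    by (simp_all add: L2_measurable assms)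
  have "(\<integral>x. (cmod (f x))\<^sup>2 \<partial>M) = (\<integral>x. (cmod (g x))\<^sup>2 \<partial>M)"
    by (intro integral_cong_AE) (use assms(3) in auto)
  then show ?thesis by (simp add: L2_norm_def)
qed

lemma L2_norm_scale: "L2_norm M (\<lambda>x. c * f x) = cmod c * L2_norm M f"
  by (simp add: L2_norm_def norm_mult power_mult_distrib real_sqrt_mult)

lemma L2_norm_minus_commute: "L2_dist M f g = L2_dist M g f"
  by (simp add: L2_norm_def norm_minus_commute)

lemma L2_norm_eq_0_iff:
  assumes "f \<in> L2 M"
  shows "L2_norm M f = 0 \<longleftrightarrow> (AE x in M. f x = 0)"
  using integral_nonneg_eq_0_iff_AE[OF L2_integrable_sq[OF assms]] by (simp add: L2_norm_def)

text \<open>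
  Expand the integral of the square of \<open>b * cmod (f x) - a * cmod (g x)\<close>, where \<open>a\<close> and \<open>b\<close> are the
  norms.
\<close>

lemma L2_Cauchy_Schwarz:
  assumes f: "f \<in> L2 M" and g: "g \<in> L2 M"
  shows "(\<integral>x. cmod (f x) * cmod (g x) \<partial>M) \<le> L2_norm M f * L2_norm M g"
proof -
  define a b where "a = L2_norm M f" and "b = L2_norm M g"
  let ?I = "\<integral>x. cmod (f x) * cmod (g x) \<partial>M"
  have [measurable]: "f \<in> borel_measurable M" "g \<in> borel_measurable M"
    by (simp_all add: L2_measurable assms)
  note int = L2_integrable_sq[OF f] L2_integrable_sq[OF g] L2_integrable_norm_mult[OF f g]
  show ?thesis
  proof (cases "a = 0 \<or> b = 0")
    case True
    then have "AE x in M. cmod (f x) * cmod (g x) = 0"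
      using L2_norm_eq_0_iff[OF f] L2_norm_eq_0_iff[OF g] by (auto simp: a_def b_def)
    then have "?I = (\<integral>x. 0 \<partial>M)" by (intro integral_cong_AE) auto
    then show ?thesis by simp
  next
    case False
    then have pos: "a > 0" "b > 0" by (auto simp: a_def b_def less_le)
    have "0 \<le> (\<integral>x. (b * cmod (f x) - a * cmod (g x))\<^sup>2 \<partial>M)" by simp
    also have "\<dots> = (\<integral>x. b\<^sup>2 * (cmod (f x))\<^sup>2 + a\<^sup>2 * (cmod (g x))\<^sup>2 - (2 * a * b) * (cmod (f x) * cmod (g x)) \<partial>M)"
      by (intro Bochner_Integration.integral_cong) (auto simp: power2_diff power_mult_distrib algebra_simps)
    also have "\<dots> = b\<^sup>2 * a\<^sup>2 + a\<^sup>2 * b\<^sup>2 - (2 * a * b) * ?I"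
      unfolding a_def b_def L2_norm_sq using int by simp
    also have "\<dots> = (2 * a * b) * (a * b - ?I)" by (simp add: power2_eq_square algebra_simps)
    finally have "0 \<le> a * b - ?I"
      using mult_le_cancel_left_pos[of "2 * a * b" 0 "a * b - ?I"] pos by simp
    then show ?thesis by (simp add: a_def b_def)
  qed
qed

lemma L2_norm_triangle:
  assumes f: "f \<in> L2 M" and g: "g \<in> L2 M"
  shows "L2_norm M (\<lambda>x. f x + g x) \<le> L2_norm M f + L2_norm M g"
proof (rule power2_le_imp_le)
  note int = L2_integrable_sq[OF f] L2_integrable_sq[OF g] L2_integrable_norm_mult[OF f g]
  have "(L2_norm M (\<lambda>x. f x + g x))\<^sup>2 = (\<integral>x. (cmod (f x + g x))\<^sup>2 \<partial>M)" by (rule L2_norm_sq)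
  also have "\<dots> \<le> (\<integral>x. (cmod (f x))\<^sup>2 + 2 * (cmod (f x) * cmod (g x)) + (cmod (g x))\<^sup>2 \<partial>M)"
  proof (rule integral_mono)
    have "(cmod (a + b))\<^sup>2 \<le> (cmod a)\<^sup>2 + 2 * (cmod a * cmod b) + (cmod b)\<^sup>2" for a b
      using power_mono[OF norm_triangle_ineq[of a b] norm_ge_zero, of 2] by (simp add: power2_sum)
    then show "(cmod (f x + g x))\<^sup>2 \<le> (cmod (f x))\<^sup>2 + 2 * (cmod (f x) * cmod (g x)) + (cmod (g x))\<^sup>2" for x .
  qed (use int L2_integrable_sq[OF L2_add[OF f g]] in auto)
  also have "\<dots> = (L2_norm M f)\<^sup>2 + 2 * (\<integral>x. cmod (f x) * cmod (g x) \<partial>M) + (L2_norm M g)\<^sup>2"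
    unfolding L2_norm_sq using int by simp
  also have "\<dots> \<le> (L2_norm M f + L2_norm M g)\<^sup>2"
    using L2_Cauchy_Schwarz[OF f g] by (simp add: power2_sum)
  finally show "(L2_norm M (\<lambda>x. f x + g x))\<^sup>2 \<le> (L2_norm M f + L2_norm M g)\<^sup>2" .
qed simp

lemma L2_norm_diff_triangle:
  assumes f: "f \<in> L2 M" and g: "g \<in> L2 M" and h: "h \<in> L2 M"
  shows "L2_dist M f h \<le> L2_dist M f g + L2_dist M g h"
  using L2_norm_triangle[OF L2_diff[OF f g] L2_diff[OF g h]] by simp

lemma L2_norm_le_diff:
  assumes f: "f \<in> L2 M" and g: "g \<in> L2 M"
  shows "L2_norm M f \<le> L2_dist M f g + L2_norm M g"
  using L2_norm_triangle[OF L2_diff[OF f g] g] by simp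

lemma integrable_inner: "f \<in> L2 M \<Longrightarrow> g \<in> L2 M \<Longrightarrow> integrable M (\<lambda>x. f x * cnj (g x))"
  by (intro L2_integrable_mult L2_cnj)

lemma L2_inner_le:
  assumes f: "f \<in> L2 M" and g: "g \<in> L2 M"
  shows "cmod (L2_inner M f g) \<le> L2_norm M f * L2_norm M g"
proof -
  have "cmod (L2_inner M f g) \<le> (\<integral>x. norm (f x * cnj (g x)) \<partial>M)"
    unfolding L2_inner_def by (rule integral_norm_bound)
  also have "\<dots> = (\<integral>x. cmod (f x) * cmod (g x) \<partial>M)" by (simp add: norm_mult)
  finally show ?thesis using L2_Cauchy_Schwarz[OF f g] by simp
qed

lemma L2_inner_diff_left:
  "f \<in> L2 M \<Longrightarrow> g \<in> L2 M \<Longrightarrow> h \<in> L2 M \<Longrightarrow>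
    L2_inner M (\<lambda>x. f x - g x) h = L2_inner M f h - L2_inner M g h"
  by (simp add: L2_inner_def left_diff_distrib integrable_inner)

lemma L2_inner_sum_left:
  assumes "\<And>i. i \<in> F \<Longrightarrow> u i \<in> L2 M" "h \<in> L2 M"
  shows "L2_inner M (lincomb F c u) h = (\<Sum>i\<in>F. c i * L2_inner M (u i) h)"
proof -
  have "L2_inner M (lincomb F c u) h = (\<integral>x. (\<Sum>i\<in>F. c i * (u i x * cnj (h x))) \<partial>M)"
    by (simp only: L2_inner_def sum_distrib_right mult.assoc)
  also have "\<dots> = (\<Sum>i\<in>F. c i * L2_inner M (u i) h)"
    unfolding L2_inner_def by (subst Bochner_Integration.integral_sum) (auto intro!: integrable_inner assms)
  finally show ?thesis .
qed

lemma L2_inner_cnj: "L2_inner M f g = cnj (L2_inner M g f)"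
proof -
  have "cnj (L2_inner M g f) = (\<integral>x. cnj (g x * cnj (f x)) \<partial>M)"
    unfolding L2_inner_def by (rule Bochner_Integration.integral_cnj[symmetric])
  then show ?thesis by (simp add: L2_inner_def mult.commute)
qed

lemma L2_inner_self: "L2_inner M f f = of_real ((L2_norm M f)\<^sup>2)"
proof -
  have "L2_inner M f f = (\<integral>x. of_real ((cmod (f x))\<^sup>2) \<partial>M)"
    unfolding L2_inner_def by (rule Bochner_Integration.integral_cong[OF refl]) (simp only: complex_norm_square)
  also have "\<dots> = of_real (\<integral>x. (cmod (f x))\<^sup>2 \<partial>M)" by (rule integral_complex_of_real)
  finally show ?thesis by (simp only: L2_norm_sq)
qed

lemma L2_norm_sum_orthonormal:
  assumes "finite F" "\<And>i. i \<in> F \<Longrightarrow> u i \<in> L2 M"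
    and "\<And>i j. i \<in> F \<Longrightarrow> j \<in> F \<Longrightarrow> L2_inner M (u i) (u j) = (if i = j then 1 else 0)"
  shows "(L2_norm M (lincomb F c u))\<^sup>2 = (\<Sum>i\<in>F. (cmod (c i))\<^sup>2)"
proof -
  let ?s = "\<lambda>x. \<Sum>i\<in>F. c i * u i x"
  have s: "?s \<in> L2 M" by (rule L2_sum) (rule assms)
  have *: "L2_inner M (u i) ?s = cnj (c i)" if "i \<in> F" for i
  proof -
    have "L2_inner M ?s (u i) = (\<Sum>j\<in>F. c j * L2_inner M (u j) (u i))"
      by (rule L2_inner_sum_left) (auto intro: assms that)
    also have "\<dots> = (\<Sum>j\<in>F. if j = i then c j else 0)"
      by (rule sum.cong[OF refl]) (simp add: assms(3) that)
    also have "\<dots> = c i" using that assms(1) by (simp add: sum.delta)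
    finally show ?thesis using L2_inner_cnj[of M "u i" ?s] by simp
  qed
  have "of_real ((L2_norm M ?s)\<^sup>2) = L2_inner M ?s ?s" by (simp add: L2_inner_self)
  also have "\<dots> = (\<Sum>i\<in>F. c i * L2_inner M (u i) ?s)"
    by (rule L2_inner_sum_left) (auto intro: assms s)
  also have "\<dots> = (\<Sum>i\<in>F. c i * cnj (c i))"
    by (rule sum.cong[OF refl]) (simp add: *)
  also have "\<dots> = of_real (\<Sum>i\<in>F. (cmod (c i))\<^sup>2)" by (simp only: of_real_sum complex_norm_square)
  finally show ?thesis by (simp only: of_real_eq_iff)
qed

lemma L2_Bessel:
  assumes "finite F" "\<And>i. i \<in> F \<Longrightarrow> u i \<in> L2 M"
    and "\<And>i j. i \<in> F \<Longrightarrow> j \<in> F \<Longrightarrow> L2_inner M (u i) (u j) = (if i = j then 1 else 0)"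
    and f: "f \<in> L2 M"
  shows "(\<Sum>i\<in>F. (cmod (L2_inner M f (u i)))\<^sup>2) \<le> (L2_norm M f)\<^sup>2"
proof -
  let ?c = "\<lambda>i. L2_inner M f (u i)"
  let ?s = "\<lambda>x. \<Sum>i\<in>F. ?c i * u i x"
  let ?S = "\<Sum>i\<in>F. (cmod (?c i))\<^sup>2"
  have s: "?s \<in> L2 M" by (rule L2_sum) (rule assms)
  have "L2_inner M ?s f = (\<Sum>i\<in>F. ?c i * L2_inner M (u i) f)"
    by (rule L2_inner_sum_left) (auto intro: assms f)
  also have "\<dots> = (\<Sum>i\<in>F. ?c i * cnj (?c i))"
    by (rule sum.cong[OF refl]) (simp only: L2_inner_cnj[of M _ f])
  finally have sf: "L2_inner M ?s f = of_real ?S" by (simp only: of_real_sum complex_norm_square)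
  have "?S \<le> L2_norm M ?s * L2_norm M f"
    using L2_inner_le[OF s f] unfolding sf norm_of_real by simp
  moreover have "(L2_norm M ?s)\<^sup>2 = ?S"
    by (rule L2_norm_sum_orthonormal) (use assms in auto)
  ultimately have "(L2_norm M ?s)\<^sup>2 \<le> L2_norm M ?s * L2_norm M f" by simp
  then have le: "L2_norm M ?s * L2_norm M ?s \<le> L2_norm M ?s * L2_norm M f"
    by (simp only: power2_eq_square)
  have "L2_norm M ?s \<le> L2_norm M f"
  proof (cases "L2_norm M ?s = 0")
    case False
    then have "0 < L2_norm M ?s" using L2_norm_nonneg[of M ?s] by linarith
    then show ?thesis using le by (simp only: mult_le_cancel_left_pos)
  qed simp
  then have "(L2_norm M ?s)\<^sup>2 \<le> (L2_norm M f)\<^sup>2" by (intro power_mono) auto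
  then show ?thesis using \<open>(L2_norm M ?s)\<^sup>2 = ?S\<close> by simp
qed

text \<open>
  A subsequence has increments of norm at most \<open>(1/2)\<^sup>k\<close>.  On a finite measure space these are
  summable in mean, so the subsequence converges almost everywhere; by Fatou's lemma the pointwise
  limit is the limit in norm.
\<close>

theorem L2_complete:
  fixes s :: "nat \<Rightarrow> 'a \<Rightarrow> complex"
  assumes "finite_measure M" and s: "\<And>n. s n \<in> L2 M"
    and cau: "\<And>e. e > 0 \<Longrightarrow> \<exists>N. \<forall>m\<ge>N. \<forall>n\<ge>N. L2_dist M (s m) (s n) < e"
  shows "\<exists>h\<in>L2 M. (\<lambda>n. L2_dist M (s n) h) \<longlonglongrightarrow> 0"
proof -
  interpret finite_measure M by fact
  have one: "(\<lambda>x. 1) \<in> L2 M" by (rule L2_bounded[OF assms(1), of _ 1]) auto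
  have "\<exists>N. \<forall>m\<ge>N. \<forall>n\<ge>N. L2_dist M (s m) (s n) < (1/2)^k" for k :: nat
    by (rule cau) simp
  then obtain r where r: "\<And>k m n. m \<ge> r k \<Longrightarrow> n \<ge> r k \<Longrightarrow> L2_dist M (s m) (s n) < (1/2)^k"
    by metis
  \<comment> \<open>A monotone majorant of the thresholds \<open>r\<close>.\<close>
  define q where "q k = (\<Sum>i\<le>k. r i)" for k
  have qr: "q j \<ge> r k" if "j \<ge> k" for j k
    unfolding q_def using that by (intro member_le_sum) auto
  define t where "t k = s (q k)" for k
  have t: "t k \<in> L2 M" for k by (simp add: t_def s)
  have [measurable]: "t k \<in> borel_measurable M" for k using t L2_measurable by blast
  have tt: "L2_dist M (t j) (t k) < (1/2)^k" if "j \<ge> k" for j k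
    unfolding t_def using that by (intro r qr) auto
  have "AE x in M. convergent (\<lambda>k. t k x)"
  proof -
    have "(\<integral>\<^sup>+x. (\<Sum>k. ennreal (cmod (t (Suc k) x - t k x))) \<partial>M) =
        (\<Sum>k. \<integral>\<^sup>+x. ennreal (cmod (t (Suc k) x - t k x)) \<partial>M)"
      by (rule nn_integral_suminf) measurable
    also have "\<dots> \<le> (\<Sum>k. ennreal ((1/2)^k * L2_norm M (\<lambda>x. 1)))"
    proof (intro suminf_le allI)
      fix k
      have d: "(\<lambda>x. t (Suc k) x - t k x) \<in> L2 M" by (intro L2_diff t)
      have "integrable M (\<lambda>x. cmod (t (Suc k) x - t k x))"
        using L2_integrable_norm_mult[OF d one] by simp
      then have "(\<integral>\<^sup>+x. ennreal (cmod (t (Suc k) x - t k x)) \<partial>M) = ennreal (\<integral>x. cmod (t (Suc k) x - t k x) \<partial>M)"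
        by (intro nn_integral_eq_integral) auto
      also have "(\<integral>x. cmod (t (Suc k) x - t k x) \<partial>M) \<le> L2_dist M (t (Suc k)) (t k) * L2_norm M (\<lambda>x. 1)"
        using L2_Cauchy_Schwarz[OF d one] by simp
      also have "\<dots> \<le> (1/2)^k * L2_norm M (\<lambda>x. 1)"
        using tt[of k "Suc k"] by (intro mult_right_mono) auto
      finally show "(\<integral>\<^sup>+x. ennreal (cmod (t (Suc k) x - t k x)) \<partial>M) \<le> ennreal ((1/2)^k * L2_norm M (\<lambda>x. 1))"
        by (simp add: ennreal_leI)
    qed auto
    also have "\<dots> < \<infinity>"
    proof -
      have "summable (\<lambda>k. (1/2::real)^k * L2_norm M (\<lambda>x. 1))"
        by (intro summable_mult2 summable_geometric) simp
      then have "(\<Sum>k. ennreal ((1/2)^k * L2_norm M (\<lambda>x. 1))) = ennreal (\<Sum>k. (1/2)^k * L2_norm M (\<lambda>x. 1))"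
        by (intro suminf_ennreal2) auto
      then show ?thesis by simp
    qed
    finally have "AE x in M. (\<Sum>k. ennreal (cmod (t (Suc k) x - t k x))) \<noteq> \<infinity>"
      by (intro nn_integral_PInf_AE) auto
    then show ?thesis
    proof eventually_elim
      case (elim x)
      then have "summable (\<lambda>k. cmod (t (Suc k) x - t k x))"
        by (intro summable_suminf_not_top) auto
      then have "summable (\<lambda>k. t (Suc k) x - t k x)" by (rule summable_norm_cancel)
      then have "convergent (\<lambda>n. \<Sum>k<n. (t (Suc k) x - t k x))"
        by (simp add: summable_iff_convergent)
      moreover have "(\<Sum>k<n. (t (Suc k) x - t k x)) = t n x - t 0 x" for n
        by (rule sum_lessThan_telescope)
      ultimately have "convergent (\<lambda>n. t n x - t 0 x)" by simp
      then have "convergent (\<lambda>n. (t n x - t 0 x) + t 0 x)" by (intro convergent_add convergent_const)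
      then show ?case by simp
    qed
  qed
  define h where "h x = lim (\<lambda>k. t k x)" for x
  have [measurable]: "h \<in> borel_measurable M" unfolding h_def by measurable
  have lim: "AE x in M. (\<lambda>k. t k x) \<longlonglongrightarrow> h x"
    using \<open>AE x in M. convergent (\<lambda>k. t k x)\<close> by (simp add: h_def convergent_LIMSEQ_iff)
  have fat: "(\<lambda>x. h x - t k x) \<in> L2 M \<and> L2_dist M h (t k) \<le> (1/2)^k" for k
  proof -
    have "(\<integral>\<^sup>+x. ennreal ((cmod (h x - t k x))\<^sup>2) \<partial>M) =
        (\<integral>\<^sup>+x. liminf (\<lambda>j. ennreal ((cmod (t j x - t k x))\<^sup>2)) \<partial>M)"
    proof (rule nn_integral_cong_AE, use lim in eventually_elim)
      case (elim x)
      then have "(\<lambda>j. ennreal ((cmod (t j x - t k x))\<^sup>2)) \<longlonglongrightarrow> ennreal ((cmod (h x - t k x))\<^sup>2)"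
        by (intro tendsto_intros)
      then show ?case by (intro lim_imp_Liminf[symmetric]) auto
    qed
    also have "\<dots> \<le> liminf (\<lambda>j. \<integral>\<^sup>+x. ennreal ((cmod (t j x - t k x))\<^sup>2) \<partial>M)"
      by (rule nn_integral_liminf) measurable
    also have "\<dots> \<le> ennreal (((1/2)^k)\<^sup>2)"
    proof (rule Liminf_le)
      show "\<forall>\<^sub>F j in sequentially. (\<integral>\<^sup>+x. ennreal ((cmod (t j x - t k x))\<^sup>2) \<partial>M) \<le> ennreal (((1/2)^k)\<^sup>2)"
        using eventually_ge_at_top[of k]
      proof eventually_elim
        case (elim j)
        have "(\<integral>\<^sup>+x. ennreal ((cmod (t j x - t k x))\<^sup>2) \<partial>M) = ennreal (\<integral>x. (cmod (t j x - t k x))\<^sup>2 \<partial>M)"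
          by (intro nn_integral_eq_integral L2_integrable_sq L2_diff t) auto
        also have "\<dots> = ennreal ((L2_dist M (t j) (t k))\<^sup>2)" by (simp add: L2_norm_sq)
        also have "\<dots> \<le> ennreal (((1/2)^k)\<^sup>2)"
          using tt[OF elim] by (intro ennreal_leI power_mono) auto
        finally show ?case .
      qed
    qed simp
    finally have le: "(\<integral>\<^sup>+x. ennreal ((cmod (h x - t k x))\<^sup>2) \<partial>M) \<le> ennreal (((1/2)^k)\<^sup>2)" .
    then have "integrable M (\<lambda>x. (cmod (h x - t k x))\<^sup>2)"
      by (intro integrableI_bounded) (auto intro: le_less_trans)
    then have L: "(\<lambda>x. h x - t k x) \<in> L2 M" by (simp add: L2_def)
    have "ennreal ((L2_dist M h (t k))\<^sup>2) = (\<integral>\<^sup>+x. ennreal ((cmod (h x - t k x))\<^sup>2) \<partial>M)"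
      unfolding L2_norm_sq using L2_integrable_sq[OF L] by (intro nn_integral_eq_integral[symmetric]) auto
    then have "ennreal ((L2_dist M h (t k))\<^sup>2) \<le> ennreal (((1/2)^k)\<^sup>2)" using le by simp
    then have "(L2_dist M h (t k))\<^sup>2 \<le> ((1/2)^k)\<^sup>2" by (subst (asm) ennreal_le_iff) auto
    then have "L2_dist M h (t k) \<le> (1/2)^k" by (rule power2_le_imp_le) simp
    then show ?thesis using L by blast
  qed
  have h: "h \<in> L2 M" using L2_add[OF conjunct1[OF fat[of 0]] t[of 0]] by simp
  have "(\<lambda>n. L2_dist M (s n) h) \<longlonglongrightarrow> 0"
  proof (rule LIMSEQ_I)
    fix e :: real assume e: "e > 0"
    obtain k where k: "(1/2::real)^k < e / 2" using real_arch_pow_inv[of "e/2" "1/2"] e by auto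
    have "L2_dist M (s n) h < e" if "n \<ge> r k" for n
    proof -
      have "L2_dist M (s n) h \<le> L2_dist M (s n) (t k) + L2_dist M (t k) h"
        by (rule L2_norm_diff_triangle) (rule s t h)+
      moreover have "L2_dist M (s n) (t k) < (1/2)^k"
        unfolding t_def using that by (intro r qr) auto
      moreover have "L2_dist M (t k) h \<le> (1/2)^k"
        using fat[of k] by (simp add: L2_norm_minus_commute)
      ultimately show ?thesis using k by simp
    qed
    then show "\<exists>no. \<forall>n\<ge>no. norm (L2_dist M (s n) h - 0) < e" by auto
  qed
  then show ?thesis using h by blast
qed


text \<open>
  By Bessel's inequality the Fourier expansion of \<open>f\<close> converges in norm; the difference of \<open>f\<close> and its
  limit is orthogonal to the whole family.
\<close>

theorem L2_orthonormal_basisI: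
  fixes u :: "'i \<Rightarrow> 'a \<Rightarrow> complex"
  assumes fin: "finite_measure M" and I: "countable I"
    and u: "\<And>i. i \<in> I \<Longrightarrow> u i \<in> L2 M"
    and orth: "\<And>i j. i \<in> I \<Longrightarrow> j \<in> I \<Longrightarrow> L2_inner M (u i) (u j) = (if i = j then 1 else 0)"
    and triv: "\<And>f. f \<in> L2 M \<Longrightarrow> (\<And>i. i \<in> I \<Longrightarrow> L2_inner M f (u i) = 0) \<Longrightarrow> AE x in M. f x = 0"
  shows "L2_orthonormal_basis M I u"
proof -
  have dense: "\<exists>F c. finite F \<and> F \<subseteq> I \<and> L2_dist M f (lincomb F c u) < e"
    if f: "f \<in> L2 M" and e: "e > 0" for f and e :: real
  proof -
    define F where "F n = {i \<in> I. to_nat_on I i < n}" for n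
    have Fsub: "F n \<subseteq> I" for n by (auto simp: F_def)
    have Ffin: "finite (F n)" for n
    proof (rule finite_imageD)
      show "finite (to_nat_on I ` F n)" by (rule finite_subset[of _ "{..<n}"]) (auto simp: F_def)
      show "inj_on (to_nat_on I) (F n)" by (rule inj_on_subset[OF inj_on_to_nat_on[OF I] Fsub])
    qed
    have Fmono: "F m \<subseteq> F n" if "m \<le> n" for m n using that by (auto simp: F_def)
    define a where "a i = L2_inner M f (u i)" for i
    define s where "s n = (lincomb (F n) a u)" for n
    define b where "b n = (\<Sum>i\<in>F n. (cmod (a i))\<^sup>2)" for n
    have s: "s n \<in> L2 M" for n unfolding s_def by (rule L2_sum) (use u Fsub in auto)
    have bmono: "b m \<le> b n" if "m \<le> n" for m n
      unfolding b_def by (rule sum_mono2[OF Ffin Fmono[OF that]]) simp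
    have bbd: "b n \<le> (L2_norm M f)\<^sup>2" for n
      unfolding b_def a_def by (rule L2_Bessel[OF Ffin _ _ f]) (use u orth Fsub in blast)+
    have b_nonneg: "\<bar>b n\<bar> = b n" for n by (simp add: b_def sum_nonneg)
    have "convergent b"
      by (rule Bseq_monoseq_convergent) (auto intro!: BseqI'[of _ "(L2_norm M f)\<^sup>2"] simp: monoseq_def bmono bbd b_nonneg)
    then have cb: "Cauchy b" by (rule convergent_Cauchy)
    have diff: "(L2_dist M (s n) (s m))\<^sup>2 = b n - b m" if "m \<le> n" for m n
    proof -
      have "(\<lambda>x. s n x - s m x) = (lincomb (F n - F m) a u)"
        by (rule ext) (simp add: s_def sum_diff[OF Ffin Fmono[OF that]])
      moreover have "(L2_norm M (lincomb (F n - F m) a u))\<^sup>2 = (\<Sum>i\<in>F n - F m. (cmod (a i))\<^sup>2)"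
        by (rule L2_norm_sum_orthonormal) (use Ffin u orth Fsub in blast)+
      ultimately show ?thesis by (simp add: b_def sum_diff[OF Ffin Fmono[OF that]])
    qed
    have cau: "\<exists>N. \<forall>m\<ge>N. \<forall>n\<ge>N. L2_dist M (s m) (s n) < d" if d: "d > 0" for d
    proof -
      have "d\<^sup>2 > 0" using d by simp
      then obtain N where N: "\<And>m n. m \<ge> N \<Longrightarrow> n \<ge> N \<Longrightarrow> dist (b m) (b n) < d\<^sup>2"
        using cb unfolding Cauchy_def by blast
      have "L2_dist M (s n) (s m) < d" if "m \<ge> N" "n \<ge> N" "m \<le> n" for m n
      proof (rule power2_less_imp_less)
        show "(L2_dist M (s n) (s m))\<^sup>2 < d\<^sup>2"
          using N[OF that(2,1)] unfolding diff[OF that(3)] dist_real_def by simp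
      qed (use d in simp)
      then have "L2_dist M (s m) (s n) < d" if "m \<ge> N" "n \<ge> N" for m n
        using that linear[of m n] L2_norm_minus_commute[of M "s m" "s n"] by metis
      then show ?thesis by blast
    qed
    obtain h where h: "h \<in> L2 M" and lim: "(\<lambda>n. L2_dist M (s n) h) \<longlonglongrightarrow> 0"
      using L2_complete[where s = s, OF fin s cau] by blast
    have "L2_inner M (\<lambda>x. f x - h x) (u i) = 0" if i: "i \<in> I" for i
    proof -
      have "cmod (L2_inner M (\<lambda>x. f x - h x) (u i)) \<le> L2_dist M (s n) h * L2_norm M (u i)"
        if n: "n > to_nat_on I i" for n
      proof -
        have iF: "i \<in> F n" using i n by (simp add: F_def)
        have "L2_inner M (s n) (u i) = (\<Sum>j\<in>F n. a j * L2_inner M (u j) (u i))"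
          unfolding s_def by (rule L2_inner_sum_left) (use u Fsub i in auto)
        also have "\<dots> = (\<Sum>j\<in>F n. if j = i then a j else 0)"
          by (rule sum.cong[OF refl]) (simp add: orth[OF subsetD[OF Fsub] i])
        also have "\<dots> = a i" using iF Ffin by (simp add: sum.delta)
        finally have "L2_inner M (\<lambda>x. f x - s n x) (u i) = 0"
          using L2_inner_diff_left[OF f s u[OF i]] by (simp add: a_def)
        moreover have "L2_inner M (\<lambda>x. f x - h x) (u i) =
            L2_inner M (\<lambda>x. f x - s n x) (u i) + L2_inner M (\<lambda>x. s n x - h x) (u i)"
          by (simp add: L2_inner_diff_left f s h u i)
        ultimately show ?thesis using L2_inner_le[OF L2_diff[OF s h] u[OF i]] by simp
      qed
      then have "\<forall>\<^sub>F n in sequentially. cmod (L2_inner M (\<lambda>x. f x - h x) (u i)) \<le> L2_dist M (s n) h * L2_norm M (u i)"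
        using eventually_gt_at_top[of "to_nat_on I i"] by (rule eventually_mono[rotated])
      then have "cmod (L2_inner M (\<lambda>x. f x - h x) (u i)) \<le> 0 * L2_norm M (u i)"
        by (intro tendsto_le[OF _ tendsto_mult[OF lim tendsto_const] tendsto_const]) auto
      then show ?thesis by simp
    qed
    then have "AE x in M. f x - h x = 0" by (intro triv L2_diff f h)
    then have "L2_dist M f h = 0" using L2_norm_eq_0_iff[OF L2_diff[OF f h]] by simp
    then have le: "L2_dist M f (s n) \<le> L2_dist M (s n) h" for n
      using L2_norm_diff_triangle[OF f h s[of n]] by (simp add: L2_norm_minus_commute[of M h])
    obtain n where "L2_dist M (s n) h < e"
      using order_tendstoD(2)[OF lim e] by (auto simp: eventually_sequentially)
    then have "L2_dist M f (lincomb (F n) a u) < e"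
      using le[of n] by (simp add: s_def)
    then show ?thesis using Ffin Fsub by blast
  qed
  show ?thesis
    unfolding L2_orthonormal_basis_def
  proof (intro conjI ballI allI impI)
    fix f and e :: real assume "f \<in> L2 M" "e > 0"
    then show "\<exists>F c. finite F \<and> F \<subseteq> I \<and> L2_dist M f (lincomb F c u) < e"
      by (rule dense)
  qed (rule u orth; assumption)+
qed

definition L2_dense_span :: "'a measure \<Rightarrow> 'i set \<Rightarrow> ('i \<Rightarrow> 'a \<Rightarrow> complex) \<Rightarrow> bool" where
  "L2_dense_span M I u \<longleftrightarrow> (\<forall>f\<in>L2 M. \<forall>\<epsilon>>0. \<exists>F c. finite F \<and> F \<subseteq> I \<and> L2_dist M f (lincomb F c u) < \<epsilon>)"

lemma sum_pad:
  fixes w :: "'i \<Rightarrow> complex"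
  assumes "finite G" "F \<subseteq> G"
  shows "(\<Sum>i\<in>F. c i * w i) = (\<Sum>i\<in>G. (if i \<in> F then c i else 0) * w i)"
proof -
  have "(\<Sum>i\<in>G. (if i \<in> F then c i else 0) * w i) = (\<Sum>i\<in>F. (if i \<in> F then c i else 0) * w i)"
    by (rule sum.mono_neutral_right) (use assms in auto)
  then show ?thesis by simp
qed

text \<open>
  The map that sends \<open>u i\<close> to \<open>v i\<close> extends to a bounded linear map on the span of \<open>u\<close>.  Since functions
  represent elements of the Hilbert space only up to null sets, the continuous extension to the
  closure is treated as a relation between functions.
\<close>

locale dominated_families =
  fixes M :: "'a measure" and I :: "'i set" and u v :: "'i \<Rightarrow> 'a \<Rightarrow> complex" and K :: real
  assumes fin: "finite_measure M"
    and u: "\<And>i. i \<in> I \<Longrightarrow> u i \<in> L2 M" and v: "\<And>i. i \<in> I \<Longrightarrow> v i \<in> L2 M" and K: "K > 0"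
    and le: "\<And>F c. finite F \<Longrightarrow> F \<subseteq> I \<Longrightarrow> L2_norm M (lincomb F c v) \<le> K * L2_norm M (lincomb F c u)"
begin

definition span_pairs :: "(('a \<Rightarrow> complex) \<times> ('a \<Rightarrow> complex)) set" where
  "span_pairs = {(lincomb F c u, lincomb F c v) | F c. finite F \<and> F \<subseteq> I}"

text \<open>
  The closure of the graph of the linear map with \<open>u i \<mapsto> v i\<close>.
\<close>

definition span_limit :: "('a \<Rightarrow> complex) \<Rightarrow> ('a \<Rightarrow> complex) \<Rightarrow> bool" where
  "span_limit g h \<longleftrightarrow> g \<in> L2 M \<and> h \<in> L2 M \<and>
     (\<forall>\<epsilon>>0. \<exists>s t. (s, t) \<in> span_pairs \<and> L2_dist M g s < \<epsilon> \<and> L2_dist M h t < \<epsilon>)"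

lemma span_pairsI: "finite F \<Longrightarrow> F \<subseteq> I \<Longrightarrow> (lincomb F c u, lincomb F c v) \<in> span_pairs"
  unfolding span_pairs_def by blast

lemma span_pairs_L2:
  assumes "(s, t) \<in> span_pairs"
  shows "s \<in> L2 M" "t \<in> L2 M" "L2_norm M t \<le> K * L2_norm M s"
proof -
  obtain F c where F: "finite F" "F \<subseteq> I" and st: "s = lincomb F c u" "t = lincomb F c v"
    using assms by (auto simp: span_pairs_def)
  show "s \<in> L2 M" unfolding st by (rule L2_sum, rule u) (use F in auto)
  show "t \<in> L2 M" unfolding st by (rule L2_sum, rule v) (use F in auto)
  show "L2_norm M t \<le> K * L2_norm M s" unfolding st by (rule le[OF F])
qed

lemma span_pairs_linear:
  assumes "(s, t) \<in> span_pairs" "(s', t') \<in> span_pairs"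
  shows "(\<lambda>x. a * s x + b * s' x, \<lambda>x. a * t x + b * t' x) \<in> span_pairs"
proof -
  obtain F c where F: "finite F" "F \<subseteq> I" and st: "s = lincomb F c u" "t = lincomb F c v"
    using assms by (auto simp: span_pairs_def)
  obtain F' c' where F': "finite F'" "F' \<subseteq> I" and st': "s' = lincomb F' c' u" "t' = lincomb F' c' v"
    using assms by (auto simp: span_pairs_def)
  define G where "G = F \<union> F'"
  define d where "d i = a * (if i \<in> F then c i else 0) + b * (if i \<in> F' then c' i else 0)" for i
  have G: "finite G" "F \<subseteq> G" "F' \<subseteq> G" "G \<subseteq> I" using F F' by (auto simp: G_def)
  have comb: "a * (\<Sum>i\<in>F. c i * w i) + b * (\<Sum>i\<in>F'. c' i * w i) = (\<Sum>i\<in>G. d i * w i)" for w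
    unfolding sum_pad[OF G(1,2), of c w] sum_pad[OF G(1,3), of c' w] d_def
    by (simp only: sum_distrib_left distrib_right sum.distrib mult.assoc)
  show ?thesis unfolding st st' comb by (rule span_pairsI[OF G(1,4)])
qed

lemma span_limit_gen:
  assumes "i \<in> I"
  shows "span_limit (u i) (v i)"
proof -
  have "(u i, v i) \<in> span_pairs" using span_pairsI[of "{i}" "\<lambda>_. 1"] assms by simp
  moreover have "L2_dist M f f = 0" for f by (simp add: L2_norm_def)
  ultimately show ?thesis unfolding span_limit_def using u[OF assms] v[OF assms] by metis
qed

lemma span_limit_linear:
  assumes r1: "span_limit g h" and r2: "span_limit g' h'"
  shows "span_limit (\<lambda>x. a * g x + b * g' x) (\<lambda>x. a * h x + b * h' x)"
proof -
  have L: "g \<in> L2 M" "h \<in> L2 M" "g' \<in> L2 M" "h' \<in> L2 M" using r1 r2 by (auto simp: span_limit_def)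
  have tri: "L2_dist M (\<lambda>x. a * k x + b * k' x) (\<lambda>x. a * w x + b * w' x) \<le> cmod a * L2_dist M k w + cmod b * L2_dist M k' w'"
    if "k \<in> L2 M" "k' \<in> L2 M" "w \<in> L2 M" "w' \<in> L2 M" for k k' w w'
  proof -
    have "(\<lambda>x. (a * k x + b * k' x) - (a * w x + b * w' x)) = (\<lambda>x. a * (k x - w x) + b * (k' x - w' x))"
      by (rule ext) (simp add: algebra_simps)
    then show ?thesis
      using L2_norm_triangle[OF L2_scale[OF L2_diff[OF that(1,3)], of a] L2_scale[OF L2_diff[OF that(2,4)], of b]]
      by (simp add: L2_norm_scale)
  qed
  show ?thesis
    unfolding span_limit_def
  proof (intro conjI allI impI)
    show "(\<lambda>x. a * g x + b * g' x) \<in> L2 M" "(\<lambda>x. a * h x + b * h' x) \<in> L2 M"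
      using L by (auto intro!: L2_add L2_scale)
    fix e :: real assume e: "e > 0"
    \<comment> \<open>The summand \<open>1\<close> avoids a zero denominator and makes the final estimate strict.\<close>
    define d where "d = e / (cmod a + cmod b + 1)"
    have n: "cmod a + cmod b + 1 > 0" by (simp add: add_nonneg_pos)
    have d: "d > 0" using e n by (simp add: d_def)
    obtain s t where st: "(s, t) \<in> span_pairs" "L2_dist M g s < d" "L2_dist M h t < d"
      using r1 d unfolding span_limit_def by blast
    obtain s' t' where st': "(s', t') \<in> span_pairs" "L2_dist M g' s' < d" "L2_dist M h' t' < d"
      using r2 d unfolding span_limit_def by blast
    have small: "cmod a * x + cmod b * y < e" if "x < d" "y < d" for x y
    proof -
      have "cmod a * x + cmod b * y \<le> cmod a * d + cmod b * d"
        using that by (intro add_mono mult_left_mono) auto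
      also have "\<dots> < (cmod a + cmod b + 1) * d" using d by (simp add: distrib_right)
      also have "\<dots> = e" using n by (simp add: d_def)
      finally show ?thesis .
    qed
    note L' = span_pairs_L2(1,2)[OF st(1)] span_pairs_L2(1,2)[OF st'(1)]
    show "\<exists>s t. (s, t) \<in> span_pairs \<and> L2_dist M (\<lambda>x. a * g x + b * g' x) s < e \<and> L2_dist M (\<lambda>x. a * h x + b * h' x) t < e"
      using span_pairs_linear[OF st(1) st'(1), of a b]
        le_less_trans[OF tri[OF L(1,3) L'(1,3)] small[OF st(2) st'(2)]]
        le_less_trans[OF tri[OF L(2,4) L'(2,4)] small[OF st(3) st'(3)]] by blast
  qed
qed

lemma span_limit_norm_le:
  assumes r: "span_limit g h"
  shows "L2_norm M h \<le> K * L2_norm M g"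
proof (rule field_le_epsilon)
  fix e :: real assume e: "e > 0"
  have L: "g \<in> L2 M" "h \<in> L2 M" using r by (auto simp: span_limit_def)
  define d where "d = e / (K + 1)"
  have d: "d > 0" using e K by (simp add: d_def)
  obtain s t where st: "(s, t) \<in> span_pairs" "L2_dist M g s < d" "L2_dist M h t < d"
    using r d unfolding span_limit_def by blast
  note st' = span_pairs_L2[OF st(1)]
  have "L2_norm M h \<le> d + L2_norm M t" using L2_norm_le_diff[OF L(2) st'(2)] st(3) by simp
  also have "\<dots> \<le> d + K * L2_norm M s" using st'(3) by simp
  also have "\<dots> \<le> d + K * (d + L2_norm M g)"
    using L2_norm_le_diff[OF st'(1) L(1)] st(2) K by (simp add: L2_norm_minus_commute[of M g])
  also have "\<dots> = K * L2_norm M g + d * (K + 1)" by (simp add: algebra_simps)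
  also have "d * (K + 1) = e" using K by (simp add: d_def)
  finally show "L2_norm M h \<le> K * L2_norm M g + e" .
qed

lemma span_limit_unique:
  assumes r: "span_limit g h" "span_limit g' h'" and ae: "AE x in M. g x = g' x"
  shows "AE x in M. h x = h' x"
proof -
  have L: "g \<in> L2 M" "h \<in> L2 M" "g' \<in> L2 M" "h' \<in> L2 M" using r by (auto simp: span_limit_def)
  have "L2_norm M (\<lambda>x. 1 * h x + (- 1) * h' x) \<le> K * L2_norm M (\<lambda>x. 1 * g x + (- 1) * g' x)"
    by (rule span_limit_norm_le[OF span_limit_linear[OF r]])
  moreover have "L2_dist M g g' = 0" using L2_norm_eq_0_iff[OF L2_diff[OF L(1,3)]] ae by auto
  ultimately have "L2_dist M h h' = 0" using L2_norm_nonneg[of M "\<lambda>x. h x - h' x"] by simp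
  then show ?thesis using L2_norm_eq_0_iff[OF L2_diff[OF L(2,4)]] by auto
qed

text \<open>
  Approximating combinations of the \<open>u i\<close> form a Cauchy sequence; by domination so do the
  corresponding combinations of the \<open>v i\<close>.
\<close>

lemma span_limit_total:
  assumes dense: "L2_dense_span M I u" and g: "g \<in> L2 M"
  shows "\<exists>h. span_limit g h"
proof -
  have "\<exists>s t. (s, t) \<in> span_pairs \<and> L2_dist M g s < 1 / real (Suc n)" for n
  proof -
    obtain F c where "finite F" "F \<subseteq> I" "L2_dist M g (lincomb F c u) < 1 / real (Suc n)"
      using dense g unfolding L2_dense_span_def by (metis of_nat_0_less_iff zero_less_Suc zero_less_divide_1_iff)
    then show ?thesis using span_pairsI by blast
  qed
  then obtain s t where st: "\<And>n. (s n, t n) \<in> span_pairs" and gs: "\<And>n. L2_dist M g (s n) < 1 / real (Suc n)"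
    by metis
  have s: "s n \<in> L2 M" and t: "t n \<in> L2 M" for n using span_pairs_L2[OF st] by auto
  have tle: "L2_dist M (t m) (t n) \<le> K * L2_dist M (s m) (s n)" for m n
    using span_pairs_L2(3)[OF span_pairs_linear[OF st[of m] st[of n], of 1 "- 1"]] by simp
  have lim0: "(\<lambda>n. L2_dist M g (s n)) \<longlonglongrightarrow> 0"
    by (rule tendsto_sandwich[OF _ _ tendsto_const LIMSEQ_inverse_real_of_nat])
      (use gs in \<open>auto intro!: always_eventually less_imp_le simp: inverse_eq_divide\<close>)
  have cau: "\<exists>N. \<forall>m\<ge>N. \<forall>n\<ge>N. L2_dist M (t m) (t n) < d" if d: "d > 0" for d
  proof -
    have "d / (2 * K) > 0" using d K by simp
    then obtain N where N: "\<And>n. n \<ge> N \<Longrightarrow> L2_dist M g (s n) < d / (2 * K)"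
      using order_tendstoD(2)[OF lim0] unfolding eventually_sequentially by blast
    have "L2_dist M (t m) (t n) < d" if "m \<ge> N" "n \<ge> N" for m n
    proof -
      have "L2_dist M (s m) (s n) \<le> L2_dist M g (s m) + L2_dist M g (s n)"
        using L2_norm_diff_triangle[OF s[of m] g s[of n]] by (simp add: L2_norm_minus_commute[of M "s m"])
      also have "\<dots> < d / (2 * K) + d / (2 * K)" using N that by (intro add_strict_mono) auto
      also have "\<dots> = d / K" by simp
      finally have "K * L2_dist M (s m) (s n) < K * (d / K)" using K by (intro mult_strict_left_mono)
      then show ?thesis using tle[of m n] K by simp
    qed
    then show ?thesis by blast
  qed
  obtain h where h: "h \<in> L2 M" and lim: "(\<lambda>n. L2_dist M (t n) h) \<longlonglongrightarrow> 0"
    using L2_complete[where s = t, OF fin t cau] by blast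
  have "span_limit g h"
    unfolding span_limit_def
  proof (intro conjI allI impI g h)
    fix e :: real assume e: "e > 0"
    have "\<forall>\<^sub>F n in sequentially. L2_dist M g (s n) < e \<and> L2_dist M (t n) h < e"
      using order_tendstoD(2)[OF lim0 e] order_tendstoD(2)[OF lim e] by (rule eventually_conj)
    then obtain n where "L2_dist M g (s n) < e" "L2_dist M (t n) h < e"
      unfolding eventually_sequentially by blast
    then show "\<exists>s t. (s, t) \<in> span_pairs \<and> L2_dist M g s < e \<and> L2_dist M h t < e"
      using st[of n] by (intro exI[of _ "s n"] exI[of _ "t n"]) (simp add: L2_norm_minus_commute[of M h])
  qed
  then show ?thesis by blast
qed

lemma bounded_operator_of_span_limit:
  assumes U: "\<And>g. g \<in> L2 M \<Longrightarrow> span_limit g (U g)"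
  shows "L2_bounded_operator M U"
  unfolding L2_bounded_operator_def
proof (intro conjI ballI allI impI)
  fix f assume f: "f \<in> L2 M"
  show "U f \<in> L2 M" using U[OF f] by (simp add: span_limit_def)
  fix g assume g: "g \<in> L2 M"
  show "AE x in M. U f x = U g x" if "AE x in M. f x = g x"
    by (rule span_limit_unique[OF U[OF f] U[OF g] that])
  show "AE x in M. U (\<lambda>y. a * f y + b * g y) x = a * U f x + b * U g x" for a b
  proof -
    have s: "(\<lambda>y. a * f y + b * g y) \<in> L2 M" by (intro L2_add L2_scale f g)
    show ?thesis using span_limit_unique[OF U[OF s] span_limit_linear[OF U[OF f] U[OF g]]] by simp
  qed
next
  show "\<exists>C. \<forall>f\<in>L2 M. L2_norm M (U f) \<le> C * L2_norm M f" using span_limit_norm_le U by blast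
qed

end

text \<open>
  The closures of the two graphs are converse to each other, so functions chosen from them are
  mutually inverse operators.
\<close>

theorem L2_riesz_basisI:
  assumes fin: "finite_measure M" and I: "countable I"
    and e: "L2_orthonormal_basis M I e" and f: "\<And>i. i \<in> I \<Longrightarrow> f i \<in> L2 M" and K: "K > 0"
    and le1: "\<And>F c. finite F \<Longrightarrow> F \<subseteq> I \<Longrightarrow> L2_norm M (lincomb F c f) \<le> K * L2_norm M (lincomb F c e)"
    and le2: "\<And>F c. finite F \<Longrightarrow> F \<subseteq> I \<Longrightarrow> L2_norm M (lincomb F c e) \<le> K * L2_norm M (lincomb F c f)"
    and dense: "L2_dense_span M I f"
  shows "L2_riesz_basis M I f"
proof -
  have eL: "e i \<in> L2 M" if "i \<in> I" for i using e that unfolding L2_orthonormal_basis_def by blast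
  have de: "L2_dense_span M I e" using e by (simp add: L2_orthonormal_basis_def L2_dense_span_def)
  interpret E: dominated_families M I e f K by (rule dominated_families.intro[OF fin eL f K le1])
  interpret F: dominated_families M I f e K by (rule dominated_families.intro[OF fin f eL K le2])
  have sym: "E.span_limit g h \<longleftrightarrow> F.span_limit h g" for g h
  proof -
    have "(s, t) \<in> E.span_pairs \<longleftrightarrow> (t, s) \<in> F.span_pairs" for s t by (auto simp: E.span_pairs_def F.span_pairs_def)
    then show ?thesis unfolding E.span_limit_def F.span_limit_def by blast
  qed
  define U where "U g = (SOME h. E.span_limit g h)" for g
  define V where "V g = (SOME h. F.span_limit g h)" for g
  have U: "E.span_limit g (U g)" and V: "F.span_limit g (V g)" if "g \<in> L2 M" for g
    unfolding U_def V_def using someI_ex[OF E.span_limit_total[OF de that]] someI_ex[OF F.span_limit_total[OF dense that]] by simp_all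
  have UL: "U g \<in> L2 M" and VL: "V g \<in> L2 M" if "g \<in> L2 M" for g
    using U[OF that] V[OF that] by (auto simp: E.span_limit_def F.span_limit_def)
  have "AE x in M. V (U g) x = g x" "AE x in M. U (V g) x = g x" if g: "g \<in> L2 M" for g
    by (rule F.span_limit_unique[OF V[OF UL[OF g]] U[OF g, unfolded sym]], simp)
      (rule E.span_limit_unique[OF U[OF VL[OF g]] V[OF g, folded sym]], simp)
  moreover have "L2_bounded_operator M U" by (rule E.bounded_operator_of_span_limit[OF U])
  moreover have "L2_bounded_operator M V" by (rule F.bounded_operator_of_span_limit[OF V])
  ultimately have inv: "L2_bounded_invertible M U"
    unfolding L2_bounded_invertible_def by blast
  have "AE x in M. f i x = U (e i) x" if i: "i \<in> I" for i
    by (rule E.span_limit_unique[OF E.span_limit_gen[OF i] U[OF eL[OF i]]]) simp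
  then show ?thesis unfolding L2_riesz_basis_def using I inv e by blast
qed


section \<open>Riesz bases obtained by a matrix\<close>

text \<open>
  The square of the Frobenius norm of a \<open>J \<times> J\<close> matrix.
\<close>

definition frob_sq :: "nat \<Rightarrow> (nat \<Rightarrow> nat \<Rightarrow> complex) \<Rightarrow> real" where
  "frob_sq J V = (\<Sum>i<J. \<Sum>j<J. (cmod (V i j))\<^sup>2)"

lemma frob_sq_nonneg: "frob_sq J V \<ge> 0"
  by (simp add: frob_sq_def sum_nonneg)

lemma frob_sq_bound:
  "(\<Sum>i<J. (cmod (\<Sum>j<J. V i j * x j))\<^sup>2) \<le> frob_sq J V * (\<Sum>j<J. (cmod (x j))\<^sup>2)"
proof -
  have "(cmod (\<Sum>j<J. V i j * x j))\<^sup>2 \<le> (\<Sum>j<J. (cmod (V i j))\<^sup>2) * (\<Sum>j<J. (cmod (x j))\<^sup>2)" for i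
  proof -
    have "cmod (\<Sum>j<J. V i j * x j) \<le> (\<Sum>j<J. cmod (V i j) * cmod (x j))"
      using norm_sum[of "\<lambda>j. V i j * x j" "{..<J}"] by (simp add: norm_mult)
    then have "(cmod (\<Sum>j<J. V i j * x j))\<^sup>2 \<le> (\<Sum>j<J. cmod (V i j) * cmod (x j))\<^sup>2"
      by (intro power_mono) auto
    also have "\<dots> \<le> (\<Sum>j<J. (cmod (V i j))\<^sup>2) * (\<Sum>j<J. (cmod (x j))\<^sup>2)"
      by (rule Cauchy_Schwarz_ineq_sum)
    finally show ?thesis .
  qed
  then show ?thesis unfolding frob_sq_def sum_distrib_right by (rule sum_mono)
qed

lemma matrix_inverse_apply:
  fixes V W :: "nat \<Rightarrow> nat \<Rightarrow> complex"
  assumes WV: "\<And>i j. i < J \<Longrightarrow> j < J \<Longrightarrow> (\<Sum>l<J. W i l * V l j) = (if i = j then 1 else 0)" and i: "i < J"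
  shows "(\<Sum>l<J. W i l * (\<Sum>j<J. V l j * x j)) = x i"
proof -
  have "(\<Sum>l<J. W i l * (\<Sum>j<J. V l j * x j)) = (\<Sum>l<J. \<Sum>j<J. W i l * V l j * x j)"
    by (simp only: sum_distrib_left mult.assoc)
  also have "\<dots> = (\<Sum>j<J. \<Sum>l<J. W i l * V l j * x j)" by (rule sum.swap)
  also have "\<dots> = (\<Sum>j<J. (\<Sum>l<J. W i l * V l j) * x j)" by (simp only: sum_distrib_right)
  also have "\<dots> = (\<Sum>j<J. if j = i then x j else 0)"
    by (rule sum.cong[OF refl]) (simp add: WV i)
  also have "\<dots> = x i" using i by (simp add: sum.delta)
  finally show ?thesis .
qed

text \<open>
  The coefficients of a combination of the \<open>f (a, j)\<close> with respect to the orthonormal basis arise by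
  applying the matrix \<open>V\<close> to each block.  As \<open>V\<close> and its inverse \<open>W\<close> are the same for all blocks, the
  norms of the two coefficient families are comparable with a uniform constant.
\<close>

theorem L2_riesz_basis_block:
  fixes e f :: "'i \<times> nat \<Rightarrow> 'a \<Rightarrow> complex" and V W :: "nat \<Rightarrow> nat \<Rightarrow> complex"
  assumes fin: "finite_measure M" and A: "countable A"
    and e: "L2_orthonormal_basis M (A \<times> {..<J}) e"
    and VW: "\<And>i j. i < J \<Longrightarrow> j < J \<Longrightarrow> (\<Sum>l<J. V i l * W l j) = (if i = j then 1 else 0)"
    and WV: "\<And>i j. i < J \<Longrightarrow> j < J \<Longrightarrow> (\<Sum>l<J. W i l * V l j) = (if i = j then 1 else 0)"
    and f: "\<And>a j. a \<in> A \<Longrightarrow> j < J \<Longrightarrow> f (a, j) \<in> L2 M"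
    and fe: "\<And>a j. a \<in> A \<Longrightarrow> j < J \<Longrightarrow> AE x in M. f (a, j) x = (\<Sum>i<J. V i j * e (a, i) x)"
  shows "L2_riesz_basis M (A \<times> {..<J}) f"
proof -
  have eL: "e q \<in> L2 M" if "q \<in> A \<times> {..<J}" for q
    using e that unfolding L2_orthonormal_basis_def by blast
  have fL: "f q \<in> L2 M" if "q \<in> A \<times> {..<J}" for q using f that by auto
  have norm_e: "(L2_norm M (lincomb (A0 \<times> {..<J}) c e))\<^sup>2 = (\<Sum>a\<in>A0. \<Sum>i<J. (cmod (c (a, i)))\<^sup>2)"
    if A0: "finite A0" "A0 \<subseteq> A" for A0 c
  proof -
    have "(L2_norm M (lincomb (A0 \<times> {..<J}) c e))\<^sup>2 = (\<Sum>q\<in>A0 \<times> {..<J}. (cmod (c q))\<^sup>2)"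
    proof (rule L2_norm_sum_orthonormal)
      fix q r assume "q \<in> A0 \<times> {..<J}" "r \<in> A0 \<times> {..<J}"
      then have "q \<in> A \<times> {..<J}" "r \<in> A \<times> {..<J}" using A0 by auto
      then show "L2_inner M (e q) (e r) = (if q = r then 1 else 0)" using e unfolding L2_orthonormal_basis_def by blast
    qed (use A0 eL in auto)
    also have "\<dots> = (\<Sum>a\<in>A0. \<Sum>i<J. (cmod (c (a, i)))\<^sup>2)"
      by (subst sum.cartesian_product) (simp add: case_prod_unfold)
    finally show ?thesis .
  qed
  define y where "y c = (\<lambda>(a, i). \<Sum>j<J. V i j * c (a, j))" for c :: "'i \<times> nat \<Rightarrow> complex"
  have comb: "AE x in M. (\<Sum>q\<in>A0 \<times> {..<J}. c q * f q x) = (\<Sum>q\<in>A0 \<times> {..<J}. y c q * e q x)"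
    if A0: "finite A0" "A0 \<subseteq> A" for A0 c
  proof -
    have "AE x in M. \<forall>a\<in>A0. \<forall>j\<in>{..<J}. f (a, j) x = (\<Sum>i<J. V i j * e (a, i) x)"
      using A0 fe by (intro AE_finite_allI) auto
    then show ?thesis
    proof eventually_elim
      case (elim x)
      have "(\<Sum>q\<in>A0 \<times> {..<J}. c q * f q x) = (\<Sum>a\<in>A0. \<Sum>j<J. c (a, j) * f (a, j) x)"
        by (subst sum.cartesian_product) (simp add: case_prod_unfold)
      also have "\<dots> = (\<Sum>a\<in>A0. \<Sum>i<J. y c (a, i) * e (a, i) x)"
      proof (rule sum.cong[OF refl])
        fix a assume a: "a \<in> A0"
        have "(\<Sum>j<J. c (a, j) * f (a, j) x) = (\<Sum>j<J. \<Sum>i<J. V i j * c (a, j) * e (a, i) x)"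
          by (rule sum.cong[OF refl]) (use elim a in \<open>simp add: sum_distrib_left mult_ac\<close>)
        also have "\<dots> = (\<Sum>i<J. \<Sum>j<J. V i j * c (a, j) * e (a, i) x)" by (rule sum.swap)
        also have "\<dots> = (\<Sum>i<J. y c (a, i) * e (a, i) x)" by (simp add: y_def sum_distrib_right)
        finally show "(\<Sum>j<J. c (a, j) * f (a, j) x) = (\<Sum>i<J. y c (a, i) * e (a, i) x)" .
      qed
      also have "\<dots> = (\<Sum>q\<in>A0 \<times> {..<J}. y c q * e q x)"
        by (subst sum.cartesian_product) (simp add: case_prod_unfold)
      finally show ?case .
    qed
  qed
  have norm_f: "L2_norm M (lincomb (A0 \<times> {..<J}) c f) = L2_norm M (lincomb (A0 \<times> {..<J}) (y c) e)"
    if A0: "finite A0" "A0 \<subseteq> A" for A0 c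
  proof (rule L2_norm_cong_AE[OF _ _ comb[OF A0]])
    show "(lincomb (A0 \<times> {..<J}) c f) \<in> L2 M" by (rule L2_sum) (use fL A0 in auto)
    show "(lincomb (A0 \<times> {..<J}) (y c) e) \<in> L2 M" by (rule L2_sum) (use eL A0 in auto)
  qed
  \<comment> \<open>The summand \<open>1\<close> makes the constant positive also for \<open>J = 0\<close>.\<close>
  define K where "K = sqrt (frob_sq J V) + sqrt (frob_sq J W) + 1"
  have K: "K > 0" "frob_sq J V \<le> K\<^sup>2" "frob_sq J W \<le> K\<^sup>2"
  proof -
    have n: "sqrt (frob_sq J V) \<ge> 0" "sqrt (frob_sq J W) \<ge> 0" by (simp_all add: frob_sq_nonneg)
    then show "K > 0" unfolding K_def by linarith
    have "(sqrt (frob_sq J V))\<^sup>2 \<le> K\<^sup>2" "(sqrt (frob_sq J W))\<^sup>2 \<le> K\<^sup>2"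
      unfolding K_def by (intro power_mono; use n in linarith)+
    then show "frob_sq J V \<le> K\<^sup>2" "frob_sq J W \<le> K\<^sup>2" by (simp_all add: frob_sq_nonneg)
  qed
  have pad: thesis
    if F: "finite F" "F \<subseteq> A \<times> {..<J}"
      and r: "\<And>A0 c'. finite A0 \<Longrightarrow> A0 \<subseteq> A \<Longrightarrow>
        (\<And>w. (\<Sum>q\<in>F. c q * w q) = (\<Sum>q\<in>A0 \<times> {..<J}. c' q * w q)) \<Longrightarrow> thesis"
    for F and c :: "'i \<times> nat \<Rightarrow> complex" and thesis
  proof (rule r)
    show "finite (fst ` F)" "fst ` F \<subseteq> A" using F by auto
    fix w :: "'i \<times> nat \<Rightarrow> complex"
    show "(\<Sum>q\<in>F. c q * w q) = (\<Sum>q\<in>fst ` F \<times> {..<J}. (if q \<in> F then c q else 0) * w q)"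
      by (rule sum_pad) (use F in \<open>force+\<close>)
  qed
  have le1: "L2_norm M (lincomb (A0 \<times> {..<J}) c f) \<le> K * L2_norm M (lincomb (A0 \<times> {..<J}) c e)"
    if A0: "finite A0" "A0 \<subseteq> A" for A0 c
  proof (rule power2_le_imp_le)
    have "(L2_norm M (lincomb (A0 \<times> {..<J}) c f))\<^sup>2 = (\<Sum>a\<in>A0. \<Sum>i<J. (cmod (\<Sum>j<J. V i j * c (a, j)))\<^sup>2)"
      unfolding norm_f[OF A0] norm_e[OF A0] by (simp add: y_def)
    also have "\<dots> \<le> (\<Sum>a\<in>A0. K\<^sup>2 * (\<Sum>j<J. (cmod (c (a, j)))\<^sup>2))"
      by (intro sum_mono order_trans[OF frob_sq_bound] mult_right_mono K sum_nonneg) simp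
    also have "\<dots> = (K * L2_norm M (lincomb (A0 \<times> {..<J}) c e))\<^sup>2"
      by (simp add: power_mult_distrib norm_e[OF A0] sum_distrib_left)
    finally show "(L2_norm M (lincomb (A0 \<times> {..<J}) c f))\<^sup>2 \<le> (K * L2_norm M (lincomb (A0 \<times> {..<J}) c e))\<^sup>2" .
  qed (use K in simp)
  have le2: "L2_norm M (lincomb (A0 \<times> {..<J}) c e) \<le> K * L2_norm M (lincomb (A0 \<times> {..<J}) c f)"
    if A0: "finite A0" "A0 \<subseteq> A" for A0 c
  proof (rule power2_le_imp_le)
    have "(L2_norm M (lincomb (A0 \<times> {..<J}) c e))\<^sup>2 = (\<Sum>a\<in>A0. \<Sum>i<J. (cmod (c (a, i)))\<^sup>2)"
      by (rule norm_e[OF A0])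
    also have "\<dots> = (\<Sum>a\<in>A0. \<Sum>i<J. (cmod (\<Sum>l<J. W i l * y c (a, l)))\<^sup>2)"
      by (intro sum.cong refl) (simp add: y_def matrix_inverse_apply[OF WV])
    also have "\<dots> \<le> (\<Sum>a\<in>A0. K\<^sup>2 * (\<Sum>l<J. (cmod (y c (a, l)))\<^sup>2))"
      by (intro sum_mono order_trans[OF frob_sq_bound] mult_right_mono K sum_nonneg) simp
    also have "\<dots> = (K * L2_norm M (lincomb (A0 \<times> {..<J}) c f))\<^sup>2"
      by (simp add: power_mult_distrib norm_f[OF A0] norm_e[OF A0] sum_distrib_left)
    finally show "(L2_norm M (lincomb (A0 \<times> {..<J}) c e))\<^sup>2 \<le> (K * L2_norm M (lincomb (A0 \<times> {..<J}) c f))\<^sup>2" .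
  qed (use K in simp)
  show ?thesis
  proof (rule L2_riesz_basisI[OF fin _ e fL K(1)])
    show "countable (A \<times> {..<J})" by (intro countable_SIGMA A) auto
    fix F and c :: "'i \<times> nat \<Rightarrow> complex" assume F: "finite F" "F \<subseteq> A \<times> {..<J}"
    obtain A0 c' where A0: "finite A0" "A0 \<subseteq> A"
      and eq: "\<And>w. (\<Sum>q\<in>F. c q * w q) = (\<Sum>q\<in>A0 \<times> {..<J}. c' q * w q)"
      by (rule pad[OF F, of c]) (rule that)
    show "L2_norm M (lincomb F c f) \<le> K * L2_norm M (lincomb F c e)"
      unfolding eq by (rule le1[OF A0])
    show "L2_norm M (lincomb F c e) \<le> K * L2_norm M (lincomb F c f)"
      unfolding eq by (rule le2[OF A0])
  next
    show "L2_dense_span M (A \<times> {..<J}) f"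
      unfolding L2_dense_span_def
    proof (intro ballI allI impI)
      fix g and d :: real assume g: "g \<in> L2 M" and d: "d > 0"
      obtain F c where F: "finite F" "F \<subseteq> A \<times> {..<J}" and Fd: "L2_dist M g (lincomb F c e) < d"
        using e g d unfolding L2_orthonormal_basis_def by blast
      obtain A0 c' where A0: "finite A0" "A0 \<subseteq> A"
        and eq: "\<And>w. (\<Sum>q\<in>F. c q * w q) = (\<Sum>q\<in>A0 \<times> {..<J}. c' q * w q)"
        by (rule pad[OF F, of c]) (rule that)
      define b where "b = (\<lambda>(a, j). \<Sum>i<J. W j i * c' (a, i))"
      have yb: "y b q = c' q" if "q \<in> A0 \<times> {..<J}" for q
        using that by (auto simp: y_def b_def matrix_inverse_apply[OF VW])
      have "L2_dist M g (lincomb (A0 \<times> {..<J}) b f) = L2_dist M g (lincomb F c e)"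
      proof (rule L2_norm_cong_AE)
        show "(\<lambda>x. g x - (\<Sum>q\<in>A0 \<times> {..<J}. b q * f q x)) \<in> L2 M"
          by (intro L2_diff g L2_sum fL) (use A0 in auto)
        show "(\<lambda>x. g x - (\<Sum>q\<in>F. c q * e q x)) \<in> L2 M"
          by (intro L2_diff g L2_sum eL) (use F in auto)
        show "AE x in M. g x - (\<Sum>q\<in>A0 \<times> {..<J}. b q * f q x) = g x - (\<Sum>q\<in>F. c q * e q x)"
          using comb[OF A0, of b] by eventually_elim (simp add: eq yb)
      qed
      then have "L2_dist M g (lincomb (A0 \<times> {..<J}) b f) < d" using Fd by simp
      moreover have "finite (A0 \<times> {..<J})" "A0 \<times> {..<J} \<subseteq> A \<times> {..<J}" using A0 by auto
      ultimately show "\<exists>F c. finite F \<and> F \<subseteq> A \<times> {..<J} \<and> L2_dist M g (lincomb F c f) < d"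
        by blast
    qed
  qed
qed

text \<open>
  The columns of the inverse are the coefficient vectors of the Lagrange polynomials of the nodes.
  The first identity evaluates these polynomials at the nodes; the second one says that a monomial of
  degree less than \<open>J\<close> is its own interpolation polynomial.
\<close>

lemma vandermonde_inverse:
  fixes z :: "nat \<Rightarrow> complex"
  assumes inj: "inj_on z {..<J}"
  shows "\<exists>W. (\<forall>i<J. \<forall>j<J. (\<Sum>l<J. z i ^ l * W l j) = (if i = j then 1 else 0)) \<and>
             (\<forall>i<J. \<forall>j<J. (\<Sum>l<J. W i l * z l ^ j) = (if i = j then 1 else 0))"
proof (cases "J = 0")
  case False
  define L where "L i = (\<Prod>l\<in>{..<J} - {i}. Polynomial.smult (1 / (z i - z l)) [:- z l, 1:])" for i
  have deg: "degree (L i) < J" if "i < J" for i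
  proof -
    have "degree (L i) \<le> (\<Sum>l\<in>{..<J} - {i}. degree (Polynomial.smult (1 / (z i - z l)) [:- z l, 1:]))"
      unfolding L_def by (rule order_trans[OF degree_prod_sum_le]) (simp_all add: o_def)
    also have "\<dots> \<le> (\<Sum>l\<in>{..<J} - {i}. 1)"
      by (rule sum_mono) (rule order_trans[OF degree_smult_le], simp)
    also have "\<dots> < J" using that False by simp
    finally show ?thesis .
  qed
  have val: "poly (L i) (z j) = (if i = j then 1 else 0)" if "i < J" "j < J" for i j
  proof (cases "i = j")
    case True
    have "poly (L i) (z i) = 1"
      unfolding L_def poly_prod
    proof (rule prod.neutral, rule ballI)
      fix l assume "l \<in> {..<J} - {i}"
      then have "z i - z l \<noteq> 0" using inj_onD[OF inj, of i l] \<open>i < J\<close> by auto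
      moreover have "poly [:- z l, 1:] (z i) = z i - z l" by simp
      then have "poly (Polynomial.smult (1 / (z i - z l)) [:- z l, 1:]) (z i) = 1 / (z i - z l) * (z i - z l)"
        by (simp only: poly_smult)
      ultimately show "poly (Polynomial.smult (1 / (z i - z l)) [:- z l, 1:]) (z i) = 1"
        by (simp only: divide_self_if times_divide_eq_left mult_1_left if_False)
    qed
    then show ?thesis using True by simp
  next
    case False
    then show ?thesis using that by (auto simp: L_def poly_prod intro!: prod_zero bexI[of _ j])
  qed
  have ev: "poly q x = (\<Sum>l<J. poly.coeff q l * x ^ l)" if "degree q < J" for q and x :: complex
    unfolding poly_altdef by (rule sum.mono_neutral_left) (use that in \<open>auto simp: coeff_eq_0\<close>)
  define W where "W l j = poly.coeff (L j) l" for l j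
  have 1: "(\<Sum>l<J. z i ^ l * W l j) = (if i = j then 1 else 0)" if "i < J" "j < J" for i j
  proof -
    have "(\<Sum>l<J. z i ^ l * W l j) = poly (L j) (z i)"
      unfolding ev[OF deg[OF that(2)]] W_def by (simp only: mult.commute)
    also have "\<dots> = (if j = i then 1 else 0)" by (rule val[OF that(2,1)])
    finally show ?thesis by auto
  qed
  have 2: "(\<Sum>l<J. W i l * z l ^ j) = (if i = j then 1 else 0)" if ij: "i < J" "j < J" for i j
  proof -
    \<comment> \<open>The error of interpolating a monomial has degree less than \<open>J\<close> and vanishes at all nodes.\<close>
    define q where "q = (\<Sum>l<J. Polynomial.smult (z l ^ j) (L l)) - Polynomial.monom 1 j"
    have dq: "degree q < J"
    proof -
      have "degree (\<Sum>l<J. Polynomial.smult (z l ^ j) (L l)) \<le> J - 1"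
      proof (rule degree_sum_le)
        fix l assume "l \<in> {..<J}"
        then have "degree (L l) \<le> J - 1" using deg[of l] by simp
        then show "degree (Polynomial.smult (z l ^ j) (L l)) \<le> J - 1"
          by (rule order_trans[OF degree_smult_le])
      qed simp
      moreover have "degree (Polynomial.monom (1::complex) j) \<le> J - 1"
        using ij by (simp add: degree_monom_eq)
      ultimately have "degree q \<le> J - 1" unfolding q_def by (rule degree_diff_le)
      then show ?thesis using False by simp
    qed
    have "poly q (z m) = 0" if "m < J" for m
    proof -
      have "poly q (z m) = (\<Sum>l<J. z l ^ j * poly (L l) (z m)) - z m ^ j"
        by (simp add: q_def poly_sum poly_monom)
      also have "(\<Sum>l<J. z l ^ j * poly (L l) (z m)) = (\<Sum>l<J. if l = m then z l ^ j else 0)"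
        by (rule sum.cong[OF refl]) (simp add: val that)
      also have "\<dots> = z m ^ j" using that by (simp add: sum.delta)
      finally show ?thesis by simp
    qed
    then have sub: "z ` {..<J} \<subseteq> {x. poly q x = 0}" by auto
    have "q = 0"
    proof (rule ccontr)
      assume "q \<noteq> 0"
      then have "card {x. poly q x = 0} \<le> degree q" "finite {x. poly q x = 0}"
        by (rule card_poly_roots_bound, rule poly_roots_finite)
      then have "card (z ` {..<J}) \<le> degree q" using card_mono[OF _ sub] by linarith
      then show False using dq by (simp add: card_image[OF inj])
    qed
    then have "poly.coeff (\<Sum>l<J. Polynomial.smult (z l ^ j) (L l)) i = poly.coeff (Polynomial.monom 1 j) i"
      unfolding q_def by simp
    then have "(\<Sum>l<J. z l ^ j * poly.coeff (L l) i) = (if j = i then 1 else 0)"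
      by (simp add: coeff_sum)
    then show ?thesis by (simp add: W_def mult.commute eq_commute)
  qed
  show ?thesis using 1 2 by blast
qed simp

text \<open>
  The members of a Riesz basis are distinct functions, because the inverse operator recovers from
  them the members of an orthonormal basis.  So the basis may be indexed by itself.
\<close>

lemma L2_riesz_basis_image:
  assumes r: "L2_riesz_basis M I f"
  shows "L2_riesz_basis M (f ` I) (\<lambda>\<psi>. \<psi>)"
proof -
  obtain U e where I: "countable I" and U: "L2_bounded_invertible M U" and e: "L2_orthonormal_basis M I e"
    and fe: "\<And>i. i \<in> I \<Longrightarrow> AE x in M. f i x = U (e i) x"
    using r unfolding L2_riesz_basis_def by blast
  have eL: "e i \<in> L2 M" if "i \<in> I" for i using e that by (simp add: L2_orthonormal_basis_def)
  have ee: "L2_inner M (e i) (e j) = (if i = j then 1 else 0)" if "i \<in> I" "j \<in> I" for i j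
    using e that unfolding L2_orthonormal_basis_def by blast
  obtain V where UB: "L2_bounded_operator M U" and VB: "L2_bounded_operator M V"
    and VU: "\<And>g. g \<in> L2 M \<Longrightarrow> AE x in M. V (U g) x = g x"
    using U unfolding L2_bounded_invertible_def by blast
  have UL: "U g \<in> L2 M" if "g \<in> L2 M" for g using UB that by (simp add: L2_bounded_operator_def)
  have inj: "inj_on f I"
  proof (rule inj_onI, rule ccontr)
    fix i j assume ij: "i \<in> I" "j \<in> I" "f i = f j" "i \<noteq> j"
    have "AE x in M. U (e i) x = U (e j) x" using fe[OF ij(1)] fe[OF ij(2)] by eventually_elim (use ij in simp)
    moreover have "\<forall>f\<in>L2 M. \<forall>g\<in>L2 M. (AE x in M. f x = g x) \<longrightarrow> (AE x in M. V f x = V g x)"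
      using VB unfolding L2_bounded_operator_def by blast
    ultimately have "AE x in M. V (U (e i)) x = V (U (e j)) x" using UL eL ij by blast
    then have "AE x in M. e i x = e j x"
      using VU[OF eL[OF ij(1)]] VU[OF eL[OF ij(2)]] by eventually_elim simp
    moreover have [measurable]: "e i \<in> borel_measurable M" "e j \<in> borel_measurable M"
      using eL ij by (simp_all add: L2_measurable)
    ultimately have "L2_inner M (e i) (e i) = L2_inner M (e i) (e j)"
      unfolding L2_inner_def by (intro integral_cong_AE) auto
    then show False using ee ij by simp
  qed
  define h where "h = inv_into I f"
  have h: "h \<psi> \<in> I" "f (h \<psi>) = \<psi>" if "\<psi> \<in> f ` I" for \<psi>
    using that by (auto simp: h_def inv_into_into f_inv_into_f)
  have hinj: "h \<psi> = h \<phi> \<longleftrightarrow> \<psi> = \<phi>" if "\<psi> \<in> f ` I" "\<phi> \<in> f ` I" for \<psi> \<phi> using h that by metis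
  have "L2_orthonormal_basis M (f ` I) (e \<circ> h)"
    unfolding L2_orthonormal_basis_def
  proof (intro conjI ballI allI impI)
    fix g and d :: real assume "g \<in> L2 M" "d > 0"
    then obtain F c where F: "finite F" "F \<subseteq> I" "L2_dist M g (lincomb F c e) < d"
      using e unfolding L2_orthonormal_basis_def by blast
    have hf: "h (f i) = i" if "i \<in> I" for i using that inj by (simp add: h_def)
    have injF: "inj_on f F" using inj F(2) by (rule inj_on_subset)
    have "(\<Sum>\<psi>\<in>f ` F. (c \<circ> h) \<psi> * (e \<circ> h) \<psi> x) = (\<Sum>i\<in>F. c i * e i x)" for x
      using F(2) hf by (subst sum.reindex[OF injF]) (auto intro!: sum.cong)
    then have "L2_norm M (\<lambda>x. g x - (\<Sum>\<psi>\<in>f ` F. (c \<circ> h) \<psi> * (e \<circ> h) \<psi> x)) < d" using F(3) by simp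
    then show "\<exists>F c. finite F \<and> F \<subseteq> f ` I \<and> L2_norm M (\<lambda>x. g x - (\<Sum>i\<in>F. c i * (e \<circ> h) i x)) < d"
      using F by (intro exI[of _ "f ` F"] exI[of _ "c \<circ> h"]) auto
  qed (auto simp: h eL ee hinj)
  moreover have "AE x in M. \<psi> x = U ((e \<circ> h) \<psi>) x" if "\<psi> \<in> f ` I" for \<psi>
    using fe[OF h(1)[OF that]] h(2)[OF that] by simp
  ultimately show ?thesis unfolding L2_riesz_basis_def using I U by blast
qed


section \<open>Characters on a finite union of cosets\<close>

definition tower_chars :: "('p::prime_card padic \<Rightarrow> complex) set" where
  "tower_chars = {\<lambda>x. padic_char m x ^ r | m r. True}"

lemma tower_chars_characters: "\<psi> \<in> tower_chars \<Longrightarrow> \<psi> \<in> characters"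
  unfolding tower_chars_def using padic_char_power_characters by auto

lemma countable_tower_chars: "countable tower_chars"
proof -
  have eq: "tower_chars = (\<lambda>(m, r) x. padic_char m x ^ r) ` (UNIV :: (int \<times> nat) set)"
    by (auto simp: tower_chars_def)
  show ?thesis unfolding eq by (rule countable_image[OF countableI_type])
qed

text \<open>
  Apply a choice function to the restrictions to \<open>H\<close>.  With the characters of the tower as \<open>X\<close> and a
  ball as \<open>H\<close>, this picks one extension of each character of the ball.
\<close>

lemma ex_transversal:
  fixes X :: "('a \<Rightarrow> 'b) set"
  obtains A where "A \<subseteq> X" "\<forall>\<psi>\<in>X. \<exists>\<phi>\<in>A. \<forall>h\<in>H. \<phi> h = \<psi> h"
    "\<forall>\<phi>\<in>A. \<forall>\<phi>'\<in>A. (\<forall>h\<in>H. \<phi> h = \<phi>' h) \<longrightarrow> \<phi> = \<phi>'"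
proof -
  define s where "s \<psi> = (SOME \<phi>. \<phi> \<in> X \<and> (\<forall>h\<in>H. \<phi> h = \<psi> h))" for \<psi>
  have s: "s \<psi> \<in> X \<and> (\<forall>h\<in>H. s \<psi> h = \<psi> h)" if "\<psi> \<in> X" for \<psi>
    unfolding s_def by (rule someI[of _ \<psi>]) (use that in simp)
  have eq: "s \<psi> = s \<psi>'" if "\<And>h. h \<in> H \<Longrightarrow> \<psi> h = \<psi>' h" for \<psi> \<psi>'
  proof -
    have "(\<forall>h\<in>H. \<phi> h = \<psi> h) \<longleftrightarrow> (\<forall>h\<in>H. \<phi> h = \<psi>' h)" for \<phi> using that by simp
    then show ?thesis by (simp only: s_def)
  qed
  show thesis
  proof (rule that[of "s ` X"])
    show "s ` X \<subseteq> X" using s by blast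
    show "\<forall>\<psi>\<in>X. \<exists>\<phi>\<in>s ` X. \<forall>h\<in>H. \<phi> h = \<psi> h" using s by blast
    show "\<forall>\<phi>\<in>s ` X. \<forall>\<phi>'\<in>s ` X. (\<forall>h\<in>H. \<phi> h = \<phi>' h) \<longrightarrow> \<phi> = \<phi>'"
    proof (intro ballI impI)
      fix \<phi> \<phi>' assume "\<phi> \<in> s ` X" "\<phi>' \<in> s ` X" and agree: "\<forall>h\<in>H. \<phi> h = \<phi>' h"
      then obtain \<psi> \<psi>' where \<psi>: "\<psi> \<in> X" "\<phi> = s \<psi>" "\<psi>' \<in> X" "\<phi>' = s \<psi>'" by blast
      have "\<psi> h = \<psi>' h" if "h \<in> H" for h
        using s[OF \<psi>(1)] s[OF \<psi>(3)] agree that \<psi>(2,4) by simp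
      then have "s \<psi> = s \<psi>'" by (rule eq)
      then show "\<phi> = \<phi>'" by (simp only: \<psi>(2,4))
    qed
  qed
qed

lemma characters_mult: "\<psi> \<in> characters \<Longrightarrow> \<phi> \<in> characters \<Longrightarrow> (\<lambda>x. \<psi> x * \<phi> x) \<in> characters"
  by (auto simp: characters_def norm_mult intro!: continuous_on_mult)

lemma characters_cnj: "\<psi> \<in> characters \<Longrightarrow> (\<lambda>x. cnj (\<psi> x)) \<in> characters"
  by (auto simp: characters_def intro!: continuous_on_cnj)

context padic_haar
begin

text \<open>
  The functions \<open>e (\<psi>, i)\<close> with \<open>\<psi> \<in> A\<close> are orthonormal because distinct characters in \<open>A\<close> differ on
  \<open>pball M\<close>.  They are complete because a function orthogonal to them is orthogonal to every character
  of the tower: on each coset such a character is proportional to its representative in \<open>A\<close>.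
\<close>

theorem riesz_basis_union_of_cosets:
  fixes c :: "nat \<Rightarrow> 'p padic" and J :: nat
  assumes Om [measurable]: "\<Omega> \<in> sets borel" and fin: "emeasure \<mu> \<Omega> < \<infinity>"
    and inj: "inj_on (\<lambda>i. padic_char M (c i)) {..<J}"
    and ae: "AE x in \<mu>. x \<in> \<Omega> \<longleftrightarrow> (\<exists>i<J. x \<in> pcoset M (c i))"
  shows "\<exists>\<Lambda>. \<Lambda> \<subseteq> characters \<and> L2_riesz_basis (restrict_space \<mu> \<Omega>) \<Lambda> (\<lambda>\<psi>. \<psi>)"
proof -
  define N where "N = restrict_space \<mu> \<Omega>"
  have finN: "finite_measure N"
    unfolding N_def by (rule finite_measureI) (use fin in \<open>simp add: emeasure_restrict_space space_restrict_space\<close>)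
  have intN: "(\<integral>x. f x \<partial>N) = (\<integral>x. indicator \<Omega> x *\<^sub>R f x \<partial>\<mu>)" for f :: "'p padic \<Rightarrow> complex"
    unfolding N_def by (rule integral_restrict_space) simp
  have measN: "f \<in> borel_measurable N" if "f \<in> borel_measurable borel" for f :: "'p padic \<Rightarrow> complex"
    unfolding N_def using that by (intro measurable_restrict_space1) (simp add: borel_measurable_haar_iff)
  have aeN: "(AE x in N. P x) \<longleftrightarrow> (AE x in \<mu>. x \<in> \<Omega> \<longrightarrow> P x)" for P
    unfolding N_def by (rule AE_restrict_space_iff) simp
  define h where "h = measure \<mu> (pball M)"
  have h: "h > 0" unfolding h_def by (rule measure_pball_pos)
  define I where "I i = (indicator (pcoset M (c i)) :: 'p padic \<Rightarrow> complex)" for i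
  have I_m [measurable]: "I i \<in> borel_measurable borel" for i unfolding I_def by measurable
  have uniq: "i = j" if "x \<in> pcoset M (c i)" "x \<in> pcoset M (c j)" "i < J" "j < J" for x i j
    using inj_onD[OF inj, of i j] that by (simp add: pcoset_iff)
  have sum_I: "(\<Sum>i<J. a i * I i x) = a j" if x: "x \<in> pcoset M (c j)" "j < J" for a x j
  proof -
    have "(\<Sum>i<J. a i * I i x) = (\<Sum>i<J. if i = j then a i else 0)"
    proof (rule sum.cong[OF refl])
      fix i assume i: "i \<in> {..<J}"
      show "a i * I i x = (if i = j then a i else 0)"
      proof (cases "i = j")
        case True
        then show ?thesis using x(1) by (simp add: I_def)
      next
        case False
        then have "x \<notin> pcoset M (c i)" using uniq[of x i j] x i by blast
        then show ?thesis using False by (simp add: I_def)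
      qed
    qed
    then show ?thesis using x(2) by (simp add: sum.delta)
  qed
  obtain A :: "('p padic \<Rightarrow> complex) set" where A1: "A \<subseteq> tower_chars"
    and A2: "\<forall>\<psi>\<in>tower_chars. \<exists>\<phi>\<in>A. \<forall>h\<in>pball M. \<phi> h = \<psi> h"
    and A3: "\<forall>\<phi>\<in>A. \<forall>\<phi>'\<in>A. (\<forall>h\<in>pball M. \<phi> h = \<phi>' h) \<longrightarrow> \<phi> = \<phi>'"
    by (rule ex_transversal)
  have Ac: "\<psi> \<in> characters" if "\<psi> \<in> A" for \<psi> using subsetD[OF A1 that] by (rule tower_chars_characters)
  have cntA: "countable A" by (rule countable_subset[OF A1 countable_tower_chars])
  define e where "e q x = fst q x * I (snd q) x * of_real (1 / sqrt h)" for q :: "('p padic \<Rightarrow> complex) \<times> nat" and x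
  define f where "f q x = fst q x * padic_char M x ^ snd q" for q :: "('p padic \<Rightarrow> complex) \<times> nat" and x
  have char_m: "\<psi> \<in> borel_measurable borel" if "\<psi> \<in> A" for \<psi>
    by (rule borel_measurable_characters[OF Ac[OF that]])
  have eL: "e (\<psi>, i) \<in> L2 N" if "\<psi> \<in> A" for \<psi> i
  proof (rule L2_bounded[OF finN measN])
    note [measurable] = char_m[OF that]
    show "e (\<psi>, i) \<in> borel_measurable borel" unfolding e_def by simp
    show "cmod (e (\<psi>, i) x) \<le> 1 / sqrt h" for x
      using h by (simp add: e_def norm_mult character_norm[OF Ac[OF that]] I_def indicator_def norm_divide)
  qed
  have fL: "f (\<psi>, j) \<in> L2 N" if "\<psi> \<in> A" for \<psi> j
  proof (rule L2_bounded[OF finN measN])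
    note [measurable] = char_m[OF that]
    show "f (\<psi>, j) \<in> borel_measurable borel" unfolding f_def by simp
    show "cmod (f (\<psi>, j) x) \<le> 1" for x
      by (simp add: f_def norm_mult norm_power character_norm[OF Ac[OF that]])
  qed
  have orth: "L2_inner N (e (\<psi>, i)) (e (\<phi>, j)) = (if (\<psi>, i) = (\<phi>, j) then 1 else 0)"
    if q: "\<psi> \<in> A" "i < J" "\<phi> \<in> A" "j < J" for \<psi> i \<phi> j
  proof (cases "i = j")
    case False
    have "I i x * I j x = 0" for x using uniq[of x i j] q False by (auto simp: I_def indicator_def)
    then have z: "e (\<psi>, i) x * cnj (e (\<phi>, j) x) = 0" for x by (auto simp: e_def I_def)
    show ?thesis unfolding L2_inner_def z using False by simp
  next
    case True
    note [measurable] = char_m[OF q(1)] char_m[OF q(3)]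
    define \<theta> where "\<theta> = (\<lambda>x. \<psi> x * cnj (\<phi> x))"
    have \<theta>: "\<theta> \<in> characters" unfolding \<theta>_def by (intro characters_mult characters_cnj Ac q)
    have \<theta>m [measurable]: "\<theta> \<in> borel_measurable borel" by (rule borel_measurable_characters[OF \<theta>])
    have hh: "complex_of_real (1 / sqrt h) * complex_of_real (1 / sqrt h) = complex_of_real (1 / h)"
      unfolding of_real_mult[symmetric] using h by (simp add: real_sqrt_mult_self)
    have "L2_inner N (e (\<psi>, i)) (e (\<phi>, j)) = (\<integral>x. indicator \<Omega> x *\<^sub>R (e (\<psi>, i) x * cnj (e (\<phi>, j) x)) \<partial>\<mu>)"
      unfolding L2_inner_def by (rule intN)
    also have "\<dots> = (\<integral>x. complex_of_real (1 / h) * (\<theta> x * I i x) \<partial>\<mu>)"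
    proof (rule integral_cong_AE)
      have em: "e (\<psi>, i) \<in> borel_measurable borel" "e (\<phi>, j) \<in> borel_measurable borel"
        unfolding e_def by simp_all
      note [measurable] = em
      show "(\<lambda>x. indicator \<Omega> x *\<^sub>R (e (\<psi>, i) x * cnj (e (\<phi>, j) x))) \<in> borel_measurable \<mu>"
        unfolding borel_measurable_haar_iff by measurable
      show "(\<lambda>x. complex_of_real (1 / h) * (\<theta> x * I i x)) \<in> borel_measurable \<mu>"
        unfolding borel_measurable_haar_iff by measurable
      show "AE x in \<mu>. indicator \<Omega> x *\<^sub>R (e (\<psi>, i) x * cnj (e (\<phi>, j) x)) = complex_of_real (1 / h) * (\<theta> x * I i x)"
        using ae
      proof eventually_elim
        case (elim x)
        have "e (\<psi>, i) x * cnj (e (\<phi>, j) x) = (complex_of_real (1 / sqrt h) * complex_of_real (1 / sqrt h)) * (\<theta> x * I i x)"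
          using True by (simp add: e_def \<theta>_def I_def indicator_def)
        moreover have "indicator \<Omega> x *\<^sub>R I i x = I i x" using elim q by (auto simp: I_def indicator_def)
        ultimately show ?case unfolding hh by (auto simp: indicator_def)
      qed
    qed
    also have "\<dots> = complex_of_real (1 / h) * (\<integral>x. \<theta> x * I i x \<partial>\<mu>)" by simp
    also have "(\<integral>x. \<theta> x * I i x \<partial>\<mu>) = (if \<psi> = \<phi> then complex_of_real h else 0)"
    proof (cases "\<psi> = \<phi>")
      case True
      have "\<theta> x = 1" for x
        unfolding \<theta>_def True complex_norm_square[symmetric] character_norm[OF Ac[OF q(3)]] by simp
      then have "(\<integral>x. \<theta> x * I i x \<partial>\<mu>) = (\<integral>x. complex_of_real (indicator (pcoset M (c i)) x) \<partial>\<mu>)"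
        by (intro Bochner_Integration.integral_cong refl) (simp add: I_def indicator_def)
      also have "\<dots> = complex_of_real h" by (simp add: measure_pcoset h_def)
      finally show ?thesis using True by simp
    next
      case False
      then obtain g where g: "g \<in> pball M" "\<psi> g \<noteq> \<phi> g" using A3 q(1,3) by blast
      have "\<theta> g \<noteq> 1"
      proof
        assume "\<theta> g = 1"
        then have "\<psi> g * (\<phi> g * cnj (\<phi> g)) = \<phi> g" by (simp add: \<theta>_def mult_ac)
        then have "\<psi> g = \<phi> g"
          unfolding complex_norm_square[symmetric] character_norm[OF Ac[OF q(3)]] by simp
        then show False using g by simp
      qed
      then show ?thesis using integral_character_pcoset[OF \<theta> g(1), of "c i"] False by (simp add: I_def)
    qed
    finally show ?thesis using True h by simp
  qed
  have triv: "AE x in N. g x = 0"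
    if g: "g \<in> L2 N" and zero: "\<And>q. q \<in> A \<times> {..<J} \<Longrightarrow> L2_inner N g (e q) = 0" for g
  proof -
    define k where "k x = indicator \<Omega> x *\<^sub>R cnj (g x)" for x
    have one: "(\<lambda>x. 1) \<in> L2 N" by (rule L2_bounded[OF finN, of _ 1]) auto
    have "integrable N (\<lambda>x. cnj (g x))" using L2_integrable_mult[OF L2_cnj[OF g] one] by simp
    then have k: "integrable \<mu> k"
      unfolding N_def k_def using integrable_restrict_space[of \<Omega> \<mu> "\<lambda>x. cnj (g x)"] by simp
    have km [measurable]: "k \<in> borel_measurable borel"
      using borel_measurable_integrable[OF k] by (simp add: borel_measurable_haar_iff)
    have kI: "integrable \<mu> (\<lambda>x. k x * (\<psi> x * I i x))" if \<psi>: "\<psi> \<in> characters" for \<psi> i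
    proof (rule Bochner_Integration.integrable_bound[OF k])
      note [measurable] = borel_measurable_characters[OF \<psi>]
      show "(\<lambda>x. k x * (\<psi> x * I i x)) \<in> borel_measurable \<mu>" unfolding borel_measurable_haar_iff by measurable
      show "AE x in \<mu>. norm (k x * (\<psi> x * I i x)) \<le> norm (k x)"
        by (rule AE_I2) (simp add: norm_mult character_norm[OF \<psi>] I_def indicator_def)
    qed
    have zA: "(\<integral>x. k x * (\<psi> x * I i x) \<partial>\<mu>) = 0" if q: "\<psi> \<in> A" "i < J" for \<psi> i
    proof -
      have "L2_inner N g (e (\<psi>, i)) = 0" using zero q by simp
      then have "0 = cnj (L2_inner N g (e (\<psi>, i)))" by simp
      also have "\<dots> = (\<integral>x. cnj (indicator \<Omega> x *\<^sub>R (g x * cnj (e (\<psi>, i) x))) \<partial>\<mu>)"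
        unfolding L2_inner_def intN by (rule Bochner_Integration.integral_cnj[symmetric])
      also have "\<dots> = (\<integral>x. complex_of_real (1 / sqrt h) * (k x * (\<psi> x * I i x)) \<partial>\<mu>)"
        by (rule Bochner_Integration.integral_cong[OF refl]) (simp add: k_def e_def indicator_def)
      also have "\<dots> = complex_of_real (1 / sqrt h) * (\<integral>x. k x * (\<psi> x * I i x) \<partial>\<mu>)" by simp
      finally show ?thesis using h by simp
    qed
    \<comment> \<open>On a coset of \<open>pball M\<close> a character is a constant times its representative in \<open>A\<close>.\<close>
    have zX: "(\<integral>x. k x * (\<psi> x * I i x) \<partial>\<mu>) = 0" if \<psi>: "\<psi> \<in> tower_chars" and i: "i < J" for \<psi> i
    proof -
      have \<psi>c: "\<psi> \<in> characters" by (rule tower_chars_characters[OF \<psi>])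
      obtain \<phi> where \<phi>: "\<phi> \<in> A" "\<forall>h\<in>pball M. \<phi> h = \<psi> h" using A2 \<psi> by blast
      have \<phi>0: "\<phi> y \<noteq> 0" for y using character_norm[OF Ac[OF \<phi>(1)], of y] by auto
      have eq: "\<psi> x * I i x = \<psi> (c i) / \<phi> (c i) * (\<phi> x * I i x)" for x
      proof (cases "x \<in> pcoset M (c i)")
        case True
        have "\<psi> x = \<psi> (x - c i) * \<psi> (c i)" "\<phi> x = \<phi> (x - c i) * \<phi> (c i)"
          using character_add[OF \<psi>c, of "x - c i" "c i"] character_add[OF Ac[OF \<phi>(1)], of "x - c i" "c i"] by simp_all
        moreover have "\<phi> (x - c i) = \<psi> (x - c i)" using \<phi>(2) True by (simp add: pcoset_def)
        ultimately show ?thesis using \<phi>0[of "c i"] by simp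
      qed (simp add: I_def)
      have "(\<integral>x. k x * (\<psi> x * I i x) \<partial>\<mu>) = (\<integral>x. \<psi> (c i) / \<phi> (c i) * (k x * (\<phi> x * I i x)) \<partial>\<mu>)"
        unfolding eq by (simp add: mult_ac)
      also have "\<dots> = \<psi> (c i) / \<phi> (c i) * (\<integral>x. k x * (\<phi> x * I i x) \<partial>\<mu>)" by simp
      finally show ?thesis using zA[OF \<phi>(1) i] by simp
    qed
    have "(\<integral>x. k x * \<psi> x \<partial>\<mu>) = 0" if \<psi>: "\<psi> \<in> tower_chars" for \<psi>
    proof -
      have \<psi>c: "\<psi> \<in> characters" by (rule tower_chars_characters[OF \<psi>])
      note [measurable] = borel_measurable_characters[OF \<psi>c]
      have "(\<integral>x. k x * \<psi> x \<partial>\<mu>) = (\<integral>x. (\<Sum>i<J. k x * (\<psi> x * I i x)) \<partial>\<mu>)"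
      proof (rule integral_cong_AE)
        show "(\<lambda>x. k x * \<psi> x) \<in> borel_measurable \<mu>" unfolding borel_measurable_haar_iff by measurable
        show "(\<lambda>x. \<Sum>i<J. k x * (\<psi> x * I i x)) \<in> borel_measurable \<mu>" unfolding borel_measurable_haar_iff by measurable
        show "AE x in \<mu>. k x * \<psi> x = (\<Sum>i<J. k x * (\<psi> x * I i x))"
          using ae
        proof eventually_elim
          case (elim x)
          show ?case
          proof (cases "x \<in> \<Omega>")
            case True
            then obtain j where "j < J" "x \<in> pcoset M (c j)" using elim by blast
            then show ?thesis using sum_I[of x j "\<lambda>_. k x * \<psi> x"] by (simp add: mult.assoc)
          qed (simp add: k_def)
        qed
      qed
      also have "\<dots> = (\<Sum>i<J. \<integral>x. k x * (\<psi> x * I i x) \<partial>\<mu>)"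
        by (rule Bochner_Integration.integral_sum) (rule kI[OF \<psi>c])
      also have "\<dots> = 0" using zX[OF \<psi>] by simp
      finally show ?thesis .
    qed
    then have "(\<integral>x. k x * padic_char m x ^ j \<partial>\<mu>) = 0" for m j
      by (auto simp: tower_chars_def)
    then have "AE x in \<mu>. k x = 0"
      by (intro AE_zero_of_integral_pcosets[OF k] integral_pcoset_zero_of_powers[OF k])
    then show ?thesis unfolding aeN by eventually_elim (auto simp: k_def indicator_def)
  qed
  have basis: "L2_orthonormal_basis N (A \<times> {..<J}) e"
  proof (rule L2_orthonormal_basisI[OF finN])
    show "countable (A \<times> {..<J})" by (intro countable_SIGMA cntA) auto
    show "e q \<in> L2 N" if "q \<in> A \<times> {..<J}" for q using that eL by auto
    show "L2_inner N (e q) (e r) = (if q = r then 1 else 0)" if "q \<in> A \<times> {..<J}" "r \<in> A \<times> {..<J}" for q r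
    proof -
      obtain \<psi> i \<phi> j where qr: "q = (\<psi>, i)" "r = (\<phi>, j)" by (cases q, cases r)
      have "\<psi> \<in> A" "i < J" "\<phi> \<in> A" "j < J" using that qr by auto
      then show ?thesis unfolding qr by (rule orth)
    qed
  qed (rule triv)
  obtain W where W: "\<And>i j. i < J \<Longrightarrow> j < J \<Longrightarrow> (\<Sum>l<J. padic_char M (c i) ^ l * W l j) = (if i = j then 1 else 0)"
    "\<And>i j. i < J \<Longrightarrow> j < J \<Longrightarrow> (\<Sum>l<J. W i l * padic_char M (c l) ^ j) = (if i = j then 1 else 0)"
    using vandermonde_inverse[OF inj] by blast
  define s where "s = complex_of_real (sqrt h)"
  have s: "s \<noteq> 0" "s * complex_of_real (1 / sqrt h) = 1"
    using h unfolding s_def of_real_mult[symmetric] by simp_all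
  have riesz: "L2_riesz_basis N (A \<times> {..<J}) f"
  proof (rule L2_riesz_basis_block[OF finN cntA basis,
        where V = "\<lambda>i j. s * padic_char M (c i) ^ j" and W = "\<lambda>i j. W i j / s"])
    show "(\<Sum>l<J. s * padic_char M (c i) ^ l * (W l j / s)) = (if i = j then 1 else 0)" if "i < J" "j < J" for i j
      using W(1)[OF that] s(1) by simp
    show "(\<Sum>l<J. W i l / s * (s * padic_char M (c l) ^ j)) = (if i = j then 1 else 0)" if "i < J" "j < J" for i j
      using W(2)[OF that] s(1) by simp
    show "f (\<psi>, j) \<in> L2 N" if "\<psi> \<in> A" for \<psi> j by (rule fL[OF that])
    show "AE x in N. f (\<psi>, j) x = (\<Sum>i<J. s * padic_char M (c i) ^ j * e (\<psi>, i) x)" if "\<psi> \<in> A" for \<psi> j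
      unfolding aeN using ae
    proof eventually_elim
      case (elim x)
      show ?case
      proof
        assume "x \<in> \<Omega>"
        then obtain l where l: "l < J" "x \<in> pcoset M (c l)" using elim by blast
        have "(\<Sum>i<J. s * padic_char M (c i) ^ j * e (\<psi>, i) x)
            = (\<Sum>i<J. (s * complex_of_real (1 / sqrt h) * (padic_char M (c i) ^ j * \<psi> x)) * I i x)"
          by (rule sum.cong[OF refl]) (simp add: e_def mult_ac)
        also have "\<dots> = s * complex_of_real (1 / sqrt h) * (padic_char M (c l) ^ j * \<psi> x)" by (rule sum_I[OF l(2,1)])
        also have "\<dots> = f (\<psi>, j) x"
          unfolding s(2) using l(2) by (simp add: f_def pcoset_iff mult.commute)
        finally show "f (\<psi>, j) x = (\<Sum>i<J. s * padic_char M (c i) ^ j * e (\<psi>, i) x)" ..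
      qed
    qed
  qed
  have "f ` (A \<times> {..<J}) \<subseteq> characters"
  proof
    fix \<psi> assume "\<psi> \<in> f ` (A \<times> {..<J})"
    then obtain \<phi> j where "\<phi> \<in> A" and \<psi>: "\<psi> = f (\<phi>, j)" by auto
    then show "\<psi> \<in> characters"
      unfolding \<psi> f_def using characters_mult[OF Ac padic_char_power_characters] by simp
  qed
  then show ?thesis using L2_riesz_basis_image[OF riesz] unfolding N_def by blast
qed

end

theorem corollary1p3:
  fixes \<mu> :: "'p::prime_card padic measure"
    and \<Omega> :: "'p padic set"
    and k :: nat
  assumes "haar_measure \<mu>"
    and "k \<ge> 1"
    and "\<Omega> \<in> sets borel"
    and "0 < emeasure \<mu> \<Omega>" and "emeasure \<mu> \<Omega> < \<infinity>"
    and "k_tiles \<mu> k \<Omega>"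
  shows "\<exists>\<Lambda>. \<Lambda> \<subseteq> characters \<and> L2_riesz_basis (restrict_space \<mu> \<Omega>) \<Lambda> (\<lambda>\<psi>. \<psi>)"
proof -
  obtain T where T: "AE x in \<mu>. ((\<lambda>t. indicator \<Omega> (x - t) :: real) has_sum real k) T"
    using assms(6) unfolding k_tiles_def by blast
  interpret padic_tiling \<mu> \<Omega> T k
    by unfold_locales (use assms T in auto)
  obtain M where M: "\<And>L r h. h \<in> pball M \<Longrightarrow> padic_char L (h :: 'p padic) ^ r \<noteq> 1 \<Longrightarrow>
     (\<integral>y. indicator \<Omega> y * padic_char L y ^ r \<partial>\<mu>) = 0"
    using high_frequency_transform_zero by blast
  obtain J c where "inj_on (\<lambda>i. padic_char M (c i :: 'p padic)) {..<J::nat}"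
    "AE x in \<mu>. x \<in> \<Omega> \<longleftrightarrow> (\<exists>i<J. x \<in> pcoset M (c i))"
    using Omega_AE_union_of_cosets[of M] M by blast
  then show ?thesis by (rule riesz_basis_union_of_cosets[OF assms(3,5)])
qed

end
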